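(* Let $W, W_1,W_2,\dots$ be i.i.d. random vectors in $\mathbb{R}^m$ (with the samples $W_1,\dots,W_n$ distinct), let $h:\mathbb{R}^m\times\mathbb{R}^l\to\mathbb{R}^r$, and assume: A1) $c(u,w)=\|u-w\|_q^\rho$ with $q\ge1$ and $\rho\ge1$, and $p$ is such that $1/p+1/q=1$; A2) $\theta_*\in\mathbb{R}^l$ satisfies $\mathbb{E}[h(W,\theta_* )]=\mathbf 0$ and $\mathbb{E}\|h(W,\theta_* )\|_2^2<\infty$; A3) $h(\cdot,\theta_* )$ is continuously differentiable with derivative $D_wh(\cdot,\theta_* )$; A4) for each $\zeta\in\mathbb{R}^r$, $\zeta\ne0$, $\ \Pr\big(\|\zeta^TD_wh(W,\theta_* )\|_p>0\big)>0$. Let $R_n(\theta;\rho)=\inf\{\mathcal{D}_c(\mathbb{P},\mathbb{P}_n):\mathbb{E}_{\mathbb{P}}[h(W,\theta)]=\mathbf 0\}$. Then, as $n\to\infty$, $$n^{\rho/2}R_n(\theta_*;\rho)\lesssim_D\bar R(\rho),$$ where, for $\rho>1$, $$\bar R(\rho):=\max_{\zeta\in\mathbb{R}^r}\Big\{\rho\,\zeta^TH-(\rho-1)\,\mathbb{E}\big\|\zeta^TD_wh(W,\theta_* )\big\|_p^{\rho/(\rho-1)}\Big\},$$ and, for $\rho=1$, $$\bar R(1):=\max\Big\{\zeta^TH:\ \zeta\in\mathbb{R}^r,\ \Pr\big(\|\zeta^TD_wh(W,\theta_* )\|_p>1\big)=0\Big\}.$$ In both cases $H\sim\mathcal{N}(\mathbf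 0,\mathrm{Cov}[h(W,\theta_* )])$ with $\mathrm{Cov}[h(W,\theta_* )]=\mathbb{E}[h(W,\theta_* )h(W,\theta_* )^T]$ (the inner expectation and probability over $W$ are taken with $\zeta$ and $H$ fixed).
   Context: $\mathbb{P}_n=\frac1n\sum_{i=1}^n\delta_{W_i}$. For a cost $c$, $\mathcal{D}_c(\mathbb{P},\mathbb{Q})=\inf\{\mathbb{E}_\pi[c(U,W)]\}$ over joint distributions $\pi$ on $\mathbb{R}^m\times\mathbb{R}^m$ with marginals $\pi_U=\mathbb{P}$, $\pi_W=\mathbb{Q}$. The infimum in $R_n$ is over Borel probability measures $\mathbb{P}$ on $\mathbb{R}^m$ (with $W\sim\mathbb{P}$ under $\mathbb{E}_{\mathbb{P}}$). $D_wh$ is the $r\times m$ Jacobian in the first argument. Notation: $A_n\lesssim_DA$ means that for every continuous, bounded, non-decreasing $f:\mathbb{R}\to\mathbb{R}$, $\limsup_{n\to\infty}\mathbb{E}[f(A_n)]\le\mathbb{E}[f(A)]$. In A1, $q=\infty$ (with $p=1$) is allowed. *)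

theory Defs
  imports "HOL-Probability.Probability"
begin

text \<open>The \<open>l_p\<close> norm for an exponent \<open>p \<in> [1, \<infinity>]\<close>. Extended nonnegative exponents are used so that
  \<open>1 / p + 1 / q = 1\<close> covers the conjugate pairs \<open>(1, \<infinity>)\<close> and \<open>(\<infinity>, 1)\<close>, since \<open>1 / \<infinity> = 0\<close>.\<close>

definition lp_norm :: "ennreal \<Rightarrow> real ^ 'n \<Rightarrow> real" where
  "lp_norm p x =
     (if p = \<infinity> then (MAX i. \<bar>x $ i\<bar>)
      else (\<Sum>i\<in>UNIV. \<bar>x $ i\<bar> powr enn2real p) powr (1 / enn2real p))"

definition couplings ::
    "'a::topological_space measure \<Rightarrow> 'a measure \<Rightarrow> ('a \<times> 'a) measure set" where
  "couplings P Q =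
     {\<pi>. prob_space \<pi> \<and> sets \<pi> = sets borel \<and> distr \<pi> borel fst = P \<and> distr \<pi> borel snd = Q}"

text \<open>For nonnegative costs only: negative values of \<open>c\<close> would be truncated by \<^const>\<open>ennreal\<close>.\<close>

definition transport_cost ::
    "('a::topological_space \<Rightarrow> 'a \<Rightarrow> real) \<Rightarrow> 'a measure \<Rightarrow> 'a measure \<Rightarrow> ennreal" where
  "transport_cost c P Q = (INF \<pi>\<in>couplings P Q. \<integral>\<^sup>+ (u, w). ennreal (c u w) \<partial>\<pi>)"

definition empirical_measure :: "nat \<Rightarrow> (nat \<Rightarrow> 'a::topological_space) \<Rightarrow> 'a measure" where
  "empirical_measure n x = distr (uniform_count_measure {1..n}) borel x"

text \<open>The equation \<open>E\<^sub>P[h(W, \<theta>)] = 0\<close> includes the existence of the expectation. The value is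
  \<open>\<infinity>\<close> if no probability measure satisfies it.\<close>

definition profile_function ::
    "('a::topological_space \<Rightarrow> 'a \<Rightarrow> real) \<Rightarrow> ('a \<Rightarrow> 't \<Rightarrow> 'b::{banach, second_countable_topology})
      \<Rightarrow> 'a measure \<Rightarrow> 't \<Rightarrow> ennreal" where
  "profile_function c h Q \<theta> =
     (INF P\<in>{P. prob_space P \<and> sets P = sets borel \<and>
                integrable P (\<lambda>w. h w \<theta>) \<and> (\<integral>w. h w \<theta> \<partial>P) = 0}.
        transport_cost c P Q)"

text \<open>The univariate normal law with mean \<open>\<mu>\<close> and variance \<open>v\<close>, a point mass if \<open>v = 0\<close>.\<close>

definition normal_law :: "real \<Rightarrow> real \<Rightarrow> real measure" where
  "normal_law \<mu> v =
     (if v = 0 then return borel \<mu> else density lborel (\<lambda>x. ennreal (normal_density \<mu> (sqrt v) x)))"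

text \<open>\<open>H \<sim> N(0, S)\<close> for a possibly singular covariance matrix \<open>S\<close>: every linear functional of \<open>H\<close>
  is univariate normal with the matching variance.\<close>

definition centered_gaussian_vector ::
    "'b measure \<Rightarrow> ('b \<Rightarrow> real ^ 'r) \<Rightarrow> real ^ 'r ^ 'r \<Rightarrow> bool" where
  "centered_gaussian_vector N H S \<longleftrightarrow>
     prob_space N \<and> H \<in> borel_measurable N \<and>
     (\<forall>v. distr N borel (\<lambda>\<omega>. v \<bullet> H \<omega>) = normal_law 0 (v \<bullet> (S *v v)))"

definition second_moment_matrix :: "'a measure \<Rightarrow> ('a \<Rightarrow> real ^ 'r) \<Rightarrow> real ^ 'r ^ 'r" where
  "second_moment_matrix M X = (\<chi> i j. \<integral>\<omega>. X \<omega> $ i * X \<omega> $ j \<partial>M)"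

text \<open>The values over which the limiting variable is a maximum, when \<open>J\<close> is the random Jacobian and
  \<open>y\<close> is the value of the Gaussian vector. An infinite moment of \<open>\<zeta>\<^sup>T J\<close> gives the value
  \<open>-\<infinity>\<close>, which is why the moment is not a Bochner integral.\<close>

definition limit_values ::
    "ennreal \<Rightarrow> real \<Rightarrow> 'a measure \<Rightarrow> ('a \<Rightarrow> real ^ 'm ^ 'r) \<Rightarrow> real ^ 'r \<Rightarrow> ereal set" where
  "limit_values p \<rho> M J y =
     (if \<rho> = 1
      then {ereal (\<zeta> \<bullet> y) | \<zeta>. measure M {\<omega> \<in> space M. lp_norm p (\<zeta> v* J \<omega>) > 1} = 0}
      else {ereal (\<rho> * (\<zeta> \<bullet> y)) - ereal (\<rho> - 1) *
              enn2ereal (\<integral>\<^sup>+ \<omega>. ennreal (lp_norm p (\<zeta> v* J \<omega>) powr (\<rho> / (\<rho> - 1))) \<partial>M) | \<zeta>. True})"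

definition limit_bound ::
    "ennreal \<Rightarrow> real \<Rightarrow> 'a measure \<Rightarrow> ('a \<Rightarrow> real ^ 'm ^ 'r) \<Rightarrow> real ^ 'r \<Rightarrow> ereal" where
  "limit_bound p \<rho> M J y = Sup (limit_values p \<rho> M J y)"

text \<open>The extension of a bounded nondecreasing function by its limits at \<open>\<plusminus>\<infinity>\<close>. It is needed because
  the profile function may be infinite.\<close>

definition extend_mono :: "(real \<Rightarrow> real) \<Rightarrow> ereal \<Rightarrow> real" where
  "extend_mono f x = (case x of ereal r \<Rightarrow> f r | PInfty \<Rightarrow> (SUP r. f r) | MInfty \<Rightarrow> (INF r. f r))"

text \<open>\<open>A\<^sub>n \<lesssim>\<^sub>D B\<close>, where the \<open>A\<^sub>n\<close> live on \<open>M\<close> and \<open>B\<close> on \<open>N\<close>. Measurability is part of the notion,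
  as the Bochner integral of a nonmeasurable function is \<open>0\<close>.\<close>

definition asymp_stoch_le ::
    "'a measure \<Rightarrow> (nat \<Rightarrow> 'a \<Rightarrow> ereal) \<Rightarrow> 'b measure \<Rightarrow> ('b \<Rightarrow> ereal) \<Rightarrow> bool" where
  "asymp_stoch_le M A N B \<longleftrightarrow>
     (\<forall>n. A n \<in> borel_measurable M) \<and> B \<in> borel_measurable N \<and>
     (\<forall>f. continuous_on UNIV f \<and> bounded (range f) \<and> mono f \<longrightarrow>
        limsup (\<lambda>n. ereal (\<integral>\<omega>. extend_mono f (A n \<omega>) \<partial>M)) \<le> ereal (\<integral>\<omega>. extend_mono f (B \<omega>) \<partial>N))"

end

theory Submission
  imports Defs
begin

text \<open>Only an upper bound for the profile function is needed, so it suffices to exhibit good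
  competitors. Replace each sample \<open>W\<^sub>i\<close> by \<open>W\<^sub>i + n\<^sup>-\<^sup>1\<^sup>/\<^sup>2 v(W\<^sub>i)\<close> for a bounded,
  boundedly supported field \<open>v\<close>. To first order the moment condition reads
  \<open>E[D\<^sub>wh(W,\<theta>) v(W)] = -H\<^sub>n\<close> with \<open>H\<^sub>n\<close> the normalised sum of the \<open>h(W\<^sub>i,\<theta>)\<close>, and the scaled cost is
  \<open>E \<parallel>v(W)\<parallel>\<^sub>q\<^sup>\<rho>\<close>. Minimising this cost under finitely many linear constraints is a convex problem
  whose Lagrangian dual, with the supremum taken inside the expectation and evaluated by the equality
  case of Young's inequality, is the limiting variable at \<open>H\<^sub>n\<close>. Finitely many fields serve
  all values of \<open>H\<^sub>n\<close> in a compact set; Brouwer's fixed point theorem turns the first-order moment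
  condition into an exact one, and laws of large numbers control the errors. The limiting variable is a
  finite convex, hence continuous, function of the Gaussian vector, so the multivariate central limit
  theorem concludes. For measurability, a coupling with the empirical measure can be moved along with the
  sample, which shows that the profile function is upper semicontinuous in the sample.\<close>

section \<open>The \<open>l\<^sub>p\<close> norms and duality\<close>

text \<open>Only continuity of the Jacobian is available: no moment of it is assumed finite, and
  \<open>h\<close> may grow arbitrarily. This is why displacements are cut down to bounded fields
  with bounded support. Along such a field everything built from the Jacobian is bounded, the
  linearisation error is uniform, and a weak law for bounded vectors suffices. The price is that an
  optimal field need not exist in this class, so duality only yields fields of cost at most
  \<open>a\<close> for each \<open>a\<close> above the limiting variable. Nondegeneracy enters as
  surjectivity of \<open>drift\<close>, which has three effects: the multiplier of the cost is
  positive, the penalty in the dual problem is coercive (so its maximum is finite and attained), and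
  there are correction fields whose drifts are the unit vectors. There are as many correction
  parameters as moment equations, which is what Brouwer's theorem needs. The cases
  \<open>\<rho> = 1\<close> and \<open>\<rho> > 1\<close> differ in the pointwise conjugate of the
  cost: for \<open>\<rho> = 1\<close> it is 0 or infinite, so an almost sure constraint replaces the
  moment.\<close>

lemma lp_norm_nonneg: "0 \<le> lp_norm p x"
proof -
  have "0 \<le> (MAX i. \<bar>x $ i\<bar>)"
    by (rule order_trans[OF abs_ge_zero[of "x $ undefined"] Max_ge]) auto
  then show ?thesis by (simp add: lp_norm_def)
qed

lemma lp_norm_zero [simp]: "lp_norm p 0 = 0"
  by (simp add: lp_norm_def)

lemma component_le_lp_norm:
  assumes "p \<ge> 1" shows "\<bar>x $ i\<bar> \<le> lp_norm p x"
proof (cases "p = \<infinity>")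
  case True
  then show ?thesis by (auto simp: lp_norm_def intro: Max_ge)
next
  case False
  then obtain p' where p': "p = ennreal p'" "1 \<le> p'"
    using assms by (cases p) (auto simp: ennreal_1[symmetric] simp del: ennreal_1)
  have "\<bar>x $ i\<bar> = (\<bar>x $ i\<bar> powr p') powr (1 / p')"
    using p' by (simp add: powr_powr)
  also have "\<dots> \<le> (\<Sum>i\<in>UNIV. \<bar>x $ i\<bar> powr p') powr (1 / p')"
    using p' by (intro powr_mono2 member_le_sum) auto
  finally show ?thesis using p' by (simp add: lp_norm_def)
qed

lemma lp_norm_scaleR:
  assumes "p \<ge> 1" shows "lp_norm p (a *\<^sub>R x) = \<bar>a\<bar> * lp_norm p x"
proof (cases "p = \<infinity>")
  case True
  have "(MAX i. \<bar>a\<bar> * \<bar>x $ i\<bar>) = \<bar>a\<bar> * (MAX i. \<bar>x $ i\<bar>)"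
    using mono_Max_commute[of "\<lambda>t. \<bar>a\<bar> * t" "range (\<lambda>i. \<bar>x $ i\<bar>)"]
    by (simp add: image_image monoI mult_left_mono)
  then show ?thesis using True by (simp add: lp_norm_def abs_mult)
next
  case False
  then obtain p' where p': "p = ennreal p'" "1 \<le> p'"
    using assms by (cases p) (auto simp: ennreal_1[symmetric] simp del: ennreal_1)
  then show ?thesis
    by (simp add: lp_norm_def abs_mult powr_mult sum_distrib_left[symmetric] powr_powr sum_nonneg)
qed

lemma lp_norm_minus: "lp_norm p (- x) = lp_norm p x"
  by (simp add: lp_norm_def)

lemma lp_norm_minus_commute: "lp_norm p (x - y) = lp_norm p (y - x)"
  using lp_norm_minus[of p "x - y"] by simp

text \<open>At an endpoint 0 the inequality reduces to \<open>s powr p \<le> s\<close> for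
  \<open>s\<close> between 0 and 1; elsewhere it is convexity on the open half-line.\<close>

lemma powr_convex_on_nonneg:
  assumes "(p::real) \<ge> 1" shows "convex_on {0..} (\<lambda>x. x powr p)"
proof (rule convex_onI)
  fix t x y :: real assume t: "0 < t" "t < 1" and xy: "x \<in> {0..}" "y \<in> {0..}"
  have small: "s powr p \<le> s" if "0 \<le> s" "s \<le> 1" for s
    using powr_mono'[of 1 p s] that assms by (cases "s = 0") auto
  consider "x = 0" | "y = 0" | "x > 0" "y > 0" using xy by fastforce
  then show "((1 - t) *\<^sub>R x + t *\<^sub>R y) powr p \<le> (1 - t) * x powr p + t * y powr p"
  proof cases
    case 1
    then show ?thesis using t xy small[of t] by (simp add: powr_mult mult_right_mono)
  next
    case 2
    then show ?thesis using t xy small[of "1 - t"] by (simp add: powr_mult mult_right_mono)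
  next
    case 3
    then show ?thesis
      using convex_onD[OF powr_convex[OF assms], of t x y] t by simp
  qed
qed simp

lemma lp_norm_triangle:
  assumes "p \<ge> 1" shows "lp_norm p (x + y) \<le> lp_norm p x + lp_norm p y"
proof (cases "p = \<infinity>")
  case True
  have "\<bar>(x + y) $ i\<bar> \<le> lp_norm p x + lp_norm p y" for i
    using component_le_lp_norm[OF assms, of x i] component_le_lp_norm[OF assms, of y i] by simp
  then show ?thesis using True by (simp add: lp_norm_def)
next
  case False
  then obtain p' where p': "p = ennreal p'" "1 \<le> p'"
    using assms by (cases p) (auto simp: ennreal_1[symmetric] simp del: ennreal_1)
  define a where "a = lp_norm p x"
  define b where "b = lp_norm p y"
  have ab: "0 \<le> a" "0 \<le> b" by (simp_all add: a_def b_def lp_norm_nonneg)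
  have powr_eq: "(\<Sum>i\<in>UNIV. \<bar>z $ i\<bar> powr p') = lp_norm p z powr p'" for z :: "real ^ 'n"
    using p' by (simp add: lp_norm_def powr_powr sum_nonneg)
  have zero: "z = 0" if "lp_norm p z = 0" for z :: "real ^ 'n"
    using component_le_lp_norm[OF assms, of z] that by (simp add: vec_eq_iff)
  show ?thesis
  proof (cases "a = 0 \<or> b = 0")
    case True
    then show ?thesis using zero[of x] zero[of y] by (auto simp: a_def b_def)
  next
    case nz: False
    \<comment> \<open>\<open>x + y\<close> is \<open>a + b\<close> times the convex combination,
      with weights \<open>1 - t\<close> and \<open>t\<close>, of the normalised vectors. Convexity
      of the power, summed over the coordinates, then gives Minkowski's inequality.\<close>
    define t where "t = b / (a + b)"
    have t: "0 \<le> t" "t \<le> 1" "1 - t = a / (a + b)" using ab nz by (auto simp: t_def field_simps)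
    have "\<bar>(x + y) $ i\<bar> powr p' \<le> (a + b) powr p' * ((1 - t) * (\<bar>x $ i\<bar> powr p' / a powr p') + t * (\<bar>y $ i\<bar> powr p' / b powr p'))" for i
    proof -
      have "(a + b) * ((1 - t) * (\<bar>x $ i\<bar> / a) + t * (\<bar>y $ i\<bar> / b)) = \<bar>x $ i\<bar> + \<bar>y $ i\<bar>"
        unfolding t(3) unfolding t_def distrib_left using ab nz by simp
      then have "\<bar>(x + y) $ i\<bar> \<le> (a + b) * ((1 - t) * (\<bar>x $ i\<bar> / a) + t * (\<bar>y $ i\<bar> / b))"
        by simp
      then have "\<bar>(x + y) $ i\<bar> powr p' \<le> ((a + b) * ((1 - t) * (\<bar>x $ i\<bar> / a) + t * (\<bar>y $ i\<bar> / b))) powr p'"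
        using p' by (intro powr_mono2) auto
      also have "\<dots> = (a + b) powr p' * ((1 - t) * (\<bar>x $ i\<bar> / a) + t * (\<bar>y $ i\<bar> / b)) powr p'"
        using ab t by (intro powr_mult)
      also have "\<dots> \<le> (a + b) powr p' * ((1 - t) * (\<bar>x $ i\<bar> / a) powr p' + t * (\<bar>y $ i\<bar> / b) powr p')"
        using convex_onD[OF powr_convex_on_nonneg[OF p'(2)] t(1,2), of "\<bar>x $ i\<bar> / a" "\<bar>y $ i\<bar> / b"] ab
        by (intro mult_left_mono) auto
      finally show ?thesis using ab by (simp add: powr_divide)
    qed
    then have "(\<Sum>i\<in>UNIV. \<bar>(x + y) $ i\<bar> powr p') \<le>
       (\<Sum>i\<in>UNIV. (a + b) powr p' * ((1 - t) * (\<bar>x $ i\<bar> powr p' / a powr p') + t * (\<bar>y $ i\<bar> powr p' / b powr p')))"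
      by (rule sum_mono)
    also have "\<dots> = (a + b) powr p' * ((1 - t) * ((\<Sum>i\<in>UNIV. \<bar>x $ i\<bar> powr p') / a powr p') + t * ((\<Sum>i\<in>UNIV. \<bar>y $ i\<bar> powr p') / b powr p'))"
      by (simp only: sum_distrib_left sum.distrib sum_divide_distrib distrib_left)
    also have "\<dots> = (a + b) powr p'"
      using nz ab by (simp add: powr_eq flip: a_def b_def)
    finally have "lp_norm p (x + y) powr p' \<le> (a + b) powr p'" unfolding powr_eq .
    then show ?thesis
      using p' ab powr_less_mono2[of p' "a + b" "lp_norm p (x + y)"] by (fastforce simp: a_def b_def)
  qed
qed

text \<open>Unit vectors have norm 1, so the triangle inequality over the basis expansion bounds
  every l_p norm by the l_1 norm. The crude constant is enough for Lipschitz continuity.\<close>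

lemma lp_norm_le_norm:
  assumes "p \<ge> 1" shows "lp_norm p (x :: real ^ 'n) \<le> real CARD('n) * norm x"
proof (cases "p = \<infinity>")
  case True
  have "\<bar>x $ i\<bar> \<le> real CARD('n) * norm x" for i
    using component_le_norm_cart[of x i] mult_right_mono[of 1 "real CARD('n)" "norm x"] by simp
  then show ?thesis using True by (simp add: lp_norm_def)
next
  case False
  have axis: "lp_norm p (axis i 1 :: real ^ 'n) = 1" for i
    using False assms 
    by (simp add: lp_norm_def axis_def if_distrib[of abs] if_distrib[of "\<lambda>t. t powr _"] cong: if_cong)
  have "lp_norm p (\<Sum>i\<in>A. (x $ i) *\<^sub>R axis i 1) \<le> (\<Sum>i\<in>A. \<bar>x $ i\<bar>)" if "finite A" for A
    using that
  proof induction
    case (insert i A)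
    then show ?case
      using lp_norm_triangle[OF assms, of "(x $ i) *\<^sub>R axis i 1" "\<Sum>i\<in>A. (x $ i) *\<^sub>R axis i 1"]
      by (simp add: lp_norm_scaleR[OF assms] axis)
  qed simp
  from this[of UNIV] have "lp_norm p x \<le> (\<Sum>i\<in>UNIV. \<bar>x $ i\<bar>)"
    by (simp add: basis_expansion flip: scalar_mult_eq_scaleR)
  also have "\<dots> \<le> (\<Sum>i\<in>(UNIV::'n set). norm x)"
    by (intro sum_mono component_le_norm_cart)
  finally show ?thesis by simp
qed

lemma lp_norm_diff_le:
  assumes "p \<ge> 1" shows "\<bar>lp_norm p x - lp_norm p y\<bar> \<le> lp_norm p (x - y)"
  using lp_norm_triangle[OF assms, of "x - y" y] lp_norm_triangle[OF assms, of "y - x" x]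
    lp_norm_minus_commute[of p x y] by simp

lemma continuous_on_lp_norm [continuous_intros]:
  fixes f :: "'a::topological_space \<Rightarrow> real ^ 'n"
  assumes "p \<ge> 1" "continuous_on S f" shows "continuous_on S (\<lambda>x. lp_norm p (f x))"
proof -
  have "(real CARD('n))-lipschitz_on UNIV (lp_norm p :: real ^ 'n \<Rightarrow> real)"
    by (rule lipschitz_onI)
      (use order_trans[OF lp_norm_diff_le[OF assms(1)] lp_norm_le_norm[OF assms(1)]]
        in \<open>auto simp: dist_norm\<close>)
  then have "continuous_on UNIV (lp_norm p :: real ^ 'n \<Rightarrow> real)"
    by (rule lipschitz_on_continuous_on)
  then show ?thesis
    using assms(2) by (rule continuous_on_compose2) auto
qed

lemma measurable_lp_norm [measurable]:
  "(lp_norm p :: real ^ 'n \<Rightarrow> real) \<in> borel_measurable borel"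
proof -
  have "(\<lambda>x::real ^ 'n. MAX i. \<bar>x $ i\<bar>) \<in> borel_measurable borel"
    by measurable
  moreover have "(\<lambda>x::real ^ 'n. (\<Sum>i\<in>UNIV. \<bar>x $ i\<bar> powr r) powr s) \<in> borel_measurable borel" for r s
    by measurable
  ultimately show ?thesis unfolding lp_norm_def by auto
qed

lemma conjugate_exponents_cases:
  assumes "1 / p + 1 / q = (1::ennreal)" 
  obtains "q = \<infinity>" "p = 1" | "q = 1" "p = \<infinity>"
    | p' q' where "p = ennreal p'" "q = ennreal q'" "1 < p'" "1 < q'" "1 / p' + 1 / q' = 1"
proof -
  have one: "r = 1" if "1 / r = (1::ennreal)" for r
  proof (cases r)
    case (real x)
    then have "x > 0" using that by (cases "x = 0") auto
    then show ?thesis using that real by (simp add: divide_ennreal flip: ennreal_1)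
  qed (use that in auto)
  show thesis
  proof (cases p)
    case top
    then show thesis using assms one[of q] that(2) by simp
  next
    case p: (real x)
    show thesis
    proof (cases q)
      case top
      then show thesis using assms one[of p] that(1) by simp
    next
      case q: (real y)
      have xy: "x > 0" "y > 0" using assms p q by (cases "x = 0"; cases "y = 0"; simp)+
      then have "ennreal (1 / x + 1 / y) = 1"
        using assms p q by (simp add: divide_ennreal flip: ennreal_1)
      then have eq: "1 / x + 1 / y = 1" by (metis ennreal_eq_1)
      moreover have "1 / x > 0" "1 / y > 0" using xy by auto
      ultimately have "1 / x < 1" "1 / y < 1" by linarith+
      then have "1 < x" "1 < y" using xy by (simp_all add: field_simps)
      then show thesis using that(3) p q eq by blast
    qed
  qed
qed

lemma conjugate_exponent_ge_1:
  assumes "1 / p + 1 / q = (1::ennreal)" shows "p \<ge> 1"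
  using assms by (cases rule: conjugate_exponents_cases) auto

text \<open>Equality case of Hoelder's inequality. The witness is the sign vector for
  \<open>p = 1\<close>, a signed unit vector at a coordinate of largest modulus for
  \<open>p = \<infinity>\<close>, and otherwise the vector of signed powers of exponent
  \<open>p' - 1\<close>, normalised.\<close>

lemma lp_norm_dual_vector:
  assumes "1 / p + 1 / q = (1::ennreal)"
  obtains e :: "real ^ 'n" where "lp_norm q e \<le> 1" "a \<bullet> e = lp_norm p a"
proof -
  from assms show thesis
  proof (cases rule: conjugate_exponents_cases)
    case 1
    have "lp_norm q (\<chi> i. sgn (a $ i)) \<le> 1"
      using 1 by (auto simp: lp_norm_def abs_sgn_eq)
    moreover have "a \<bullet> (\<chi> i. sgn (a $ i)) = lp_norm p a"
      using 1 by (simp add: lp_norm_def inner_vec_def abs_sgn[symmetric] sum_nonneg)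
    ultimately show thesis by (rule that)
  next
    case 2
    have "(MAX i. \<bar>a $ i\<bar>) \<in> range (\<lambda>i. \<bar>a $ i\<bar>)" by (rule Max_in) auto
    then obtain i where "(MAX i. \<bar>a $ i\<bar>) = \<bar>a $ i\<bar>" by (rule imageE)
    then have i: "lp_norm p a = \<bar>a $ i\<bar>" using 2 by (simp add: lp_norm_def)
    have "lp_norm q (axis i (sgn (a $ i))) \<le> 1"
      using 2 by (simp add: lp_norm_def axis_def if_distrib[of abs] if_distrib[of "\<lambda>t. t powr _"] abs_sgn_eq cong: if_cong)
    moreover have "a \<bullet> axis i (sgn (a $ i)) = lp_norm p a"
      using i by (simp add: inner_axis abs_sgn)
    ultimately show thesis by (rule that)
  next
    case (3 p' q')
    have pq: "(p' - 1) * q' = p'" using 3 by (simp add: field_simps)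
    define S where "S = (\<Sum>i\<in>UNIV. \<bar>a $ i\<bar> powr p')"
    have S0: "S \<ge> 0" by (simp add: S_def sum_nonneg)
    define e :: "real ^ 'n" where "e = (\<chi> i. sgn (a $ i) * \<bar>a $ i\<bar> powr (p' - 1) / S powr (1 / q'))"
    show thesis
    proof (cases "S = 0")
      case True
      then have "a = 0" by (simp add: S_def sum_nonneg_eq_0_iff vec_eq_iff)
      then show thesis by (intro that[of 0]) auto
    next
      case False
      have "\<bar>e $ i\<bar> powr q' = \<bar>a $ i\<bar> powr p' / S" for i
        using 3 S0 False pq
        by (cases "a $ i = 0") (auto simp: e_def abs_mult abs_sgn_eq powr_divide powr_powr)
      then have "lp_norm q e = 1"
        using 3 False by (simp add: lp_norm_def sum_divide_distrib[symmetric] flip: S_def)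
      moreover have "a \<bullet> e = lp_norm p a"
      proof -
        have "a $ i * e $ i = \<bar>a $ i\<bar> powr p' / S powr (1 / q')" for i
          by (cases "a $ i = 0") (auto simp: e_def powr_diff sgn_if)
        then have "a \<bullet> e = S / S powr (1 / q')"
          by (simp add: inner_vec_def sum_divide_distrib[symmetric] flip: S_def)
        also have "\<dots> = S powr (1 - 1 / q')" using S0 False by (simp add: powr_diff)
        also have "1 - 1 / q' = 1 / p'" using 3 by simp
        finally show ?thesis using 3 by (simp add: lp_norm_def S_def)
      qed
      ultimately show thesis by (intro that[of e]) auto
    qed
  qed
qed

text \<open>Along the ray of the dual vector \<open>e\<close> the left side is at least
  \<open>\<rho> * b * t - t powr \<rho>\<close> with \<open>b = lp_norm p a / \<rho>\<close>. This
  is maximal where \<open>t powr (\<rho> - 1) = b\<close>, which dictates the choice of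
  \<open>t\<close>.\<close>

lemma young_attained:
  assumes "q \<ge> 1" "1 / p + 1 / q = (1::ennreal)" "\<rho> > 1"
  obtains v :: "real ^ 'n" where
    "a \<bullet> v - lp_norm q v powr \<rho> \<ge> (\<rho> - 1) * (lp_norm p a / \<rho>) powr (\<rho> / (\<rho> - 1))"
proof -
  obtain e :: "real ^ 'n" where e: "lp_norm q e \<le> 1" "a \<bullet> e = lp_norm p a"
    using lp_norm_dual_vector[OF assms(2)] .
  define b where "b = lp_norm p a / \<rho>"
  define t where "t = b powr (1 / (\<rho> - 1))"
  have b: "b \<ge> 0" using assms lp_norm_nonneg[of p a] by (simp add: b_def)
  have t: "t \<ge> 0" by (simp add: t_def)
  have tr: "t powr \<rho> = b powr (\<rho> / (\<rho> - 1))" by (simp add: t_def powr_powr)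
  have "1 + 1 / (\<rho> - 1) = \<rho> / (\<rho> - 1)" using assms by (simp add: field_simps)
  then have tb: "b * t = b powr (\<rho> / (\<rho> - 1))"
    using b by (simp add: t_def powr_mult_base)
  have "lp_norm q (t *\<^sub>R e) powr \<rho> \<le> t powr \<rho>"
    using t e assms lp_norm_nonneg[of q e]
    by (intro powr_mono2) (auto simp: lp_norm_scaleR mult_left_le)
  moreover have "a \<bullet> (t *\<^sub>R e) = \<rho> * (b * t)" using e assms by (simp add: b_def)
  ultimately have "(\<rho> - 1) * b powr (\<rho> / (\<rho> - 1)) \<le> a \<bullet> (t *\<^sub>R e) - lp_norm q (t *\<^sub>R e) powr \<rho>"
    by (simp only: tb tr left_diff_distrib mult_1)
  then show thesis by (intro that[of "t *\<^sub>R e"]) (simp add: b_def)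
qed

lemma lp_norm_powr_convex:
  assumes "q \<ge> 1" "\<rho> \<ge> 1" "0 \<le> t" "t \<le> 1"
  shows "lp_norm q ((1 - t) *\<^sub>R x + t *\<^sub>R y) powr \<rho> \<le> (1 - t) * lp_norm q x powr \<rho> + t * lp_norm q y powr \<rho>"
proof -
  have "lp_norm q ((1 - t) *\<^sub>R x + t *\<^sub>R y) \<le> (1 - t) * lp_norm q x + t * lp_norm q y"
    using lp_norm_triangle[OF assms(1), of "(1 - t) *\<^sub>R x" "t *\<^sub>R y"] assms
    by (simp add: lp_norm_scaleR)
  then have "lp_norm q ((1 - t) *\<^sub>R x + t *\<^sub>R y) powr \<rho> \<le> ((1 - t) * lp_norm q x + t * lp_norm q y) powr \<rho>"
    using assms by (intro powr_mono2) (auto simp: lp_norm_nonneg)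
  also have "\<dots> \<le> (1 - t) * lp_norm q x powr \<rho> + t * lp_norm q y powr \<rho>"
    using convex_onD[OF powr_convex_on_nonneg[OF assms(2)] assms(3,4), of "lp_norm q x" "lp_norm q y"]
    by (simp add: lp_norm_nonneg)
  finally show ?thesis .
qed

section \<open>Fields of displacements and Lagrangian duality\<close>

text \<open>One constant serves as bound and as radius of the support. These fields form a vector
  space, so their drifts form a subspace and convex combinations stay admissible.\<close>

definition bounded_field :: "(real ^ 'm \<Rightarrow> real ^ 'm) \<Rightarrow> bool" where
  "bounded_field v \<longleftrightarrow>
     v \<in> borel_measurable borel \<and> (\<exists>B. \<forall>w. norm (v w) \<le> B \<and> (B < norm w \<longrightarrow> v w = 0))"

lemma bounded_field_measurable [measurable_dest]:
  "bounded_field v \<Longrightarrow> v \<in> borel_measurable borel"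
  by (simp add: bounded_field_def)

lemma bounded_fieldE:
  assumes "bounded_field v"
  obtains B where "B > 0" "\<And>w. norm (v w) \<le> B" "\<And>w. B < norm w \<Longrightarrow> v w = 0"
proof -
  obtain B where B: "\<And>w. norm (v w) \<le> B" "\<And>w. B < norm w \<Longrightarrow> v w = 0"
    using assms by (auto simp: bounded_field_def)
  show thesis
  proof (rule that[of "\<bar>B\<bar> + 1"])
    show "norm (v w) \<le> \<bar>B\<bar> + 1" for w using B(1)[of w] by linarith
    show "v w = 0" if "\<bar>B\<bar> + 1 < norm w" for w using that by (intro B(2)) linarith
  qed simp
qed

lemma bounded_fieldI:
  assumes "v \<in> borel_measurable borel" "\<And>w. norm (v w) \<le> B" "\<And>w. C < norm w \<Longrightarrow> v w = 0"
  shows "bounded_field v"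
  unfolding bounded_field_def
proof (intro conjI exI[of _ "max B C"] allI impI)
  show "norm (v w) \<le> max B C" for w using assms(2)[of w] by simp
  show "v w = 0" if "max B C < norm w" for w using that by (intro assms(3)) simp
qed (rule assms(1))

lemma bounded_field_zero: "bounded_field (\<lambda>w. 0)"
  by (rule bounded_fieldI[of _ 0 0]) auto

lemma bounded_field_add:
  assumes "bounded_field u" "bounded_field v" shows "bounded_field (\<lambda>w. u w + v w)"
proof -
  from assms(1) obtain B where B: "\<And>w. norm (u w) \<le> B" "\<And>w. B < norm w \<Longrightarrow> u w = 0"
    by (rule bounded_fieldE) blast
  from assms(2) obtain C where C: "\<And>w. norm (v w) \<le> C" "\<And>w. C < norm w \<Longrightarrow> v w = 0"
    by (rule bounded_fieldE) blast
  show ?thesis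
    using assms B C by (intro bounded_fieldI[of _ "B + C" "max B C"]) (auto intro: norm_triangle_mono)
qed

lemma bounded_field_scaleR:
  assumes "bounded_field u" shows "bounded_field (\<lambda>w. a *\<^sub>R u w)"
proof -
  from assms obtain B where B: "\<And>w. norm (u w) \<le> B" "\<And>w. B < norm w \<Longrightarrow> u w = 0"
    by (rule bounded_fieldE) blast
  show ?thesis
    using assms B by (intro bounded_fieldI[of _ "\<bar>a\<bar> * B" B]) (auto intro: mult_left_mono)
qed

lemma compact_norm_bound:
  fixes S :: "'b::real_normed_vector set"
  assumes "compact S"
  obtains B where "B > 0" "\<forall>x\<in>S. norm x \<le> B"
  using compact_imp_bounded[OF assms] unfolding bounded_pos by auto

text \<open>Only pairs in a product of two compact balls matter, since outside the support of
  \<open>v\<close> the second argument is 0, where \<open>F\<close> vanishes. This yields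
  integrability under any probability law without growth conditions on \<open>F\<close>.\<close>

lemma bounded_field_compose_bounded:
  fixes F :: "real ^ 'm \<Rightarrow> real ^ 'm \<Rightarrow> 'b::real_normed_vector"
  assumes "bounded_field v" "continuous_on UNIV (\<lambda>x. F (fst x) (snd x))" "\<And>w. F w 0 = 0"
  obtains C where "\<forall>w. norm (F w (v w)) \<le> C"
proof -
  from assms(1) obtain B where B: "B > 0" "\<And>w. norm (v w) \<le> B" "\<And>w. B < norm w \<Longrightarrow> v w = 0"
    by (rule bounded_fieldE) blast
  have "compact ((\<lambda>x. F (fst x) (snd x)) ` (cball 0 B \<times> cball 0 B))"
    by (intro compact_continuous_image compact_Times compact_cball continuous_on_subset[OF assms(2)]) auto
  from compact_norm_bound[OF this]
  obtain C where C: "C > 0" "\<forall>x\<in>(\<lambda>x. F (fst x) (snd x)) ` (cball 0 B \<times> cball 0 B). norm x \<le> C" .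
  have "norm (F w (v w)) \<le> C" for w
  proof (cases "norm w \<le> B")
    case True
    then show ?thesis using B by (intro C(2)[rule_format] image_eqI[of _ _ "(w, v w)"]) auto
  next
    case False
    then show ?thesis using B(3)[of w] assms(3) C by simp
  qed
  then show thesis by (intro that allI)
qed

lemma bounded_field_compose_measurable:
  fixes F :: "real ^ 'm \<Rightarrow> real ^ 'm \<Rightarrow> 'b::{second_countable_topology, real_normed_vector}"
  assumes "v \<in> borel_measurable borel" "continuous_on UNIV (\<lambda>x. F (fst x) (snd x))"
  shows "(\<lambda>w. F w (v w)) \<in> borel_measurable borel"
  by (rule borel_measurable_continuous_Pair[where H=F, OF measurable_ident_sets[OF refl] assms])

lemma scaleR_vector_matrix_mult: "(c *\<^sub>R x) v* A = c *\<^sub>R (x v* (A :: real ^ 'm ^ 'r))"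
  by (simp add: vector_matrix_mult_def vec_eq_iff sum_distrib_left mult_ac)

text \<open>\<open>\<mu>\<close> is the law of a single observation. Working on the data space makes
  displacements functions of the observed point, as the construction of competitors
  requires.\<close>

locale jacobian_field = prob_space \<mu>
  for \<mu> :: "(real ^ 'm) measure" +
  fixes J :: "real ^ 'm \<Rightarrow> real ^ 'm ^ 'r" and p q :: ennreal and \<rho> :: real
  assumes sets_\<mu> [measurable_cong, simp]: "sets \<mu> = sets borel"
    and continuous_J: "continuous_on UNIV J"
    and q_ge_1: "q \<ge> 1" and \<rho>_ge_1: "\<rho> \<ge> 1" and conjugate: "1 / p + 1 / q = 1"
    and nondegenerate: "\<And>\<zeta>. \<zeta> \<noteq> 0 \<Longrightarrow> measure \<mu> {w. lp_norm p (\<zeta> v* J w) > 0} > 0"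
begin

lemma space_\<mu> [simp]: "space \<mu> = UNIV"
  using sets_eq_imp_space_eq[OF sets_\<mu>] by simp

lemma continuous_drift_term: "continuous_on UNIV (\<lambda>x. J (fst x) *v snd x)"
proof -
  have "continuous_on UNIV (\<lambda>x. J (fst x))"
    by (rule continuous_on_compose2[OF continuous_J]) (auto intro: continuous_on_fst continuous_on_id)
  then show ?thesis
    unfolding matrix_vector_mult_def
    by (intro continuous_on_vec_lambda continuous_on_sum continuous_on_mult continuous_on_component
        continuous_on_snd continuous_on_id)
qed

lemma continuous_left_mult: "continuous_on UNIV (\<lambda>w. \<zeta> v* J w)"
  unfolding vector_matrix_mult_def
  by (intro continuous_on_vec_lambda continuous_on_sum continuous_on_mult continuous_on_component
      continuous_on_const continuous_J)

lemma measurable_left_mult [measurable]: "(\<lambda>w. \<zeta> v* J w) \<in> borel_measurable borel"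
  by (rule borel_measurable_continuous_onI[OF continuous_left_mult])

lemma continuous_energy_term: "continuous_on UNIV (\<lambda>x. lp_norm q (snd x) powr \<rho>)"
  using \<rho>_ge_1
  by (intro continuous_on_powr' continuous_on_lp_norm[OF q_ge_1] continuous_on_snd continuous_on_id continuous_on_const)
    (auto simp: lp_norm_nonneg)

lemma bounded_field_compose_integrable:
  fixes F :: "real ^ 'm \<Rightarrow> real ^ 'm \<Rightarrow> 'b::{banach, second_countable_topology}"
  assumes "bounded_field v" "continuous_on UNIV (\<lambda>x. F (fst x) (snd x))" "\<And>w. F w 0 = 0"
  shows "integrable \<mu> (\<lambda>w. F w (v w))"
proof -
  obtain C where "\<forall>w. norm (F w (v w)) \<le> C"
    using bounded_field_compose_bounded[OF assms] .
  moreover have "(\<lambda>w. F w (v w)) \<in> borel_measurable \<mu>"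
    using bounded_field_compose_measurable[OF bounded_field_measurable[OF assms(1)] assms(2)] by simp
  ultimately show ?thesis by (intro integrable_const_bound[of _ C]) simp_all
qed

definition drift :: "(real ^ 'm \<Rightarrow> real ^ 'm) \<Rightarrow> real ^ 'r" where
  "drift v = (\<integral>w. J w *v v w \<partial>\<mu>)"

definition energy :: "(real ^ 'm \<Rightarrow> real ^ 'm) \<Rightarrow> real" where
  "energy v = (\<integral>w. lp_norm q (v w) powr \<rho> \<partial>\<mu>)"

lemma integrable_drift: "bounded_field v \<Longrightarrow> integrable \<mu> (\<lambda>w. J w *v v w)"
  by (rule bounded_field_compose_integrable[of _ "\<lambda>w x. J w *v x", OF _ continuous_drift_term]) simp_all

lemma integrable_energy: "bounded_field v \<Longrightarrow> integrable \<mu> (\<lambda>w. lp_norm q (v w) powr \<rho>)"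
  by (rule bounded_field_compose_integrable[of _ "\<lambda>w x. lp_norm q x powr \<rho>", OF _ continuous_energy_term]) simp_all

lemma drift_add: "bounded_field u \<Longrightarrow> bounded_field v \<Longrightarrow> drift (\<lambda>w. u w + v w) = drift u + drift v"
  by (simp add: drift_def matrix_vector_right_distrib integrable_drift)

lemma drift_scaleR: "bounded_field u \<Longrightarrow> drift (\<lambda>w. a *\<^sub>R u w) = a *\<^sub>R drift u"
  by (simp add: drift_def matrix_vector_mult_scaleR integrable_drift)

lemma energy_convex:
  assumes "bounded_field u" "bounded_field v" "0 \<le> t" "t \<le> 1"
  shows "energy (\<lambda>w. (1 - t) *\<^sub>R u w + t *\<^sub>R v w) \<le> (1 - t) * energy u + t * energy v"
proof -
  have "energy (\<lambda>w. (1 - t) *\<^sub>R u w + t *\<^sub>R v w)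
      \<le> (\<integral>w. (1 - t) * lp_norm q (u w) powr \<rho> + t * lp_norm q (v w) powr \<rho> \<partial>\<mu>)"
    unfolding energy_def using assms q_ge_1 \<rho>_ge_1
    by (intro integral_mono integrable_energy Bochner_Integration.integrable_add
        integrable_mult_right lp_norm_powr_convex bounded_field_add bounded_field_scaleR)
  also have "\<dots> = (1 - t) * energy u + t * energy v"
    using assms by (simp add: energy_def integrable_energy)
  finally show ?thesis .
qed

lemma left_mult_not_AE_0:
  assumes "AE w in \<mu>. lp_norm p (\<zeta> v* J w) = 0" shows "\<zeta> = 0"
proof (rule ccontr)
  assume "\<zeta> \<noteq> 0"
  have "{w \<in> space \<mu>. lp_norm p (\<zeta> v* J w) > 0} \<in> sets \<mu>" by measurable
  then have "measure \<mu> {w. lp_norm p (\<zeta> v* J w) > 0} = 0"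
    using assms by (simp add: prob_eq_0) (elim eventually_mono, simp)
  with nondegenerate[OF \<open>\<zeta> \<noteq> 0\<close>] show False by simp
qed

text \<open>If the drifts formed a proper subspace, some nonzero \<open>\<zeta>\<close> would be
  orthogonal to all of them. Testing with \<open>\<zeta> v* J w\<close> itself, cut off outside
  balls, makes the integral of its squared length vanish, contrary to nondegeneracy. This is the
  constraint qualification of the convex problem.\<close>

lemma drift_surjective: "\<exists>v. bounded_field v \<and> drift v = y"
proof -
  define D where "D = {drift v | v. bounded_field v}"
  have "subspace D"
    unfolding subspace_def
  proof safe
    show "0 \<in> D" using bounded_field_zero by (force simp: D_def drift_def)
    show "x + z \<in> D" if xz: "x \<in> D" "z \<in> D" for x z
    proof -
      from xz obtain u v where "bounded_field u" "bounded_field v" "x = drift u" "z = drift v"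
        by (auto simp: D_def)
      then show ?thesis unfolding D_def
        by (auto intro!: exI[of _ "\<lambda>w. u w + v w"] simp: drift_add bounded_field_add)
    qed
    show "a *\<^sub>R x \<in> D" if x: "x \<in> D" for a x
    proof -
      from x obtain u where "bounded_field u" "x = drift u" by (auto simp: D_def)
      then show ?thesis unfolding D_def
        by (auto intro!: exI[of _ "\<lambda>w. a *\<^sub>R u w"] simp: drift_scaleR bounded_field_scaleR)
    qed
  qed
  have "D = UNIV"
  proof (rule ccontr)
    assume "D \<noteq> UNIV"
    then have "span D \<noteq> UNIV" using \<open>subspace D\<close> by (simp add: span_eq_iff[THEN iffD2])
    then have "dim D < DIM(real ^ 'r)"
      using dim_eq_full[of D] dim_subset_UNIV[of D] by linarith
    then obtain \<zeta> where \<zeta>: "\<zeta> \<noteq> 0" "\<And>x. x \<in> span D \<Longrightarrow> orthogonal \<zeta> x"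
      by (rule orthogonal_to_subspace_exists) blast
    define v where "v k w = (if norm w \<le> real k then \<zeta> v* J w else 0)" for k w
    have v: "bounded_field (v k)" for k
    proof -
      have "compact ((\<lambda>w. \<zeta> v* J w) ` cball 0 (real k))"
        by (intro compact_continuous_image continuous_on_subset[OF continuous_left_mult]) auto
      from compact_norm_bound[OF this]
      obtain B where B: "B > 0" "\<forall>x\<in>(\<lambda>w. \<zeta> v* J w) ` cball 0 (real k). norm x \<le> B" .
      show ?thesis
      proof (rule bounded_fieldI[of _ B "real k"])
        have "(\<lambda>w. v k w) \<in> borel_measurable borel" unfolding v_def by measurable
        then show "v k \<in> borel_measurable borel" by simp
      qed (use B in \<open>auto simp: v_def\<close>)
    qed
    have "AE w in \<mu>. \<zeta> \<bullet> (J w *v v k w) = 0" for k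
    proof -
      have nn: "\<zeta> \<bullet> (J w *v v k w) \<ge> 0" for w
        by (simp add: v_def flip: dot_lmul_matrix)
      have "(\<integral>w. \<zeta> \<bullet> (J w *v v k w) \<partial>\<mu>) = \<zeta> \<bullet> drift (v k)"
        using integrable_drift[OF v] by (simp add: drift_def)
      also have "\<dots> = 0"
        using \<zeta>(2)[OF span_base, of "drift (v k)"] v by (auto simp: D_def orthogonal_def)
      finally show ?thesis
        using integral_nonneg_eq_0_iff_AE[of \<mu> "\<lambda>w. \<zeta> \<bullet> (J w *v v k w)"] nn integrable_drift[OF v] by auto
    qed
    then have "AE w in \<mu>. \<forall>k. \<zeta> \<bullet> (J w *v v k w) = 0" by (simp add: AE_all_countable)
    then have "AE w in \<mu>. lp_norm p (\<zeta> v* J w) = 0"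
    proof (rule eventually_mono)
      fix w assume *: "\<forall>k. \<zeta> \<bullet> (J w *v v k w) = 0"
      obtain k where "norm w \<le> real k" using real_arch_simple by blast
      then have "(\<zeta> v* J w) \<bullet> (\<zeta> v* J w) = 0"
        using *[rule_format, of k] by (simp add: v_def dot_lmul_matrix)
      then show "lp_norm p (\<zeta> v* J w) = 0" by simp
    qed
    then show False using left_mult_not_AE_0 \<zeta>(1) by blast
  qed
  then have "y \<in> D" by simp
  then show ?thesis by (auto simp: D_def)
qed

text \<open>Lagrange multiplier by separation: 0 lies outside the convex set of pairs (violation of
  the constraint, excess cost), and a separating normal with positive last component becomes the
  multiplier after scaling.\<close>

lemma exists_multiplier:
  assumes "\<And>v. bounded_field v \<Longrightarrow> drift v = - y \<Longrightarrow> a < energy v"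
  obtains l where "\<forall>v. bounded_field v \<longrightarrow> a - l \<bullet> y \<le> energy v + l \<bullet> drift v"
proof -
  \<comment> \<open>The slack \<open>s\<close> makes the set upward closed in the cost. This gives
    convexity although \<open>energy\<close> is convex rather than affine, and it rules out a
    negative last component of the normal.\<close>
  define C where "C = {(drift v + y, energy v - a + s) | v s. bounded_field v \<and> s \<ge> 0}"
  have "convex C"
    unfolding convex_alt
  proof safe
    fix x1 t1 x2 t2 u assume *: "(x1, t1) \<in> C" "(x2, t2) \<in> C" and u: "0 \<le> u" "u \<le> (1::real)"
    from * obtain v1 s1 where 1: "x1 = drift v1 + y" "t1 = energy v1 - a + s1" "bounded_field v1" "s1 \<ge> 0"
      by (auto simp: C_def)
    from * obtain v2 s2 where 2: "x2 = drift v2 + y" "t2 = energy v2 - a + s2" "bounded_field v2" "s2 \<ge> 0"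
      by (auto simp: C_def)
    define v where "v = (\<lambda>w. (1 - u) *\<^sub>R v1 w + u *\<^sub>R v2 w)"
    have v: "bounded_field v" using 1 2 by (auto simp: v_def intro: bounded_field_add bounded_field_scaleR)
    have "drift v = (1 - u) *\<^sub>R drift v1 + u *\<^sub>R drift v2"
      using 1 2 by (simp add: v_def drift_add bounded_field_scaleR drift_scaleR)
    then have eq1: "(1 - u) *\<^sub>R x1 + u *\<^sub>R x2 = drift v + y"
      using 1 2 by (simp add: algebra_simps)
    define s where "s = (1 - u) * energy v1 + u * energy v2 - energy v + ((1 - u) * s1 + u * s2)"
    have "s \<ge> 0" using energy_convex[OF 1(3) 2(3) u] 1 2 u by (simp add: s_def v_def)
    moreover have "(1 - u) * t1 + u * t2 = energy v - a + s"
      unfolding 1(2) 2(2) s_def by (simp add: algebra_simps)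
    ultimately show "(1 - u) *\<^sub>R (x1, t1) + u *\<^sub>R (x2, t2) \<in> C"
      using eq1 v by (auto simp: C_def)
  qed
  moreover have "0 \<notin> C"
  proof
    assume "0 \<in> C"
    then obtain v s where "bounded_field v" "s \<ge> 0" "drift v + y = 0" "energy v - a + s = 0"
      by (auto simp: C_def zero_prod_def)
    then show False using assms[of v] by (simp add: eq_neg_iff_add_eq_0)
  qed
  ultimately obtain z where "z \<noteq> 0" "\<forall>x\<in>C. 0 \<le> z \<bullet> x"
    using separating_hyperplane_set_0 by blast
  moreover obtain l \<tau> where "z = (l, \<tau>)" by (cases z)
  ultimately have nz: "l \<noteq> 0 \<or> \<tau> \<noteq> 0"
    and sep: "\<And>v s. bounded_field v \<Longrightarrow> s \<ge> 0 \<Longrightarrow> 0 \<le> l \<bullet> (drift v + y) + \<tau> * (energy v - a + s)"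
    by (auto simp: C_def zero_prod_def)
  have "\<tau> > 0"
  proof (rule ccontr)
    assume "\<not> \<tau> > 0"
    then consider "\<tau> < 0" | "\<tau> = 0" by linarith
    then show False
    proof cases
      case 1
      \<comment> \<open>This slack makes the separated quantity at the zero field at most
        \<open>\<tau>\<close>, hence negative.\<close>
      define s where "s = \<bar>l \<bullet> (drift (\<lambda>w. 0) + y) + \<tau> * (energy (\<lambda>w. 0) - a)\<bar> / (- \<tau>) + 1"
      have "0 \<le> l \<bullet> (drift (\<lambda>w. 0) + y) + \<tau> * (energy (\<lambda>w. 0) - a + s)"
        using 1 by (intro sep bounded_field_zero) (simp add: s_def)
      moreover have "\<tau> * s = - \<bar>l \<bullet> (drift (\<lambda>w. 0) + y) + \<tau> * (energy (\<lambda>w. 0) - a)\<bar> + \<tau>"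
        using 1 by (simp add: s_def field_simps)
      ultimately show False using 1 by (simp add: distrib_left)
    next
      case 2
      \<comment> \<open>A vertical hyperplane is refuted by surjectivity: this drift makes the
        separated quantity equal to \<open>- (l \<bullet> l)\<close>.\<close>
      obtain v where "bounded_field v" "drift v = - l - y" using drift_surjective by blast
      then have "l \<bullet> l \<le> 0" using sep[of v 0] 2 by simp
      moreover have "l \<bullet> l > 0" using 2 nz by simp
      ultimately show False by linarith
    qed
  qed
  show thesis
  proof (rule that[of "(1 / \<tau>) *\<^sub>R l"], intro allI impI)
    fix v :: "real ^ 'm \<Rightarrow> real ^ 'm" assume "bounded_field v"
    from sep[OF this, of 0] have "0 \<le> (l \<bullet> (drift v + y) + \<tau> * (energy v - a)) / \<tau>"
      using \<open>\<tau> > 0\<close> by simp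
    also have "\<dots> = ((1 / \<tau>) *\<^sub>R l) \<bullet> drift v + ((1 / \<tau>) *\<^sub>R l) \<bullet> y + (energy v - a)"
      using \<open>\<tau> > 0\<close> by (simp add: add_divide_distrib inner_right_distrib)
    finally show "a - ((1 / \<tau>) *\<^sub>R l) \<bullet> y \<le> energy v + ((1 / \<tau>) *\<^sub>R l) \<bullet> drift v"
      by simp
  qed
qed

text \<open>The supremum over fields may be taken inside the integral: a greedy selection from a countable
  dense set gives bounded fields whose integrands increase to the pointwise supremum.\<close>

lemma integral_pointwise_supremum:
  fixes l :: "real ^ 'r"
  defines "g \<equiv> \<lambda>w x. - ((l v* J w) \<bullet> x) - lp_norm q x powr \<rho>"
  assumes K: "\<And>v. bounded_field v \<Longrightarrow> K \<le> energy v + l \<bullet> drift v"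
  obtains S :: "real ^ 'm \<Rightarrow> ennreal" where "S \<in> borel_measurable borel"
    "\<forall>w x. ennreal (g w x) \<le> S w" "(\<integral>\<^sup>+ w. S w \<partial>\<mu>) \<le> ennreal (- K)"
proof -
  have cont: "continuous_on UNIV (\<lambda>x. g (fst x) (snd x))"
    unfolding g_def
    by (intro continuous_on_diff continuous_on_minus continuous_on_inner continuous_energy_term
        continuous_on_compose2[OF continuous_left_mult] continuous_on_fst continuous_on_snd continuous_on_id) auto
  have g0: "g w 0 = 0" for w by (simp add: g_def)
  obtain D :: "(real ^ 'm) set" where D: "countable D" "\<And>X. open X \<Longrightarrow> X \<noteq> {} \<Longrightarrow> \<exists>d\<in>D. d \<in> X"
    by (rule countable_dense_setE) blast
  then have "D \<noteq> {}" by (metis UNIV_not_empty empty_iff open_UNIV)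
  define d where "d = from_nat_into D"
  have range_d: "range d = D"
    using D(1) \<open>D \<noteq> {}\<close> by (simp add: d_def range_from_nat_into)
  \<comment> \<open>\<open>sel k w\<close> is the best among 0 and the first \<open>k\<close> dense
    points. Starting from 0 keeps the values of \<open>g\<close> nonnegative, so the cut-off to
    balls below can only lower them to 0 and monotonicity in \<open>k\<close> survives.\<close>
  define sel where "sel = rec_nat (\<lambda>w. 0) (\<lambda>k f w. if g w (f w) < g w (d k) then d k else f w)"
  have sel_0: "sel 0 w = 0" and sel_Suc: "sel (Suc k) w = (if g w (sel k w) < g w (d k) then d k else sel k w)" for k w
    by (simp_all add: sel_def)
  have sel_meas: "sel k \<in> borel_measurable borel" for k
  proof (induction k)
    case 0
    have "sel 0 = (\<lambda>w. 0)" using sel_0 by auto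
    then show ?case by simp
  next
    case (Suc k)
    have [measurable]: "(\<lambda>w. g w (sel k w)) \<in> borel_measurable borel" "(\<lambda>w. g w (d k)) \<in> borel_measurable borel"
      by (rule bounded_field_compose_measurable[of _ g, OF _ cont], simp add: Suc)+
    have "sel (Suc k) = (\<lambda>w. if g w (sel k w) < g w (d k) then d k else sel k w)" using sel_Suc by auto
    then show ?case using Suc by simp
  qed
  have sel_mono: "incseq (\<lambda>k. g w (sel k w))" for w
    by (rule incseq_SucI) (simp add: sel_Suc)
  have sel_ge: "g w (d j) \<le> g w (sel k w)" if "j < k" for j k w
    using incseqD[OF sel_mono, of "Suc j" k w] that by (simp add: sel_Suc split: if_splits)
  have sel_nonneg: "0 \<le> g w (sel k w)" for k w
    using incseqD[OF sel_mono, of 0 k w] by (simp add: sel_0 g0)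
  have sel_bound: "norm (sel k w) \<le> (\<Sum>j<k. norm (d j))" for k w
    by (induction k) (auto simp: sel_0 sel_Suc sum_nonneg add_increasing2)
  define v where "v k w = (if norm w \<le> real k then sel k w else 0)" for k w
  have v: "bounded_field (v k)" for k
  proof (rule bounded_fieldI[of _ "\<Sum>j<k. norm (d j)" "real k"])
    have "(\<lambda>w. v k w) \<in> borel_measurable borel" unfolding v_def using sel_meas[of k] by measurable
    then show "v k \<in> borel_measurable borel" by simp
  qed (use sel_bound[of k] in \<open>auto simp: v_def sum_nonneg\<close>)
  have gv_nonneg: "0 \<le> g w (v k w)" for k w by (simp add: v_def sel_nonneg g0)
  have gv_mono: "incseq (\<lambda>k. g w (v k w))" for w
  proof (rule incseq_SucI)
    fix k show "g w (v k w) \<le> g w (v (Suc k) w)"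
      using sel_mono[of w] sel_nonneg[of w "Suc k"] by (auto simp: v_def incseq_Suc_iff g0)
  qed
  have gv_meas [measurable]: "(\<lambda>w. g w (v k w)) \<in> borel_measurable borel" for k
    by (rule bounded_field_compose_measurable[of _ g, OF bounded_field_measurable[OF v] cont])
  define S where "S w = (SUP k. ennreal (g w (v k w)))" for w
  show thesis
  proof (rule that[of S])
    show "S \<in> borel_measurable borel" unfolding S_def by measurable
    show "\<forall>w x. ennreal (g w x) \<le> S w"
    proof (intro allI, rule ccontr)
      fix w x
      assume "\<not> ennreal (g w x) \<le> S w"
      then have lt: "S w < ennreal (g w x)" by simp
      then have "S w < \<infinity>" using less_le_trans by fastforce
      then obtain s where s: "s \<ge> 0" "S w = ennreal s" by (cases "S w") auto
      then have sg: "s < g w x" using lt by (simp add: ennreal_less_iff)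
      \<comment> \<open>A strict inequality at \<open>x\<close> persists on an open set and hence at
        some dense point \<open>d j\<close>; a large \<open>k\<close> has passed \<open>j\<close>
        and has \<open>w\<close> inside its ball.\<close>
      have "continuous_on UNIV (\<lambda>x. g w x)"
        using continuous_on_compose2[OF cont, of UNIV "\<lambda>x. (w, x)"] by (simp add: continuous_intros)
      then have "open {x'. s < g w x'}" by (intro open_Collect_less continuous_on_const)
      then obtain j where j: "s < g w (d j)" using D(2)[of "{x'. s < g w x'}"] sg range_d by blast
      obtain k where k: "norm w \<le> real k" "j < k"
      proof -
        obtain k where "norm w + real j + 1 \<le> real k" using real_arch_simple by blast
        moreover have "norm w \<ge> 0" by simp
        ultimately show ?thesis using that[of k] by linarith
      qed
      have "s < g w (v k w)" using j k sel_ge[of j k w] by (simp add: v_def)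
      then have "ennreal s < ennreal (g w (v k w))" using s by (simp add: ennreal_less_iff)
      also have "\<dots> \<le> S w" unfolding S_def by (rule SUP_upper) simp
      finally show False using s by simp
    qed
    have "(\<integral>\<^sup>+ w. S w \<partial>\<mu>) = (SUP k. \<integral>\<^sup>+ w. ennreal (g w (v k w)) \<partial>\<mu>)"
      unfolding S_def using gv_mono
      by (intro nn_integral_monotone_convergence_SUP) (auto simp: mono_def le_fun_def intro!: ennreal_leI)
    also have "\<dots> \<le> ennreal (- K)"
    proof (rule SUP_least)
      fix k
      have int: "integrable \<mu> (\<lambda>w. g w (v k w))"
        by (rule bounded_field_compose_integrable[of _ g, OF v cont]) (simp add: g0)
      \<comment> \<open>Minus the Lagrangian at the field \<open>v k\<close>, hence at most
        \<open>- K\<close> uniformly in \<open>k\<close>.\<close>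
      have "(\<integral>w. g w (v k w) \<partial>\<mu>) = - (l \<bullet> drift (v k)) - energy (v k)"
        using integrable_drift[OF v, of k] integrable_energy[OF v, of k]
        by (simp add: g_def drift_def energy_def dot_lmul_matrix)
      also have "\<dots> \<le> - K" using K[OF v, of k] by simp
      finally show "(\<integral>\<^sup>+ w. ennreal (g w (v k w)) \<partial>\<mu>) \<le> ennreal (- K)"
        using int gv_nonneg by (simp add: nn_integral_eq_integral ennreal_leI)
    qed
    finally show "(\<integral>\<^sup>+ w. S w \<partial>\<mu>) \<le> ennreal (- K)" .
  qed
qed

text \<open>Strong duality by contradiction: without such a field there is a multiplier
  \<open>l\<close> for which the Lagrangian is bounded below over all fields. With the supremum
  moved inside the integral this bounds the integrated conjugate of the cost at
  \<open>l v* J w\<close>, which exhibits an element of \<open>limit_values\<close> that is at least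
  \<open>a\<close>.\<close>

theorem exists_optimal_field:
  assumes "limit_bound p \<rho> \<mu> J y < ereal a"
  obtains v where "bounded_field v" "drift v = - y" "energy v \<le> a"
proof (rule ccontr)
  assume "\<not> thesis"
  then have "\<And>v. bounded_field v \<Longrightarrow> drift v = - y \<Longrightarrow> a < energy v"
    using that not_le by blast
  then obtain l where "\<forall>v. bounded_field v \<longrightarrow> a - l \<bullet> y \<le> energy v + l \<bullet> drift v"
    by (rule exists_multiplier)
  then have l: "a - l \<bullet> y \<le> energy v + l \<bullet> drift v" if "bounded_field v" for v
    using that by blast
  define K where "K = a - l \<bullet> y"
  have "K \<le> energy v + l \<bullet> drift v" if "bounded_field v" for v
    using l[OF that] by (simp add: K_def)
  then obtain S :: "real ^ 'm \<Rightarrow> ennreal" where S_meas: "S \<in> borel_measurable borel"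
    and S_ge: "\<forall>w x. ennreal (- ((l v* J w) \<bullet> x) - lp_norm q x powr \<rho>) \<le> S w"
    and S_int: "(\<integral>\<^sup>+ w. S w \<partial>\<mu>) \<le> ennreal (- K)"
    by (rule integral_pointwise_supremum)
  note S = S_meas S_ge[rule_format] S_int
  have K0: "K \<le> 0" using l[OF bounded_field_zero] by (simp add: K_def drift_def energy_def)
  have "\<exists>z\<in>limit_values p \<rho> \<mu> J y. ereal a \<le> z"
  proof (cases "\<rho> = 1")
    case True
    \<comment> \<open>For \<open>\<rho> = 1\<close> the conjugate of the cost is infinite outside
      the dual unit ball, so a finite integral of \<open>S\<close> forces feasibility of
      \<open>l\<close>.\<close>
    have "AE w in \<mu>. S w \<noteq> \<infinity>"
      using S(1,3) by (intro nn_integral_noteq_infinite) (auto simp: top_unique)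
    then have "AE w in \<mu>. \<not> 1 < lp_norm p (l v* J w)"
    proof (rule eventually_mono)
      fix w assume "S w \<noteq> \<infinity>"
      then obtain s where s: "S w = ennreal s" "s \<ge> 0" by (cases "S w") auto
      obtain e where e: "lp_norm q e \<le> 1" "(l v* J w) \<bullet> e = lp_norm p (l v* J w)"
        using lp_norm_dual_vector[OF conjugate] .
      show "\<not> 1 < lp_norm p (l v* J w)"
      proof
        assume gt: "1 < lp_norm p (l v* J w)"
        \<comment> \<open>Along \<open>- t *\<^sub>R e\<close> the integrand is at least
          \<open>t\<close> times the excess of the dual norm over 1; this \<open>t\<close> pushes it
          beyond \<open>s\<close>.\<close>
        define t where "t = (s + 1) / (lp_norm p (l v* J w) - 1)"
        have t: "t \<ge> 0" "t * (lp_norm p (l v* J w) - 1) = s + 1" using gt s by (auto simp: t_def)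
        have "lp_norm q ((- t) *\<^sub>R e) = t * lp_norm q e" using t lp_norm_scaleR[OF q_ge_1, of "- t" e] by simp
        also have "\<dots> \<le> t" using t e by (simp add: mult_left_le)
        finally have "s + 1 \<le> - ((l v* J w) \<bullet> ((- t) *\<^sub>R e)) - lp_norm q ((- t) *\<^sub>R e) powr \<rho>"
          using t e True by (simp add: lp_norm_nonneg algebra_simps)
        then have "ennreal (s + 1) \<le> ennreal s"
          using S(2)[of w "(- t) *\<^sub>R e"] s order_trans[OF ennreal_leI] by metis
        then show False using s by simp
      qed
    qed
    moreover have "{w \<in> space \<mu>. lp_norm p (l v* J w) > 1} \<in> sets \<mu>" by measurable
    ultimately have "measure \<mu> {w \<in> space \<mu>. lp_norm p (l v* J w) > 1} = 0"
      by (simp add: prob_eq_0)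
    then show ?thesis
      using True K0 by (auto simp: limit_values_def K_def)
  next
    case False
    then have \<rho>: "\<rho> > 1" using \<rho>_ge_1 by simp
    \<comment> \<open>Division by \<open>\<rho>\<close> matches the normalisation of
      \<open>limit_values\<close>: \<open>l \<bullet> y\<close> becomes
      \<open>\<rho> * (\<zeta> \<bullet> y)\<close>, and the maximum from Young's inequality becomes
      \<open>\<rho> - 1\<close> times a pure power of the norm of
      \<open>\<zeta> v* J w\<close>.\<close>
    define \<zeta> where "\<zeta> = (1 / \<rho>) *\<^sub>R l"
    have pge: "p \<ge> 1" using conjugate by (rule conjugate_exponent_ge_1)
    define G where "G w = lp_norm p (\<zeta> v* J w) powr (\<rho> / (\<rho> - 1))" for w
    have G_meas [measurable]: "G \<in> borel_measurable borel" unfolding G_def by measurable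
    have "(\<zeta> v* J w) = (1 / \<rho>) *\<^sub>R (l v* J w)" for w
      by (simp add: \<zeta>_def scaleR_vector_matrix_mult)
    then have G: "G w = (lp_norm p (l v* J w) / \<rho>) powr (\<rho> / (\<rho> - 1))" for w
      using \<rho> pge by (simp only: G_def lp_norm_scaleR) simp
    have "ennreal ((\<rho> - 1) * G w) \<le> S w" for w
    proof -
      obtain x where "- (l v* J w) \<bullet> x - lp_norm q x powr \<rho> \<ge>
          (\<rho> - 1) * (lp_norm p (- (l v* J w)) / \<rho>) powr (\<rho> / (\<rho> - 1))"
        using young_attained[OF q_ge_1 conjugate \<rho>] .
      then have "(\<rho> - 1) * G w \<le> - ((l v* J w) \<bullet> x) - lp_norm q x powr \<rho>"
        by (simp add: G lp_norm_minus)
      then show ?thesis using S(2)[of w x] order_trans[OF ennreal_leI] by blast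
    qed
    then have "(\<integral>\<^sup>+ w. ennreal ((\<rho> - 1) * G w) \<partial>\<mu>) \<le> (\<integral>\<^sup>+ w. S w \<partial>\<mu>)"
      by (intro nn_integral_mono)
    then have "(\<integral>\<^sup>+ w. ennreal ((\<rho> - 1) * G w) \<partial>\<mu>) \<le> ennreal (- K)" using S(3) by (rule order_trans)
    then have "ennreal (\<rho> - 1) * (\<integral>\<^sup>+ w. ennreal (G w) \<partial>\<mu>) \<le> ennreal (- K)"
      using \<rho> by (subst (asm) ennreal_mult) (auto simp: G_def nn_integral_cmult)
    then have "enn2ereal (ennreal (\<rho> - 1) * (\<integral>\<^sup>+ w. ennreal (G w) \<partial>\<mu>)) \<le> enn2ereal (ennreal (- K))"
      by (simp add: less_eq_ennreal.rep_eq)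
    then have "ereal (\<rho> - 1) * enn2ereal (\<integral>\<^sup>+ w. ennreal (G w) \<partial>\<mu>) \<le> ereal (- K)"
      using \<rho> K0 by (simp add: times_ennreal.rep_eq enn2ereal_ennreal)
    then have "ereal (l \<bullet> y) - ereal (- K) \<le> ereal (l \<bullet> y) - ereal (\<rho> - 1) * enn2ereal (\<integral>\<^sup>+ w. ennreal (G w) \<partial>\<mu>)"
      by (intro ereal_minus_mono) auto
    moreover have "ereal (l \<bullet> y) - ereal (- K) = ereal a" by (simp add: K_def)
    moreover have "\<rho> * (\<zeta> \<bullet> y) = l \<bullet> y" using \<rho> by (simp add: \<zeta>_def)
    moreover have "ereal (\<rho> * (\<zeta> \<bullet> y)) - ereal (\<rho> - 1) * enn2ereal (\<integral>\<^sup>+ w. ennreal (G w) \<partial>\<mu>) \<in> limit_values p \<rho> \<mu> J y"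
      using False by (auto simp: limit_values_def G_def)
    ultimately show ?thesis by (metis (no_types, lifting))
  qed
  then have "ereal a \<le> limit_bound p \<rho> \<mu> J y"
    unfolding limit_bound_def by (meson Sup_upper order_trans)
  with assms show False by simp
qed

end

section \<open>The limiting variable\<close>

text \<open>Superlinear growth in explicit form: above the threshold
  \<open>t powr (r - 1) = A\<close> the power dominates \<open>A * t\<close>, and below it
  \<open>t\<close> is at most \<open>A powr (1 / (r - 1))\<close>.\<close>

lemma powr_ge_linear:
  fixes t :: real
  assumes "t \<ge> 0" "A \<ge> 0" "r > 1" shows "A * t \<le> t powr r + A * A powr (1 / (r - 1))"
proof (cases "A \<le> t powr (r - 1)")
  case True
  then have "A * t \<le> t powr (r - 1) * t" using assms by (intro mult_right_mono)
  also have "\<dots> = t powr r" using assms by (cases "t = 0") (simp_all add: powr_diff)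
  finally show ?thesis using assms by (simp add: add_increasing2)
next
  case False
  then have "(t powr (r - 1)) powr (1 / (r - 1)) \<le> A powr (1 / (r - 1))"
    using assms by (intro powr_mono2) auto
  then have "t \<le> A powr (1 / (r - 1))" using assms by (simp add: powr_powr)
  then have "A * t \<le> A * A powr (1 / (r - 1))" using assms by (intro mult_left_mono)
  then show ?thesis by (simp add: add_increasing)
qed

context jacobian_field
begin

lemma p_ge_1: "p \<ge> 1"
  using conjugate by (rule conjugate_exponent_ge_1)

text \<open>Unifies both cases: the limiting variable is the supremum of
  \<open>\<rho> * (\<zeta> \<bullet> y)\<close> minus this term. For \<open>\<rho> = 1\<close> it is
  the indicator function, in the sense of convex analysis, of the feasible set.\<close>

definition penalty :: "real ^ 'r \<Rightarrow> ennreal" where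
  "penalty \<zeta> =
     (if \<rho> = 1 then (if AE w in \<mu>. lp_norm p (\<zeta> v* J w) \<le> 1 then 0 else \<infinity>)
      else ennreal (\<rho> - 1) * (\<integral>\<^sup>+ w. ennreal (lp_norm p (\<zeta> v* J w) powr (\<rho> / (\<rho> - 1))) \<partial>\<mu>))"

lemma feasible_iff:
  "measure \<mu> {w \<in> space \<mu>. lp_norm p (\<zeta> v* J w) > 1} = 0 \<longleftrightarrow> (AE w in \<mu>. lp_norm p (\<zeta> v* J w) \<le> 1)"
proof -
  have "{w \<in> space \<mu>. lp_norm p (\<zeta> v* J w) > 1} \<in> sets \<mu>" by measurable
  then show ?thesis by (simp add: prob_eq_0 not_less)
qed

text \<open>The guard is there because an infeasible \<open>\<zeta>\<close> contributes no value at
  all when \<open>\<rho> = 1\<close>, whereas an infinite moment contributes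
  \<open>-\<infinity>\<close> when \<open>\<rho> > 1\<close>.\<close>

lemma limit_values_penalty:
  "z \<in> limit_values p \<rho> \<mu> J y \<longleftrightarrow>
    (\<exists>\<zeta>. z = ereal (\<rho> * (\<zeta> \<bullet> y)) - enn2ereal (penalty \<zeta>) \<and> (\<rho> = 1 \<longrightarrow> penalty \<zeta> < \<infinity>))"
proof (cases "\<rho> = 1")
  case True
  show ?thesis unfolding limit_values_def feasible_iff penalty_def using True
    by (auto simp: zero_ennreal.rep_eq split: if_splits)
next
  case False
  have "enn2ereal (ennreal (\<rho> - 1) * X) = ereal (\<rho> - 1) * enn2ereal X" for X
    using \<rho>_ge_1 by (simp add: times_ennreal.rep_eq enn2ereal_ennreal)
  then show ?thesis using False by (auto simp: limit_values_def penalty_def)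
qed

lemma penalty_zero [simp]: "penalty 0 = 0"
  by (simp add: penalty_def)

lemma penalty_finite_iff:
  assumes "\<rho> = 1" shows "penalty \<zeta> \<noteq> \<infinity> \<longleftrightarrow> (AE w in \<mu>. lp_norm p (\<zeta> v* J w) \<le> 1)"
  unfolding penalty_def using assms by simp

lemma limit_valuesI:
  assumes "penalty \<zeta> < \<infinity>"
  shows "ereal (\<rho> * (\<zeta> \<bullet> y)) - enn2ereal (penalty \<zeta>) \<in> limit_values p \<rho> \<mu> J y"
  unfolding limit_values_penalty using assms by blast

lemma zero_in_limit_values: "0 \<in> limit_values p \<rho> \<mu> J y"
  using limit_valuesI[of 0 y] by (simp add: zero_ennreal.rep_eq flip: zero_ereal_def)

lemma continuous_lp_norm_left_mult: "continuous_on UNIV (\<lambda>\<zeta>. lp_norm p (\<zeta> v* J w))"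
  unfolding vector_matrix_mult_def
  by (intro continuous_on_lp_norm[OF p_ge_1] continuous_on_vec_lambda continuous_on_sum
      continuous_on_mult continuous_on_component continuous_on_const continuous_on_id)

lemma tendsto_lp_norm_left_mult:
  assumes "(Z \<longlongrightarrow> \<zeta>) F"
  shows "((\<lambda>k. lp_norm p (Z k v* J w)) \<longlongrightarrow> lp_norm p (\<zeta> v* J w)) F"
  using continuous_on_tendsto_compose[OF continuous_lp_norm_left_mult assms] by simp

text \<open>For \<open>\<rho> > 1\<close> this is Fatou's lemma. For \<open>\<rho> = 1\<close>
  countably many constraints hold off a single null set, and if infinitely many members of the
  sequence are feasible, the closed condition passes to the limit.\<close>

lemma penalty_lsc:
  assumes Z: "Z \<longlonglongrightarrow> \<zeta>"
  shows "penalty \<zeta> \<le> liminf (\<lambda>k. penalty (Z k))"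
proof (cases "\<rho> = 1")
  case True
  show ?thesis
  proof (cases "\<exists>\<^sub>F k in sequentially. penalty (Z k) \<noteq> \<infinity>")
    case freq: True
    have "AE w in \<mu>. penalty (Z k) \<noteq> \<infinity> \<longrightarrow> lp_norm p (Z k v* J w) \<le> 1" for k
      using penalty_finite_iff[OF True, of "Z k"] by (cases "penalty (Z k) = \<infinity>") (auto elim: eventually_mono)
    then have "AE w in \<mu>. \<forall>k. penalty (Z k) \<noteq> \<infinity> \<longrightarrow> lp_norm p (Z k v* J w) \<le> 1"
      by (simp add: AE_all_countable)
    then have "AE w in \<mu>. lp_norm p (\<zeta> v* J w) \<le> 1"
    proof (rule eventually_mono)
      fix w assume *: "\<forall>k. penalty (Z k) \<noteq> \<infinity> \<longrightarrow> lp_norm p (Z k v* J w) \<le> 1"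
      show "lp_norm p (\<zeta> v* J w) \<le> 1"
      proof (rule ccontr)
        assume "\<not> lp_norm p (\<zeta> v* J w) \<le> 1"
        then have "\<forall>\<^sub>F k in sequentially. lp_norm p (Z k v* J w) > 1"
          using order_tendstoD(1)[OF tendsto_lp_norm_left_mult[OF Z]] by simp
        with freq have "\<exists>\<^sub>F k in sequentially. penalty (Z k) \<noteq> \<infinity> \<and> lp_norm p (Z k v* J w) > 1"
          by (rule frequently_eventually_frequently)
        then show False using * by (auto dest!: frequently_ex)
      qed
    qed
    then have "penalty \<zeta> = 0" unfolding penalty_def using True by simp
    then show ?thesis by simp
  next
    case False
    then have "\<forall>\<^sub>F k in sequentially. penalty (Z k) = \<infinity>" by (simp add: frequently_def)
    then have "liminf (\<lambda>k. penalty (Z k)) = liminf (\<lambda>k. \<infinity>)" by (rule Liminf_eq)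
    then show ?thesis by (simp add: Liminf_const)
  qed
next
  case False
  define r where "r = \<rho> / (\<rho> - 1)"
  have r: "r > 0" using False \<rho>_ge_1 by (simp add: r_def)
  have eq: "penalty \<xi> = (\<integral>\<^sup>+ w. ennreal ((\<rho> - 1) * lp_norm p (\<xi> v* J w) powr r) \<partial>\<mu>)" for \<xi>
    using False \<rho>_ge_1 unfolding penalty_def r_def
    by (simp add: ennreal_mult nn_integral_cmult)
  have "(\<lambda>k. ennreal ((\<rho> - 1) * lp_norm p (Z k v* J w) powr r))
      \<longlonglongrightarrow> ennreal ((\<rho> - 1) * lp_norm p (\<zeta> v* J w) powr r)" for w
    using r tendsto_lp_norm_left_mult[OF Z, of w]
    by (intro tendsto_ennrealI tendsto_mult tendsto_const tendsto_powr2) (auto simp: lp_norm_nonneg)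
  from lim_imp_Liminf[OF sequentially_bot this]
  have "penalty \<zeta> = (\<integral>\<^sup>+ w. liminf (\<lambda>k. ennreal ((\<rho> - 1) * lp_norm p (Z k v* J w) powr r)) \<partial>\<mu>)"
    by (simp add: eq)
  also have "\<dots> \<le> liminf (\<lambda>k. penalty (Z k))"
    unfolding eq by (intro nn_integral_liminf) measurable
  finally show ?thesis .
qed

lemma norm_le_sum_lp_norm: "norm x \<le> real CARD('m) * lp_norm p (x :: real ^ 'm)"
proof -
  have "norm x \<le> (\<Sum>i\<in>UNIV. \<bar>x $ i\<bar>)" by (rule norm_le_l1_cart)
  also have "\<dots> \<le> (\<Sum>i\<in>(UNIV :: 'm set). lp_norm p x)"
    by (intro sum_mono component_le_lp_norm p_ge_1)
  finally show ?thesis by simp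
qed

text \<open>A bounded field with drift \<open>axis i 1\<close> represents \<open>\<zeta> $ i\<close>
  as the integral of \<open>(\<zeta> v* J w) \<bullet> v w\<close>. Surjectivity of
  \<open>drift\<close> thus becomes a quantitative lower bound on the first moment, which may be
  infinite.\<close>

lemma norm_le_first_moment:
  obtains C where "C > 0" "\<forall>\<zeta>. ennreal (norm \<zeta>) \<le> ennreal C * (\<integral>\<^sup>+ w. ennreal (lp_norm p (\<zeta> v* J w)) \<partial>\<mu>)"
proof -
  have "\<exists>B>0. \<forall>\<zeta>. ennreal \<bar>\<zeta> $ i\<bar> \<le> ennreal B * (\<integral>\<^sup>+ w. ennreal (lp_norm p (\<zeta> v* J w)) \<partial>\<mu>)" for i
  proof -
    obtain v where v: "bounded_field v" "drift v = axis i 1" using drift_surjective by blast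
    from v(1) obtain B where B: "B > 0" "\<And>w. norm (v w) \<le> B"
      by (rule bounded_fieldE) blast
    have "ennreal \<bar>\<zeta> $ i\<bar> \<le> ennreal (real CARD('m) * B) * (\<integral>\<^sup>+ w. ennreal (lp_norm p (\<zeta> v* J w)) \<partial>\<mu>)" for \<zeta>
    proof -
      have int: "integrable \<mu> (\<lambda>w. (\<zeta> v* J w) \<bullet> v w)"
        using integrable_inner_right[OF integrable_drift[OF v(1)], of \<zeta>] by (simp add: dot_lmul_matrix)
      have "\<zeta> $ i = \<zeta> \<bullet> drift v" by (simp add: v inner_axis)
      also have "\<dots> = (\<integral>w. (\<zeta> v* J w) \<bullet> v w \<partial>\<mu>)"
        using integrable_drift[OF v(1)] by (simp add: drift_def dot_lmul_matrix)
      finally have "ennreal \<bar>\<zeta> $ i\<bar> \<le> (\<integral>\<^sup>+ w. ennreal \<bar>(\<zeta> v* J w) \<bullet> v w\<bar> \<partial>\<mu>)"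
        using integral_norm_bound_ennreal[OF int] by simp
      also have "\<dots> \<le> (\<integral>\<^sup>+ w. ennreal (real CARD('m) * B) * ennreal (lp_norm p (\<zeta> v* J w)) \<partial>\<mu>)"
      proof (intro nn_integral_mono)
        fix w
        have "\<bar>(\<zeta> v* J w) \<bullet> v w\<bar> \<le> norm (\<zeta> v* J w) * norm (v w)" by (rule Cauchy_Schwarz_ineq2)
        also have "\<dots> \<le> (real CARD('m) * lp_norm p (\<zeta> v* J w)) * B"
          using norm_le_sum_lp_norm[of "\<zeta> v* J w"] B(2)[of w] by (intro mult_mono) (auto simp: lp_norm_nonneg)
        finally show "ennreal \<bar>(\<zeta> v* J w) \<bullet> v w\<bar> \<le> ennreal (real CARD('m) * B) * ennreal (lp_norm p (\<zeta> v* J w))"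
          using B(1) by (simp add: ennreal_mult[symmetric] lp_norm_nonneg mult_ac ennreal_leI)
      qed
      also have "\<dots> = ennreal (real CARD('m) * B) * (\<integral>\<^sup>+ w. ennreal (lp_norm p (\<zeta> v* J w)) \<partial>\<mu>)"
        by (intro nn_integral_cmult) measurable
      finally show ?thesis .
    qed
    then show ?thesis using B(1) by (intro exI[of _ "real CARD('m) * B"]) auto
  qed
  then obtain B where B: "\<And>i. B i > 0"
    "\<And>i \<zeta>. ennreal \<bar>\<zeta> $ i\<bar> \<le> ennreal (B i) * (\<integral>\<^sup>+ w. ennreal (lp_norm p (\<zeta> v* J w)) \<partial>\<mu>)"
    by metis
  have "ennreal (norm \<zeta>) \<le> ennreal (\<Sum>i\<in>UNIV. B i) * (\<integral>\<^sup>+ w. ennreal (lp_norm p (\<zeta> v* J w)) \<partial>\<mu>)" for \<zeta>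
  proof -
    have "ennreal (norm \<zeta>) \<le> (\<Sum>i\<in>UNIV. ennreal \<bar>\<zeta> $ i\<bar>)"
      using norm_le_l1_cart[of \<zeta>] by (simp add: sum_ennreal ennreal_leI)
    also have "\<dots> \<le> (\<Sum>i\<in>UNIV. ennreal (B i) * (\<integral>\<^sup>+ w. ennreal (lp_norm p (\<zeta> v* J w)) \<partial>\<mu>))"
      by (intro sum_mono B)
    also have "\<dots> = ennreal (\<Sum>i\<in>UNIV. B i) * (\<integral>\<^sup>+ w. ennreal (lp_norm p (\<zeta> v* J w)) \<partial>\<mu>)"
      using B(1) by (simp add: sum_distrib_right[symmetric] sum_ennreal less_imp_le)
    finally show ?thesis .
  qed
  moreover have "(\<Sum>i\<in>UNIV. B i) > 0" using B(1) by (intro sum_pos) auto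
  ultimately show thesis by (intro that allI)
qed

text \<open>For \<open>\<rho> = 1\<close> a feasible \<open>\<zeta>\<close> has first moment at most
  1 and therefore norm at most \<open>C\<close>. For \<open>\<rho> > 1\<close> the power in the
  penalty beats every linear function of the first moment.\<close>

lemma penalty_coercive:
  assumes "b \<ge> 0" obtains R where "\<forall>\<zeta>. norm \<zeta> > R \<longrightarrow> ennreal (b * norm \<zeta>) \<le> penalty \<zeta>"
proof -
  obtain C where C: "C > 0"
    "\<forall>\<zeta>. ennreal (norm \<zeta>) \<le> ennreal C * (\<integral>\<^sup>+ w. ennreal (lp_norm p (\<zeta> v* J w)) \<partial>\<mu>)"
    by (rule norm_le_first_moment)
  show thesis
  proof (cases "\<rho> = 1")
    case True
    have "penalty \<zeta> = \<infinity>" if "norm \<zeta> > C" for \<zeta>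
    proof (rule ccontr)
      assume "penalty \<zeta> \<noteq> \<infinity>"
      then have "AE w in \<mu>. lp_norm p (\<zeta> v* J w) \<le> 1" using penalty_finite_iff[OF True] by blast
      then have "(\<integral>\<^sup>+ w. ennreal (lp_norm p (\<zeta> v* J w)) \<partial>\<mu>) \<le> (\<integral>\<^sup>+ w. 1 \<partial>\<mu>)"
        by (intro nn_integral_mono_AE) (auto elim!: eventually_mono)
      then have "(\<integral>\<^sup>+ w. ennreal (lp_norm p (\<zeta> v* J w)) \<partial>\<mu>) \<le> 1"
        by (simp add: emeasure_space_1[simplified])
      then have "ennreal C * (\<integral>\<^sup>+ w. ennreal (lp_norm p (\<zeta> v* J w)) \<partial>\<mu>) \<le> ennreal C * 1"
        by (intro mult_left_mono) auto
      with C(2) have "ennreal (norm \<zeta>) \<le> ennreal C" by (metis mult.right_neutral order_trans)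
      then show False using that C(1) by (simp add: ennreal_le_iff)
    qed
    then show thesis by (intro that[of C]) auto
  next
    case False
    define r where "r = \<rho> / (\<rho> - 1)"
    have \<rho>: "\<rho> > 1" and r: "r > 1" using False \<rho>_ge_1 by (simp_all add: r_def field_simps)
    \<comment> \<open>With this slope the penalty controls \<open>(b + 1) * norm \<zeta>\<close> up
      to the constant \<open>(\<rho> - 1) * D\<close>. The surplus 1 in \<open>b + 1\<close> absorbs
      that constant once \<open>norm \<zeta>\<close> exceeds it.\<close>
    define A where "A = (b + 1) * C / (\<rho> - 1)"
    have A: "A \<ge> 0" using assms C \<rho> by (simp add: A_def)
    define D where "D = A * A powr (1 / (r - 1))"
    have D: "D \<ge> 0" using A by (simp add: D_def)
    have "ennreal (b * norm \<zeta>) \<le> penalty \<zeta>" if R: "norm \<zeta> > (\<rho> - 1) * D" for \<zeta>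
    proof -
      let ?I = "\<integral>\<^sup>+ w. ennreal (lp_norm p (\<zeta> v* J w)) \<partial>\<mu>"
      let ?G = "\<integral>\<^sup>+ w. ennreal (lp_norm p (\<zeta> v* J w) powr r) \<partial>\<mu>"
      have "ennreal A * ?I = (\<integral>\<^sup>+ w. ennreal A * ennreal (lp_norm p (\<zeta> v* J w)) \<partial>\<mu>)"
        by (intro nn_integral_cmult[symmetric]) measurable
      also have "\<dots> \<le> (\<integral>\<^sup>+ w. ennreal (lp_norm p (\<zeta> v* J w) powr r) + ennreal D \<partial>\<mu>)"
      proof (intro nn_integral_mono)
        fix w
        have "A * lp_norm p (\<zeta> v* J w) \<le> lp_norm p (\<zeta> v* J w) powr r + D"
          unfolding D_def using A r by (intro powr_ge_linear lp_norm_nonneg)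
        then show "ennreal A * ennreal (lp_norm p (\<zeta> v* J w)) \<le> ennreal (lp_norm p (\<zeta> v* J w) powr r) + ennreal D"
          using A D by (simp add: ennreal_mult[symmetric] lp_norm_nonneg ennreal_leI flip: ennreal_plus)
      qed
      also have "\<dots> = ?G + ennreal D"
        by (subst nn_integral_add) (auto simp: emeasure_space_1[simplified])
      finally have "ennreal (\<rho> - 1) * (ennreal A * ?I) \<le> ennreal (\<rho> - 1) * (?G + ennreal D)"
        by (intro mult_left_mono) auto
      then have 1: "ennreal (\<rho> - 1) * ennreal A * ?I \<le> penalty \<zeta> + ennreal ((\<rho> - 1) * D)"
        using False \<rho> D by (simp add: penalty_def r_def distrib_left mult.assoc ennreal_mult)
      have "ennreal ((b + 1) * norm \<zeta>) = ennreal (b + 1) * ennreal (norm \<zeta>)"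
        using assms by (simp add: ennreal_mult)
      also have "\<dots> \<le> ennreal (b + 1) * (ennreal C * ?I)" using C(2) by (intro mult_left_mono) auto
      also have "ennreal (b + 1) * (ennreal C * ?I) = ennreal (\<rho> - 1) * ennreal A * ?I"
        using assms C \<rho> A
        by (simp add: A_def mult.assoc[symmetric] ennreal_mult[symmetric] del: ennreal_plus)
      also note 1
      finally have *: "ennreal ((b + 1) * norm \<zeta>) \<le> penalty \<zeta> + ennreal ((\<rho> - 1) * D)" .
      show ?thesis
      proof (cases "penalty \<zeta>")
        case (real x)
        then have "ennreal ((b + 1) * norm \<zeta>) \<le> ennreal (x + (\<rho> - 1) * D)"
          using * D \<rho> by simp
        then have "(b + 1) * norm \<zeta> \<le> x + (\<rho> - 1) * D"
          using real D \<rho> by (subst (asm) ennreal_le_iff) auto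
        then show ?thesis using R real by (simp add: ennreal_leI algebra_simps)
      qed simp
    qed
    then show thesis by (intro that[of "(\<rho> - 1) * D"]) auto
  qed
qed

lemma limit_bound_nonneg: "0 \<le> limit_bound p \<rho> \<mu> J y"
  unfolding limit_bound_def
  by (intro Sup_upper zero_in_limit_values)

text \<open>Direct method: coercivity keeps a maximising sequence bounded, and semicontinuity of the
  penalty makes a limit point a maximiser. A zero supremum is attained at \<open>\<zeta> = 0\<close>
  and is treated apart, so that the sequence may be taken with positive values.\<close>

theorem limit_bound_attained: "limit_bound p \<rho> \<mu> J y \<in> limit_values p \<rho> \<mu> J y"
proof (cases "limit_bound p \<rho> \<mu> J y = 0")
  case True
  then show ?thesis using zero_in_limit_values by simp
next
  case False
  let ?L = "limit_bound p \<rho> \<mu> J y"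
  have pos: "0 < ?L" using False limit_bound_nonneg[of y] by simp
  have ne: "limit_values p \<rho> \<mu> J y \<noteq> {}"
    using zero_in_limit_values by blast
  obtain f where f: "incseq f" "range f \<subseteq> limit_values p \<rho> \<mu> J y" "?L = (SUP i. f i)"
    using Sup_countable_SUP[OF ne] unfolding limit_bound_def by blast
  \<comment> \<open>From index \<open>N\<close> on the values are positive. This forces finite
    penalties below \<open>\<rho> * (Z k \<bullet> y)\<close>, which coercivity with slope
    \<open>\<rho> * norm y\<close> contradicts for large \<open>Z k\<close>.\<close>
  obtain N where N: "0 < f N" using pos f(3) less_SUP_iff[of 0 f UNIV] by auto
  have fpos: "0 < f (k + N)" for k
    using N incseqD[OF f(1), of N "k + N"] by simp
  have "\<exists>\<zeta>. f (k + N) = ereal (\<rho> * (\<zeta> \<bullet> y)) - enn2ereal (penalty \<zeta>)" for k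
    using f(2) limit_values_penalty[of "f (k + N)" y] by blast
  then obtain Z where Z: "\<And>k. f (k + N) = ereal (\<rho> * (Z k \<bullet> y)) - enn2ereal (penalty (Z k))"
    by metis
  have "\<exists>x. 0 \<le> x \<and> penalty (Z k) = ennreal x" for k
    using fpos[of k] Z[of k] by (cases "penalty (Z k)") (auto simp: top_ennreal.rep_eq)
  then obtain \<phi> where \<phi>: "\<And>k. 0 \<le> \<phi> k" "\<And>k. penalty (Z k) = ennreal (\<phi> k)"
    by metis
  have fk: "f (k + N) = ereal (\<rho> * (Z k \<bullet> y) - \<phi> k)" for k
    using Z[of k] \<phi>[of k] by (simp add: enn2ereal_ennreal)
  have \<phi>_less: "\<phi> k < \<rho> * (Z k \<bullet> y)" for k using fpos[of k] fk[of k] by simp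
  obtain R where R: "\<forall>\<zeta>. norm \<zeta> > R \<longrightarrow> ennreal ((\<rho> * norm y) * norm \<zeta>) \<le> penalty \<zeta>"
    by (rule penalty_coercive[of "\<rho> * norm y"]) (use \<rho>_ge_1 in auto)
  have "norm (Z k) \<le> R" for k
  proof (rule ccontr)
    assume "\<not> norm (Z k) \<le> R"
    then have "ennreal (\<rho> * norm y * norm (Z k)) \<le> ennreal (\<phi> k)" using R \<phi>(2)[of k] by (metis not_le)
    then have "\<rho> * norm y * norm (Z k) \<le> \<phi> k" using \<phi>(1)[of k] by (simp add: ennreal_le_iff)
    moreover have "\<rho> * (Z k \<bullet> y) \<le> \<rho> * (norm (Z k) * norm y)"
      using \<rho>_ge_1 norm_cauchy_schwarz by (intro mult_left_mono) auto
    ultimately show False using \<phi>_less[of k] by (simp add: mult_ac)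
  qed
  then have "\<forall>k. Z k \<in> cball 0 R" by simp
  then obtain \<zeta> s where s: "strict_mono (s :: nat \<Rightarrow> nat)" "(Z \<circ> s) \<longlonglongrightarrow> \<zeta>"
    using compact_cball[of 0 R] unfolding compact_def by metis
  have "(\<lambda>k. f (s k + N)) \<longlonglongrightarrow> ?L"
    using LIMSEQ_subseq_LIMSEQ[OF LIMSEQ_ignore_initial_segment[OF LIMSEQ_SUP[OF f(1)], of N] s(1)] f(3)
    by (simp add: comp_def)
  moreover have lim_inner: "(\<lambda>k. ereal (\<rho> * (Z (s k) \<bullet> y))) \<longlonglongrightarrow> ereal (\<rho> * (\<zeta> \<bullet> y))"
    using s(2) by (auto intro!: tendsto_intros simp: comp_def)
  moreover have "f (s k + N) \<le> ereal (\<rho> * (Z (s k) \<bullet> y))" for k using fk \<phi>(1) by simp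
  ultimately have "?L \<le> ereal (\<rho> * (\<zeta> \<bullet> y))" by (intro LIMSEQ_le[of "\<lambda>k. f (s k + N)" _ "\<lambda>k. ereal (\<rho> * (Z (s k) \<bullet> y))"]) auto
  then obtain b where b: "?L = ereal b" using pos by (cases ?L) auto
  \<comment> \<open>Values and linear terms converge along the subsequence, hence so do the
    penalties; semicontinuity then bounds the penalty at the limit point.\<close>
  have "(\<lambda>k. \<rho> * (Z (s k) \<bullet> y) - \<phi> (s k)) \<longlonglongrightarrow> b"
    using \<open>(\<lambda>k. f (s k + N)) \<longlonglongrightarrow> ?L\<close> by (simp add: fk b)
  then have "(\<lambda>k. \<rho> * (Z (s k) \<bullet> y) - (\<rho> * (Z (s k) \<bullet> y) - \<phi> (s k))) \<longlonglongrightarrow> \<rho> * (\<zeta> \<bullet> y) - b"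
    using lim_inner by (intro tendsto_diff) auto
  then have lim: "(\<lambda>k. \<phi> (s k)) \<longlonglongrightarrow> \<rho> * (\<zeta> \<bullet> y) - b" by simp
  then have nonneg: "0 \<le> \<rho> * (\<zeta> \<bullet> y) - b" using \<phi>(1) by (intro LIMSEQ_le_const) auto
  have "(\<lambda>k. penalty ((Z \<circ> s) k)) \<longlonglongrightarrow> ennreal (\<rho> * (\<zeta> \<bullet> y) - b)"
    using lim by (simp add: \<phi>(2) tendsto_ennrealI)
  then have "penalty \<zeta> \<le> ennreal (\<rho> * (\<zeta> \<bullet> y) - b)"
    using penalty_lsc[OF s(2)] lim_imp_Liminf[OF sequentially_bot] by fastforce
  then obtain x where x: "penalty \<zeta> = ennreal x" "0 \<le> x" "x \<le> \<rho> * (\<zeta> \<bullet> y) - b"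
    using nonneg by (cases "penalty \<zeta>") (auto simp: ennreal_le_iff top_unique)
  have mem: "ereal (\<rho> * (\<zeta> \<bullet> y)) - enn2ereal (penalty \<zeta>) \<in> limit_values p \<rho> \<mu> J y"
    using x by (intro limit_valuesI) simp
  then have "ereal (\<rho> * (\<zeta> \<bullet> y)) - enn2ereal (penalty \<zeta>) \<le> ?L"
    unfolding limit_bound_def by (rule Sup_upper)
  moreover have "?L \<le> ereal (\<rho> * (\<zeta> \<bullet> y)) - enn2ereal (penalty \<zeta>)"
    using x b by (simp add: enn2ereal_ennreal)
  ultimately show ?thesis using mem by simp
qed

definition real_bound :: "real ^ 'r \<Rightarrow> real" where
  "real_bound y = real_of_ereal (limit_bound p \<rho> \<mu> J y)"

lemma limit_bound_eq: "limit_bound p \<rho> \<mu> J y = ereal (real_bound y)"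
proof -
  obtain \<zeta> where "limit_bound p \<rho> \<mu> J y = ereal (\<rho> * (\<zeta> \<bullet> y)) - enn2ereal (penalty \<zeta>)"
    using limit_bound_attained[of y] limit_values_penalty by blast
  then have "limit_bound p \<rho> \<mu> J y \<noteq> \<infinity>" by (cases "penalty \<zeta>") (auto simp: enn2ereal_ennreal top_ennreal.rep_eq)
  then show ?thesis using limit_bound_nonneg[of y] by (cases "limit_bound p \<rho> \<mu> J y") (auto simp: real_bound_def)
qed

lemma real_bound_nonneg: "0 \<le> real_bound y"
  using limit_bound_nonneg[of y] by (simp add: limit_bound_eq)

text \<open>A maximiser at an intermediate point supplies an affine function that lies below
  \<open>real_bound\<close> everywhere and touches it there, which gives convexity. A finite convex
  function on the whole space is continuous.\<close>

lemma continuous_real_bound: "continuous_on UNIV real_bound"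
proof (rule convex_on_continuous)
  show "convex_on UNIV real_bound"
  proof (rule convex_onI)
    fix t :: real and x y :: "real ^ 'r" assume t: "0 < t" "t < (1::real)"
    define z where "z = (1 - t) *\<^sub>R x + t *\<^sub>R y"
    obtain \<zeta> where \<zeta>: "ereal (real_bound z) = ereal (\<rho> * (\<zeta> \<bullet> z)) - enn2ereal (penalty \<zeta>)"
      using limit_bound_attained[of z] limit_values_penalty[of _ z] limit_bound_eq by metis
    then obtain a where a: "penalty \<zeta> = ennreal a" "a \<ge> 0"
      by (cases "penalty \<zeta>") (auto simp: top_ennreal.rep_eq)
    have ge: "\<rho> * (\<zeta> \<bullet> u) - a \<le> real_bound u" for u
    proof -
      have "ereal (\<rho> * (\<zeta> \<bullet> u)) - enn2ereal (penalty \<zeta>) \<in> limit_values p \<rho> \<mu> J u"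
        using a by (intro limit_valuesI) simp
      then have "ereal (\<rho> * (\<zeta> \<bullet> u)) - enn2ereal (penalty \<zeta>) \<le> limit_bound p \<rho> \<mu> J u"
        unfolding limit_bound_def by (rule Sup_upper)
      then show ?thesis using a by (simp add: limit_bound_eq enn2ereal_ennreal)
    qed
    have "real_bound z = \<rho> * (\<zeta> \<bullet> z) - a" using \<zeta> a by (simp add: enn2ereal_ennreal)
    also have "\<dots> = (1 - t) * (\<rho> * (\<zeta> \<bullet> x) - a) + t * (\<rho> * (\<zeta> \<bullet> y) - a)"
      by (simp add: z_def inner_add_right algebra_simps)
    also have "\<dots> \<le> (1 - t) * real_bound x + t * real_bound y"
      using t by (intro add_mono mult_left_mono ge) auto
    finally show "real_bound ((1 - t) *\<^sub>R x + t *\<^sub>R y) \<le> (1 - t) * real_bound x + t * real_bound y"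
      by (simp add: z_def)
  qed simp
qed simp

end

section \<open>Upper bounds and measurability of the profile function\<close>

lemma nn_integral_empirical_measure:
  fixes w :: "nat \<Rightarrow> 'a::topological_space" and f :: "'a \<Rightarrow> ennreal"
  assumes "n > 0" and f: "f \<in> borel_measurable borel"
  shows "(\<integral>\<^sup>+ x. f x \<partial>empirical_measure n w) = (\<Sum>i\<in>{1..n}. ennreal (1 / real n) * f (w i))"
proof -
  have "(\<integral>\<^sup>+ x. f x \<partial>empirical_measure n w) = (\<integral>\<^sup>+ i. f (w i) \<partial>uniform_count_measure {1..n})"
    unfolding empirical_measure_def using f by (intro nn_integral_distr) simp_all
  also have "\<dots> = (\<Sum>i\<in>{1..n}. ennreal (1 / real n) * f (w i))"
    unfolding uniform_count_measure_def by (subst nn_integral_point_measure_finite) (auto simp: mult.commute)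
  finally show ?thesis .
qed

lemma sets_empirical_measure [simp, measurable_cong]: "sets (empirical_measure n w) = sets borel"
  by (simp add: empirical_measure_def)

text \<open>The competitor is the empirical law of the points \<open>x i\<close>, coupled with the
  sample by drawing one common uniform index; coincidences among the points do no harm.\<close>

lemma profile_function_le_points:
  fixes h :: "'a::{second_countable_topology} \<Rightarrow> 't \<Rightarrow> 'b::{banach, second_countable_topology}"
  assumes "n > 0" and h: "(\<lambda>w. h w \<theta>) \<in> borel_measurable borel"
    and c: "(\<lambda>z. c (fst z) (snd z)) \<in> borel_measurable borel" "\<And>u w. 0 \<le> c u w"
    and zero: "(\<Sum>i\<in>{1..n}. h (x i) \<theta>) = 0"
  shows "profile_function c h (empirical_measure n w) \<theta> \<le> ennreal ((\<Sum>i\<in>{1..n}. c (x i) (w i)) / real n)"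
proof -
  let ?U = "uniform_count_measure {1..n}"
  interpret U: prob_space ?U using assms(1) by (intro prob_space_uniform_count_measure) auto
  have x: "x \<in> measurable ?U borel" and xw: "(\<lambda>i. (x i, w i)) \<in> measurable ?U borel" by simp_all
  define P where "P = distr ?U borel x"
  define \<pi> where "\<pi> = distr ?U borel (\<lambda>i. (x i, w i))"
  have fst: "(fst :: 'a \<times> 'a \<Rightarrow> 'a) \<in> borel_measurable borel" and snd: "(snd :: 'a \<times> 'a \<Rightarrow> 'a) \<in> borel_measurable borel"
    by (simp_all add: borel_prod[symmetric])
  have "\<pi> \<in> couplings P (empirical_measure n w)"
    unfolding couplings_def \<pi>_def P_def empirical_measure_def
    using U.prob_space_distr[OF xw] distr_distr[OF fst xw] distr_distr[OF snd xw] by (simp add: comp_def)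
  moreover have "(\<integral>\<^sup>+ (u, w). ennreal (c u w) \<partial>\<pi>) = ennreal ((\<Sum>i\<in>{1..n}. c (x i) (w i)) / real n)"
  proof -
    have "(\<integral>\<^sup>+ z. ennreal (c (fst z) (snd z)) \<partial>\<pi>) = (\<integral>\<^sup>+ i. ennreal (c (x i) (w i)) \<partial>?U)"
      unfolding \<pi>_def using c by (subst nn_integral_distr) simp_all
    also have "\<dots> = (\<Sum>i\<in>{1..n}. ennreal (c (x i) (w i)) * ennreal (1 / real n))"
      unfolding uniform_count_measure_def by (subst nn_integral_point_measure_finite) (auto simp: mult.commute)
    also have "\<dots> = ennreal ((\<Sum>i\<in>{1..n}. c (x i) (w i)) / real n)"
      using c(2) by (simp add: ennreal_mult[symmetric] sum_ennreal sum_divide_distrib)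
    finally show ?thesis by (simp add: case_prod_unfold)
  qed
  ultimately have "transport_cost c P (empirical_measure n w) \<le> ennreal ((\<Sum>i\<in>{1..n}. c (x i) (w i)) / real n)"
    unfolding transport_cost_def by (metis (no_types, lifting) INF_lower)
  moreover have "prob_space P" unfolding P_def by (rule U.prob_space_distr[OF x])
  moreover have "integrable P (\<lambda>w. h w \<theta>)"
    unfolding P_def by (subst integrable_distr_eq[OF x h])
      (auto simp: uniform_count_measure_def intro!: integrable_point_measure_finite)
  moreover have "(\<integral>w. h w \<theta> \<partial>P) = 0"
  proof -
    have "(\<integral>w. h w \<theta> \<partial>P) = (\<integral>i. h (x i) \<theta> \<partial>?U)"
      unfolding P_def by (rule integral_distr[OF x h])
    also have "\<dots> = (\<Sum>i\<in>{1..n}. (1 / real n) *\<^sub>R h (x i) \<theta>)"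
      unfolding uniform_count_measure_def by (subst lebesgue_integral_point_measure_finite) auto
    also have "\<dots> = 0" using zero by (simp only: scaleR_sum_right[symmetric] scaleR_zero_right)
    finally show ?thesis .
  qed
  ultimately show ?thesis
    unfolding profile_function_def by (intro INF_lower2[of P]) (auto simp: P_def)
qed

lemma measurable_cost_term:
  "(\<lambda>x :: (real ^ 'm) \<times> (real ^ 'm). ennreal ((lp_norm q (fst x - snd x) + a) powr \<rho>)) \<in> borel_measurable borel"
proof -
  have "(\<lambda>x :: (real ^ 'm) \<times> (real ^ 'm). fst x - snd x) \<in> borel_measurable borel"
    by (intro borel_measurable_continuous_onI continuous_intros)
  then show ?thesis
    by (rule measurable_compose[where g = "\<lambda>t. ennreal ((lp_norm q t + a) powr \<rho>)"]) measurable
qed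

text \<open>Mass that \<open>\<pi>\<close> sends to a point \<open>z\<close> is shared equally among the indices \<open>j\<close> with \<open>w j = z\<close> and
  then moved to \<open>w' j\<close>, because the support points of the empirical measure may coincide.\<close>

lemma coupling_move_support:
  fixes w w' :: "nat \<Rightarrow> real ^ 'm"
  assumes n: "n > 0" and \<pi>: "\<pi> \<in> couplings P (empirical_measure n w)"
    and q: "q \<ge> 1" and \<rho>: "\<rho> \<ge> 1" and close: "\<And>j. j \<in> {1..n} \<Longrightarrow> lp_norm q (w j - w' j) \<le> \<delta>"
  obtains \<pi>' where "\<pi>' \<in> couplings P (empirical_measure n w')"
    "(\<integral>\<^sup>+ (u, z). ennreal (lp_norm q (u - z) powr \<rho>) \<partial>\<pi>') \<le>
     (\<integral>\<^sup>+ (u, z). ennreal ((lp_norm q (u - z) + \<delta>) powr \<rho>) \<partial>\<pi>)"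
proof -
  let ?I = "{1..n}"
  interpret pi: prob_space \<pi> using \<pi> by (simp add: couplings_def)
  have sets_\<pi> [measurable_cong, simp]: "sets \<pi> = sets borel" using \<pi> by (simp add: couplings_def)
  have fst_\<pi>: "distr \<pi> borel fst = P" and snd_\<pi>: "distr \<pi> borel snd = empirical_measure n w"
    using \<pi> by (simp_all add: couplings_def)
  have [measurable]: "(fst :: (real ^ 'm) \<times> (real ^ 'm) \<Rightarrow> real ^ 'm) \<in> borel_measurable borel"
      "(snd :: (real ^ 'm) \<times> (real ^ 'm) \<Rightarrow> real ^ 'm) \<in> borel_measurable borel"
    by (simp_all add: borel_prod[symmetric])
  \<comment> \<open>\<open>N z\<close> is the multiplicity of \<open>z\<close> in the sample. The
    weights \<open>wt j z\<close> sum to 1 over \<open>j\<close> at each support point, which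
    preserves the first marginal, and to 1 over the sample for each \<open>j\<close>, which gives
    every index mass \<open>1 / n\<close>.\<close>
  define N where "N z = real (card {k\<in>?I. w k = z})" for z
  define wt where "wt j z = (if w j = z then 1 / N z else 0)" for j z
  have wt_nonneg: "0 \<le> wt j z" for j z by (simp add: wt_def N_def)
  have wt_eq: "wt j z = indicator {w j} z * (1 / N (w j))" for j z by (simp add: wt_def indicator_def)
  have wt_meas [measurable]: "wt j \<in> borel_measurable borel" for j
    unfolding wt_eq[abs_def] by measurable
  have wt_sum: "(\<Sum>j\<in>?I. wt j z) = 1" if "z \<in> w ` ?I" for z
  proof -
    have "(\<Sum>j\<in>?I. wt j z) = (\<Sum>j\<in>{k\<in>?I. w k = z}. 1 / N z)"
      unfolding wt_def by (rule sum.inter_filter[symmetric]) simp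
    also have "\<dots> = N z * (1 / N z)" by (simp add: N_def)
    also have "N z \<noteq> 0" using that by (auto simp: N_def)
    then have "N z * (1 / N z) = 1" by simp
    finally show ?thesis .
  qed
  have wt_sum': "(\<Sum>k\<in>?I. wt j (w k)) = 1" if "j \<in> ?I" for j
  proof -
    have "(\<Sum>k\<in>?I. wt j (w k)) = (\<Sum>k\<in>{k\<in>?I. w k = w j}. 1 / N (w j))"
      unfolding wt_def by (subst sum.inter_filter) (auto intro!: sum.cong)
    also have "\<dots> = N (w j) * (1 / N (w j))" by (simp add: N_def)
    also have "N (w j) \<noteq> 0" using that by (auto simp: N_def)
    then have "N (w j) * (1 / N (w j)) = 1" by simp
    finally show ?thesis .
  qed
  have AE_support: "AE x in \<pi>. snd x \<in> w ` ?I"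
  proof -
    have "- (w ` ?I) \<in> sets borel"
      by (intro borel_open open_Compl finite_imp_closed finite_imageI finite_atLeastAtMost)
    then have ind [measurable]: "(indicator (- (w ` ?I)) :: _ \<Rightarrow> ennreal) \<in> borel_measurable borel"
      by (rule borel_measurable_indicator)
    have "(\<integral>\<^sup>+ z. indicator (- (w ` ?I)) z \<partial>empirical_measure n w) = 0"
      by (subst nn_integral_empirical_measure[OF n ind]) (auto intro!: sum.neutral simp: indicator_def)
    then have "AE z in empirical_measure n w. indicator (- (w ` ?I)) z = (0::ennreal)"
      using ind by (subst (asm) nn_integral_0_iff_AE) simp_all
    then have "AE z in distr \<pi> borel snd. z \<in> w ` ?I"
      unfolding snd_\<pi> by (auto elim!: eventually_mono simp: indicator_def split: if_splits)
    moreover have "w ` ?I \<in> sets borel"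
      by (intro borel_closed finite_imp_closed finite_imageI finite_atLeastAtMost)
    ultimately show ?thesis by (subst (asm) AE_distr_iff) auto
  qed
  \<comment> \<open>Joint law of an index and a pair drawn from \<open>\<pi>\<close>: given the
    pair, the index is chosen with the weights \<open>wt\<close>. Its image \<open>\<pi>'\<close>
    replaces the second coordinate by \<open>w' j\<close>.\<close>
  define B where "B = density (count_space ?I \<Otimes>\<^sub>M \<pi>) (\<lambda>(j, x). ennreal (wt j (snd x)))"
  define \<pi>' where "\<pi>' = distr B borel (\<lambda>(j, x). (fst x, w' j))"
  have m1: "(\<lambda>(j, x). ennreal (wt j (snd x))) \<in> borel_measurable (count_space ?I \<Otimes>\<^sub>M \<pi>)"
    by (rule measurable_pair_measure_countable1) simp_all
  have m2: "(\<lambda>(j, x). (fst x, w' j)) \<in> measurable (count_space ?I \<Otimes>\<^sub>M \<pi>) borel"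
    by (rule measurable_pair_measure_countable1) (simp_all add: borel_prod[symmetric])
  have int: "(\<integral>\<^sup>+ y. f y \<partial>\<pi>') = (\<Sum>j\<in>?I. \<integral>\<^sup>+ x. ennreal (wt j (snd x)) * f (fst x, w' j) \<partial>\<pi>)"
    if f: "f \<in> borel_measurable borel" for f :: "_ \<Rightarrow> ennreal"
  proof -
    have m3: "(\<lambda>y. f (case y of (j, x) \<Rightarrow> (fst x, w' j))) \<in> borel_measurable (count_space ?I \<Otimes>\<^sub>M \<pi>)"
      using measurable_compose[OF m2 f] by simp
    have "(\<integral>\<^sup>+ y. f y \<partial>\<pi>') = (\<integral>\<^sup>+ y. f (case y of (j, x) \<Rightarrow> (fst x, w' j)) \<partial>B)"
      unfolding \<pi>'_def using f m2 by (intro nn_integral_distr) (simp_all add: B_def)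
    also have "\<dots> = (\<integral>\<^sup>+ y. (case y of (j, x) \<Rightarrow> ennreal (wt j (snd x))) * f (case y of (j, x) \<Rightarrow> (fst x, w' j))
        \<partial>(count_space ?I \<Otimes>\<^sub>M \<pi>))"
      unfolding B_def by (intro nn_integral_density m1 m3)
    also have "\<dots> = (\<integral>\<^sup>+ j. \<integral>\<^sup>+ x. ennreal (wt j (snd x)) * f (fst x, w' j) \<partial>\<pi> \<partial>count_space ?I)"
      by (subst pi.nn_integral_fst[symmetric]) (use m1 m3 in auto)
    also have "\<dots> = (\<Sum>j\<in>?I. \<integral>\<^sup>+ x. ennreal (wt j (snd x)) * f (fst x, w' j) \<partial>\<pi>)"
      by (rule nn_integral_count_space_finite) simp
    finally show ?thesis .
  qed
  have wt_int: "(\<Sum>j\<in>?I. \<integral>\<^sup>+ x. ennreal (wt j (snd x)) * g x \<partial>\<pi>) = (\<integral>\<^sup>+ x. g x \<partial>\<pi>)"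
    if g [measurable]: "g \<in> borel_measurable borel" for g
  proof -
    have "(\<Sum>j\<in>?I. \<integral>\<^sup>+ x. ennreal (wt j (snd x)) * g x \<partial>\<pi>)
        = (\<integral>\<^sup>+ x. (\<Sum>j\<in>?I. ennreal (wt j (snd x)) * g x) \<partial>\<pi>)"
      by (rule nn_integral_sum[symmetric]) measurable
    also have "\<dots> = (\<integral>\<^sup>+ x. g x \<partial>\<pi>)"
    proof (rule nn_integral_cong_AE, use AE_support in \<open>rule eventually_mono\<close>)
      fix x :: "(real ^ 'm) \<times> (real ^ 'm)" assume "snd x \<in> w ` ?I"
      then have "ennreal (\<Sum>j\<in>?I. wt j (snd x)) = 1" by (simp only: wt_sum ennreal_1)
      then show "(\<Sum>j\<in>?I. ennreal (wt j (snd x)) * g x) = g x"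
        by (simp add: sum_distrib_right[symmetric] sum_ennreal wt_nonneg)
    qed
    finally show ?thesis .
  qed
  have sets_\<pi>': "sets \<pi>' = sets borel" by (simp add: \<pi>'_def)
  have fst_\<pi>': "distr \<pi>' borel fst = P"
  proof (rule measure_eqI)
    show "sets (distr \<pi>' borel fst) = sets P" using fst_\<pi> by auto
    fix A :: "(real ^ 'm) set" assume "A \<in> sets (distr \<pi>' borel fst)"
    then have A [measurable]: "A \<in> sets borel" by simp
    have "emeasure (distr \<pi>' borel fst) A = (\<integral>\<^sup>+ y. indicator A (fst y) \<partial>\<pi>')"
      by (subst nn_integral_indicator[symmetric], simp, subst nn_integral_distr)
        (auto simp: \<pi>'_def)
    also have "\<dots> = (\<integral>\<^sup>+ x. indicator A (fst x) \<partial>\<pi>)"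
    proof -
      have ind: "(\<lambda>x :: (real ^ 'm) \<times> (real ^ 'm). indicator A (fst x) :: ennreal) \<in> borel_measurable borel"
        by measurable
      show ?thesis using int[OF ind] wt_int[OF ind] by simp
    qed
    also have "\<dots> = emeasure P A"
      unfolding fst_\<pi>[symmetric]
      by (subst nn_integral_indicator[symmetric], simp, subst nn_integral_distr) auto
    finally show "emeasure (distr \<pi>' borel fst) A = emeasure P A" .
  qed
  have snd_\<pi>': "distr \<pi>' borel snd = empirical_measure n w'"
  proof (rule measure_eqI)
    show "sets (distr \<pi>' borel snd) = sets (empirical_measure n w')" by simp
    fix A :: "(real ^ 'm) set" assume "A \<in> sets (distr \<pi>' borel snd)"
    then have A [measurable]: "A \<in> sets borel" by simp
    have "emeasure (distr \<pi>' borel snd) A = (\<integral>\<^sup>+ y. indicator A (snd y) \<partial>\<pi>')"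
      by (subst nn_integral_indicator[symmetric], simp, subst nn_integral_distr)
        (auto simp: \<pi>'_def)
    also have "\<dots> = (\<Sum>j\<in>?I. \<integral>\<^sup>+ x. ennreal (wt j (snd x)) * indicator A (w' j) \<partial>\<pi>)"
      by (subst int) auto
    also have "\<dots> = (\<Sum>j\<in>?I. (\<integral>\<^sup>+ z. ennreal (wt j z) \<partial>empirical_measure n w) * indicator A (w' j))"
      unfolding snd_\<pi>[symmetric] by (intro sum.cong refl) (simp add: nn_integral_distr nn_integral_multc)
    also have "\<dots> = (\<Sum>j\<in>?I. ennreal (1 / real n) * indicator A (w' j))"
    proof (intro sum.cong refl arg_cong2[where f="(*)"])
      fix j assume j: "j \<in> ?I"
      have "(\<integral>\<^sup>+ z. ennreal (wt j z) \<partial>empirical_measure n w) = (\<Sum>k\<in>?I. ennreal (1 / real n) * ennreal (wt j (w k)))"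
        by (rule nn_integral_empirical_measure[OF n]) simp
      also have "\<dots> = ennreal (1 / real n) * ennreal (\<Sum>k\<in>?I. wt j (w k))"
        by (simp add: sum_distrib_left[symmetric] sum_ennreal wt_nonneg)
      finally show "(\<integral>\<^sup>+ z. ennreal (wt j z) \<partial>empirical_measure n w) = ennreal (1 / real n)"
        using wt_sum'[OF j] by simp
    qed
    also have "\<dots> = (\<integral>\<^sup>+ z. indicator A z \<partial>empirical_measure n w')"
      by (rule nn_integral_empirical_measure[OF n, symmetric]) simp
    also have "\<dots> = emeasure (empirical_measure n w') A" by simp
    finally show "emeasure (distr \<pi>' borel snd) A = emeasure (empirical_measure n w') A" .
  qed
  have "prob_space \<pi>'"
  proof (rule prob_spaceI)
    have "emeasure \<pi>' (space \<pi>') = (\<integral>\<^sup>+ y. 1 \<partial>\<pi>')" by simp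
    also have "\<dots> = (\<integral>\<^sup>+ x. 1 \<partial>\<pi>)" by (subst int) (use wt_int[of "\<lambda>_. 1"] in auto)
    finally show "emeasure \<pi>' (space \<pi>') = 1" by (simp add: pi.emeasure_space_1)
  qed
  then have "\<pi>' \<in> couplings P (empirical_measure n w')"
    using sets_\<pi>' fst_\<pi>' snd_\<pi>' by (simp add: couplings_def)
  moreover have "(\<integral>\<^sup>+ y. ennreal (lp_norm q (fst y - snd y) powr \<rho>) \<partial>\<pi>') \<le>
     (\<integral>\<^sup>+ x. ennreal ((lp_norm q (fst x - snd x) + \<delta>) powr \<rho>) \<partial>\<pi>)"
  proof -
    have "(\<integral>\<^sup>+ y. ennreal (lp_norm q (fst y - snd y) powr \<rho>) \<partial>\<pi>')
        = (\<Sum>j\<in>?I. \<integral>\<^sup>+ x. ennreal (wt j (snd x)) * ennreal (lp_norm q (fst x - w' j) powr \<rho>) \<partial>\<pi>)"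
      using int[OF measurable_cost_term[of q 0 \<rho>]] by simp
    also have "\<dots> \<le> (\<Sum>j\<in>?I. \<integral>\<^sup>+ x. ennreal (wt j (snd x)) * ennreal ((lp_norm q (fst x - snd x) + \<delta>) powr \<rho>) \<partial>\<pi>)"
    proof (intro sum_mono nn_integral_mono)
      fix j x assume j: "j \<in> ?I"
      show "ennreal (wt j (snd x)) * ennreal (lp_norm q (fst x - w' j) powr \<rho>)
          \<le> ennreal (wt j (snd x)) * ennreal ((lp_norm q (fst x - snd x) + \<delta>) powr \<rho>)"
      proof (cases "w j = snd x")
        case True
        have "lp_norm q (fst x - w' j) \<le> lp_norm q (fst x - snd x) + \<delta>"
          using lp_norm_triangle[OF q, of "fst x - w j" "w j - w' j"] close[OF j] True by simp
        then have "lp_norm q (fst x - w' j) powr \<rho> \<le> (lp_norm q (fst x - snd x) + \<delta>) powr \<rho>"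
          using \<rho> by (intro powr_mono2) (auto simp: lp_norm_nonneg)
        then show ?thesis by (intro mult_left_mono ennreal_leI) auto
      qed (simp add: wt_def)
    qed
    also have "\<dots> = (\<integral>\<^sup>+ x. ennreal ((lp_norm q (fst x - snd x) + \<delta>) powr \<rho>) \<partial>\<pi>)"
      by (rule wt_int) (rule measurable_cost_term)
    finally show ?thesis .
  qed
  ultimately show thesis by (intro that[of \<pi>']) (simp_all add: case_prod_unfold)
qed

text \<open>A coupling of cost below \<open>a\<close> leaves strict slack. A small move of the
  sample raises each distance by at most \<open>1 / real (Suc k)\<close>, and the raised cost
  decreases to the original one as \<open>k\<close> grows, so some \<open>k\<close> stays below
  \<open>a\<close> with the same competitor \<open>P\<close>.\<close>

lemma profile_function_upper_semicontinuous:
  fixes w :: "nat \<Rightarrow> real ^ 'm" and h :: "real ^ 'm \<Rightarrow> 't \<Rightarrow> 'b::{banach, second_countable_topology}"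
    and q :: ennreal and \<rho> :: real
  defines "c \<equiv> \<lambda>u w. lp_norm q (u - w) powr \<rho>"
  assumes n: "n > 0" and q: "q \<ge> 1" and \<rho>: "\<rho> \<ge> 1"
    and less: "profile_function c h (empirical_measure n w) \<theta> < a"
  obtains \<delta> where "\<delta> > 0"
    "\<forall>w'. (\<forall>j\<in>{1..n}. dist (w' j) (w j) < \<delta>) \<longrightarrow> profile_function c h (empirical_measure n w') \<theta> < a"
proof -
  from less obtain P where P: "prob_space P" "sets P = sets borel" "integrable P (\<lambda>w. h w \<theta>)" "(\<integral>w. h w \<theta> \<partial>P) = 0"
    and "transport_cost c P (empirical_measure n w) < a"
    unfolding profile_function_def INF_less_iff by auto
  then obtain \<pi> where \<pi>: "\<pi> \<in> couplings P (empirical_measure n w)"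
    and cost: "(\<integral>\<^sup>+ (u, w). ennreal (c u w) \<partial>\<pi>) < a"
    unfolding transport_cost_def INF_less_iff by auto
  interpret pi: prob_space \<pi> using \<pi> by (simp add: couplings_def)
  have [measurable_cong, simp]: "sets \<pi> = sets borel" using \<pi> by (simp add: couplings_def)
  have [measurable]: "(fst :: (real ^ 'm) \<times> (real ^ 'm) \<Rightarrow> real ^ 'm) \<in> borel_measurable borel"
      "(snd :: (real ^ 'm) \<times> (real ^ 'm) \<Rightarrow> real ^ 'm) \<in> borel_measurable borel"
    by (simp_all add: borel_prod[symmetric])
  let ?L = "\<lambda>x. lp_norm q (fst x - snd x)"
  define g where "g k x = ennreal ((?L x + 1 / real (Suc k)) powr \<rho>)" for k and x :: "(real ^ 'm) \<times> (real ^ 'm)"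
  have g_meas [measurable]: "g k \<in> borel_measurable borel" for k
    unfolding g_def by (rule measurable_cost_term)
  have cost': "(\<integral>\<^sup>+ x. ennreal (?L x powr \<rho>) \<partial>\<pi>) < a" using cost by (simp add: c_def case_prod_unfold)
  \<comment> \<open>Exchanging infimum and integral needs a finite member of the decreasing family;
    it comes from \<open>(t + 1) powr \<rho> \<le> 2 powr \<rho> * (t powr \<rho> +
    1)\<close>.\<close>
  have "(\<integral>\<^sup>+ x. g 0 x \<partial>\<pi>) < \<infinity>"
  proof -
    have "g 0 x \<le> ennreal (2 powr \<rho>) * ennreal (?L x powr \<rho>) + ennreal (2 powr \<rho>)" for x
    proof -
      have "(?L x + 1) powr \<rho> \<le> (2 * max (?L x) 1) powr \<rho>"
        using \<rho> by (intro powr_mono2) (auto simp: lp_norm_nonneg)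
      also have "\<dots> = 2 powr \<rho> * (max (?L x) 1) powr \<rho>" by (simp add: powr_mult)
      also have "\<dots> \<le> 2 powr \<rho> * (?L x powr \<rho> + 1)" by (intro mult_left_mono) (auto simp: max_def)
      finally show ?thesis
        by (simp add: g_def ennreal_mult[symmetric] ennreal_leI distrib_left flip: ennreal_plus)
    qed
    then have "(\<integral>\<^sup>+ x. g 0 x \<partial>\<pi>) \<le> (\<integral>\<^sup>+ x. ennreal (2 powr \<rho>) * ennreal (?L x powr \<rho>) + ennreal (2 powr \<rho>) \<partial>\<pi>)"
      by (intro nn_integral_mono)
    also have "\<dots> = ennreal (2 powr \<rho>) * (\<integral>\<^sup>+ x. ennreal (?L x powr \<rho>) \<partial>\<pi>) + ennreal (2 powr \<rho>)"
      by (subst nn_integral_add) (auto simp: nn_integral_cmult pi.emeasure_space_1)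
    also have "\<dots> < \<infinity>"
      using less_le_trans[OF cost' top_greatest] by (simp add: ennreal_mult_less_top)
    finally show ?thesis .
  qed
  then have exchange: "(\<integral>\<^sup>+ x. (INF k. g k x) \<partial>\<pi>) = (INF k. \<integral>\<^sup>+ x. g k x \<partial>\<pi>)"
  proof (intro nn_integral_monotone_convergence_INF_AE' AE_I2)
    fix k x show "g (Suc k) x \<le> g k x"
      unfolding g_def using \<rho> by (intro ennreal_leI powr_mono2 add_left_mono) (auto simp: lp_norm_nonneg field_simps)
  qed simp_all
  have INF_le: "(INF k. g k x) \<le> ennreal (?L x powr \<rho>)" for x
  proof -
    have "(\<lambda>k. ?L x + 1 / real (Suc k)) \<longlonglongrightarrow> ?L x + 0"
      using LIMSEQ_inverse_real_of_nat by (intro tendsto_add tendsto_const) (simp add: inverse_eq_divide)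
    then have "(\<lambda>k. g k x) \<longlonglongrightarrow> ennreal (?L x powr \<rho>)"
      unfolding g_def using \<rho> by (intro tendsto_ennrealI tendsto_powr2 tendsto_const) (auto simp: lp_norm_nonneg)
    then show ?thesis by (rule LIMSEQ_le_const) (auto intro: INF_lower)
  qed
  have "(INF k. \<integral>\<^sup>+ x. g k x \<partial>\<pi>) \<le> (\<integral>\<^sup>+ x. ennreal (?L x powr \<rho>) \<partial>\<pi>)"
    unfolding exchange[symmetric] by (intro nn_integral_mono INF_le)
  then have "(INF k. \<integral>\<^sup>+ x. g k x \<partial>\<pi>) < a" using cost' by simp
  then obtain k where k: "(\<integral>\<^sup>+ x. g k x \<partial>\<pi>) < a" by (auto simp: INF_less_iff)
  \<comment> \<open>The factor \<open>CARD('m)\<close> converts Euclidean distance into the l_q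
    norm.\<close>
  define \<delta> where "\<delta> = 1 / (real (Suc k) * real CARD('m))"
  show thesis
  proof (rule that[of \<delta>], goal_cases)
    case 1
    then show ?case by (simp add: \<delta>_def)
  next
    case 2
    show ?case
    proof (intro allI impI)
      fix w' :: "nat \<Rightarrow> real ^ 'm" assume close: "\<forall>j\<in>{1..n}. dist (w' j) (w j) < \<delta>"
      have "lp_norm q (w j - w' j) \<le> 1 / real (Suc k)" if "j \<in> {1..n}" for j
      proof -
        have "lp_norm q (w j - w' j) \<le> real CARD('m) * norm (w j - w' j)" by (rule lp_norm_le_norm[OF q])
        also have "\<dots> \<le> real CARD('m) * \<delta>"
          using close that by (intro mult_left_mono) (auto simp: dist_norm norm_minus_commute less_imp_le)
        finally show ?thesis by (simp add: \<delta>_def)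
      qed
      then obtain \<pi>' where \<pi>': "\<pi>' \<in> couplings P (empirical_measure n w')"
        and le: "(\<integral>\<^sup>+ (u, z). ennreal (lp_norm q (u - z) powr \<rho>) \<partial>\<pi>') \<le>
          (\<integral>\<^sup>+ (u, z). ennreal ((lp_norm q (u - z) + 1 / real (Suc k)) powr \<rho>) \<partial>\<pi>)"
        by (rule coupling_move_support[OF n \<pi> q \<rho>])
      have "profile_function c h (empirical_measure n w') \<theta> \<le> transport_cost c P (empirical_measure n w')"
        unfolding profile_function_def using P by (intro INF_lower) auto
      also have "\<dots> \<le> (\<integral>\<^sup>+ (u, z). ennreal (c u z) \<partial>\<pi>')"
        unfolding transport_cost_def using \<pi>' by (rule INF_lower)
      also have "\<dots> \<le> (\<integral>\<^sup>+ x. g k x \<partial>\<pi>)"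
        using le by (simp add: c_def g_def case_prod_unfold)
      also have "\<dots> < a" by (rule k)
      finally show "profile_function c h (empirical_measure n w') \<theta> < a" .
    qed
  qed
qed

text \<open>An infimum over uncountably many laws and couplings is not measurable for general
  reasons. Semicontinuity makes its sublevel sets open in the product topology on sequences, where
  only the coordinates 1 to \<open>n\<close> matter.\<close>

lemma measurable_profile_function:
  fixes X :: "nat \<Rightarrow> 'a \<Rightarrow> real ^ 'm" and h :: "real ^ 'm \<Rightarrow> 't \<Rightarrow> 'b::{banach, second_countable_topology}"
    and q :: ennreal and \<rho> :: real
  defines "c \<equiv> \<lambda>u w. lp_norm q (u - w) powr \<rho>"
  assumes n: "n > 0" and q: "q \<ge> 1" and \<rho>: "\<rho> \<ge> 1" and X: "\<And>i. X i \<in> borel_measurable M"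
  shows "(\<lambda>\<omega>. profile_function c h (empirical_measure n (\<lambda>i. X i \<omega>)) \<theta>) \<in> borel_measurable M"
proof -
  define F where "F w = profile_function c h (empirical_measure n w) \<theta>" for w
  have "open {w. F w < a}" for a
  proof (subst open_subopen, intro ballI)
    fix w assume "w \<in> {w. F w < a}"
    then have "profile_function (\<lambda>u w. lp_norm q (u - w) powr \<rho>) h (empirical_measure n w) \<theta> < a"
      by (simp add: F_def c_def)
    then obtain \<delta> where \<delta>: "\<delta> > 0" "\<forall>w'. (\<forall>j\<in>{1..n}. dist (w' j) (w j) < \<delta>) \<longrightarrow> F w' < a"
      unfolding F_def c_def by (rule profile_function_upper_semicontinuous[OF n q \<rho>])
    have "open (\<Inter>j\<in>{1..n}. {w' :: nat \<Rightarrow> real ^ 'm. dist (w' j) (w j) < \<delta>})"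
      by (intro open_INT ballI finite_atLeastAtMost open_Collect_less continuous_on_const
          continuous_on_dist[OF continuous_on_product_coordinates continuous_on_const])
    then show "\<exists>T. open T \<and> w \<in> T \<and> T \<subseteq> {w. F w < a}"
      using \<delta> by (intro exI[of _ "\<Inter>j\<in>{1..n}. {w'. dist (w' j) (w j) < \<delta>}"]) auto
  qed
  then have "F \<in> borel_measurable borel"
    by (intro borel_measurableI_less) (simp add: borel_open)
  moreover have "(\<lambda>\<omega> i. X i \<omega>) \<in> borel_measurable M"
    by (rule measurable_coordinatewise_then_product) (rule X)
  ultimately have "(\<lambda>\<omega>. F (\<lambda>i. X i \<omega>)) \<in> borel_measurable M"
    by (rule measurable_compose[rotated])
  then show ?thesis by (simp add: F_def)
qed

section \<open>Weak convergence from trigonometric polynomials\<close>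

text \<open>The phase \<open>a\<close> lets cosines produce sines as well, so convergence of the
  expectations of these functions is convergence of characteristic functions in real form. The span
  is an algebra by the product-to-sum formula and so falls under the Stone-Weierstrass
  theorem.\<close>

inductive trig_poly :: "('a::real_inner \<Rightarrow> real) \<Rightarrow> bool" where
  trig_poly_cos: "trig_poly (\<lambda>x. cos (v \<bullet> x + a))"
| trig_poly_add: "trig_poly f \<Longrightarrow> trig_poly g \<Longrightarrow> trig_poly (\<lambda>x. f x + g x)"
| trig_poly_scale: "trig_poly f \<Longrightarrow> trig_poly (\<lambda>x. c * f x)"

lemma trig_poly_const: "trig_poly (\<lambda>x. c)"
  using trig_poly_scale[OF trig_poly_cos[of 0 0], of c] by simp

lemma trig_poly_continuous: "trig_poly f \<Longrightarrow> continuous_on UNIV f"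
  by (induction rule: trig_poly.induct) (auto intro!: continuous_intros)

lemma trig_poly_bounded: "trig_poly f \<Longrightarrow> \<exists>B. \<forall>x. \<bar>f x\<bar> \<le> B"
proof (induction rule: trig_poly.induct)
  case (trig_poly_cos v a)
  show ?case by (intro exI[of _ 1]) simp
next
  case (trig_poly_add f g)
  then obtain B C where "\<forall>x. \<bar>f x\<bar> \<le> B" "\<forall>x. \<bar>g x\<bar> \<le> C" by auto
  then have "\<bar>f x + g x\<bar> \<le> B + C" for x
    using abs_triangle_ineq[of "f x" "g x"] add_mono[of "\<bar>f x\<bar>" B "\<bar>g x\<bar>" C] by fastforce
  then show ?case by blast
next
  case (trig_poly_scale f c)
  then obtain B where "\<forall>x. \<bar>f x\<bar> \<le> B" by auto
  then show ?case by (intro exI[of _ "\<bar>c\<bar> * B"]) (auto simp: abs_mult intro: mult_left_mono)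
qed

lemma trig_poly_mult:
  assumes "trig_poly f" "trig_poly g" shows "trig_poly (\<lambda>x. f x * g x)"
  using assms(1)
proof (induction rule: trig_poly.induct)
  case (trig_poly_cos v a)
  show ?case using assms(2)
  proof (induction rule: trig_poly.induct)
    case (trig_poly_cos w b)
    have "trig_poly (\<lambda>x. (1/2) * (cos ((v - w) \<bullet> x + (a - b)) + cos ((v + w) \<bullet> x + (a + b))))"
      by (intro trig_poly.intros)
    moreover have "cos (v \<bullet> x + a) * cos (w \<bullet> x + b) =
        (1/2) * (cos ((v - w) \<bullet> x + (a - b)) + cos ((v + w) \<bullet> x + (a + b)))" for x
    proof -
      have "(v - w) \<bullet> x + (a - b) = (v \<bullet> x + a) - (w \<bullet> x + b)" "(v + w) \<bullet> x + (a + b) = (v \<bullet> x + a) + (w \<bullet> x + b)"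
        by (simp_all add: inner_diff_left inner_add_left)
      then show ?thesis by (simp only: cos_times_cos)
    qed
    ultimately show ?case by presburger
  next
    case (trig_poly_add f g)
    from trig_poly.trig_poly_add[OF this(3,4)] show ?case by (simp add: distrib_left)
  next
    case (trig_poly_scale f c)
    from trig_poly.trig_poly_scale[OF this(2), of c] show ?case by (simp add: mult.left_commute)
  qed
next
  case (trig_poly_add f1 f2)
  from trig_poly.trig_poly_add[OF this(3,4)] show ?case by (simp add: distrib_right)
next
  case (trig_poly_scale f c)
  from trig_poly.trig_poly_scale[OF this(2), of c] show ?case by (simp add: mult.assoc)
qed

lemma trig_poly_polynomial:
  assumes "real_polynomial_function (P :: real \<Rightarrow> real)" "trig_poly f"
  shows "trig_poly (\<lambda>x. P (f x))"
  using assms(1)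
proof (induction rule: real_polynomial_function.induct)
  case (linear h)
  then interpret bounded_linear h .
  have "h (f x) = h 1 * f x" for x
    using scaleR[of "f x" 1] by (simp add: mult.commute)
  then have "(\<lambda>x. h (f x)) = (\<lambda>x. h 1 * f x)" by (rule ext)
  then show ?case using trig_poly_scale[OF assms(2), of "h 1"] by (simp only:)
next
  case (const c)
  show ?case by (rule trig_poly_const)
next
  case (add P Q)
  from add(3,4) show ?case by (rule trig_poly_add)
next
  case (mult P Q)
  from mult(3,4) show ?case by (rule trig_poly_mult)
qed

lemma trig_poly_dense:
  fixes g :: "'a::euclidean_space \<Rightarrow> real"
  assumes "compact S" "continuous_on S g" "e > 0"
  obtains f where "trig_poly f" "\<forall>x\<in>S. \<bar>g x - f x\<bar> < e"
proof -
  interpret function_ring_on "Collect trig_poly" S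
  proof
    fix x y :: 'a assume "x \<noteq> y"
    \<comment> \<open>The scaling makes \<open>v \<bullet> x\<close> and
      \<open>v \<bullet> y\<close> differ by exactly \<open>pi\<close>, so the cosine takes the
      values -1 and 1.\<close>
    define v where "v = (pi / (norm (x - y))\<^sup>2) *\<^sub>R (x - y)"
    have "v \<bullet> x - v \<bullet> y = pi / (norm (x - y))\<^sup>2 * ((x - y) \<bullet> (x - y))"
      unfolding v_def inner_scaleR_left by (simp only: inner_diff_right right_diff_distrib)
    also have "\<dots> = pi" using \<open>x \<noteq> y\<close> by (simp add: dot_square_norm)
    finally have "cos (v \<bullet> x + - (v \<bullet> y)) = -1" by simp
    moreover have "cos (v \<bullet> y + - (v \<bullet> y)) = 1" by simp
    ultimately show "\<exists>f\<in>Collect trig_poly. f x \<noteq> f y"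
      by (intro bexI[of _ "\<lambda>z. cos (v \<bullet> z + - (v \<bullet> y))"] CollectI trig_poly_cos) simp
  next
    show "continuous_on S f" if "f \<in> Collect trig_poly" for f
      using that continuous_on_subset[OF trig_poly_continuous subset_UNIV, of f S] by simp
    show "(\<lambda>x. f x + g x) \<in> Collect trig_poly" "(\<lambda>x. f x * g x) \<in> Collect trig_poly"
      if "f \<in> Collect trig_poly" "g \<in> Collect trig_poly" for f g
      using that trig_poly_add[of f g] trig_poly_mult[of f g] by simp_all
    show "(\<lambda>_. c) \<in> Collect trig_poly" for c
      using trig_poly_const by simp
  qed (rule assms(1))
  obtain f where "f \<in> Collect trig_poly" "\<forall>x\<in>S. \<bar>g x - f x\<bar> < e"
    using Stone_Weierstrass_basic[OF assms(2,3)] by blast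
  then show thesis by (intro that[of f]) simp_all
qed

text \<open>Uniform approximation on a ball only; truncating the values of a first approximation by a
  polynomial keeps the global bound, because trigonometric polynomials form an algebra.\<close>

lemma trig_poly_dense_bounded:
  fixes g :: "'a::euclidean_space \<Rightarrow> real"
  assumes S: "compact S" and g: "continuous_on UNIV g" "\<And>x. \<bar>g x\<bar> \<le> C" and "e > 0"
  obtains f where "trig_poly f" "\<forall>x\<in>S. \<bar>g x - f x\<bar> \<le> 2 * e" "\<forall>x. \<bar>f x\<bar> \<le> C + e"
proof -
  obtain T where T: "trig_poly T" "\<forall>x\<in>S. \<bar>g x - T x\<bar> < e"
    using trig_poly_dense[OF S continuous_on_subset[OF g(1) subset_UNIV] \<open>e > 0\<close>] .
  obtain B where B: "\<forall>x. \<bar>T x\<bar> \<le> B" using trig_poly_bounded[OF T(1)] by blast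
  \<comment> \<open>Clipping to \<open>{- C..C}\<close> does not increase the distance to
    \<open>g\<close>. As \<open>\<psi>\<close> is not a polynomial, it is replaced by one on an
    interval containing all values of \<open>T\<close>.\<close>
  define \<psi> where "\<psi> t = max (- C) (min C t)" for t :: real
  have C: "0 \<le> C" using abs_ge_zero[of "g 0"] g(2)[of 0] by linarith
  have "continuous_on {- B..B} \<psi>" unfolding \<psi>_def by (intro continuous_intros)
  from Stone_Weierstrass_polynomial_function[OF compact_Icc this \<open>e > 0\<close>]
  obtain P where "polynomial_function P" and P_close: "\<forall>t\<in>{- B..B}. norm (\<psi> t - P t) < e" by (elim exE conjE)
  then have P: "real_polynomial_function P" by (simp add: real_polynomial_function_eq)
  have close: "\<bar>\<psi> (T x) - P (T x)\<bar> < e" for x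
  proof -
    have "T x \<in> {- B..B}" using B[rule_format, of x] by (simp add: abs_le_iff minus_le_iff)
    then show ?thesis using P_close by simp
  qed
  show thesis
  proof (rule that[OF trig_poly_polynomial[OF P T(1)]])
    show "\<forall>x\<in>S. \<bar>g x - P (T x)\<bar> \<le> 2 * e"
    proof
      fix x assume "x \<in> S"
      then have "\<bar>g x - T x\<bar> < e" using T(2) by blast
      then have "\<bar>g x - \<psi> (T x)\<bar> < e" using g(2)[of x] unfolding \<psi>_def by linarith
      then show "\<bar>g x - P (T x)\<bar> \<le> 2 * e" using close[of x] by linarith
    qed
    show "\<forall>x. \<bar>P (T x)\<bar> \<le> C + e"
    proof
      fix x
      have "\<bar>\<psi> (T x)\<bar> \<le> C" using C by (auto simp: \<psi>_def)
      then show "\<bar>P (T x)\<bar> \<le> C + e" using close[of x] by linarith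
    qed
  qed
qed

lemma (in prob_space) expectation_close_of_tight:
  fixes f g :: "'b::euclidean_space \<Rightarrow> real"
  assumes Y [measurable]: "Y \<in> borel_measurable M"
    and f: "continuous_on UNIV f" "\<And>x. \<bar>f x\<bar> \<le> B" and g: "continuous_on UNIV g" "\<And>x. \<bar>g x\<bar> \<le> C"
    and close: "\<And>x. norm x \<le> L \<Longrightarrow> \<bar>g x - f x\<bar> \<le> \<delta>"
    and "0 \<le> L" and tight: "prob {\<omega> \<in> space M. L < norm (Y \<omega>)} \<le> \<eta>"
  shows "\<bar>expectation (\<lambda>\<omega>. g (Y \<omega>)) - expectation (\<lambda>\<omega>. f (Y \<omega>))\<bar> \<le> \<delta> + (B + C) * \<eta>"
proof -
  have [measurable]: "f \<in> borel_measurable borel" "g \<in> borel_measurable borel"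
    using f g by (auto intro: borel_measurable_continuous_onI)
  have int: "integrable M (\<lambda>\<omega>. f (Y \<omega>))" "integrable M (\<lambda>\<omega>. g (Y \<omega>))"
    by (rule integrable_const_bound[of _ B], use f in simp_all)
      (rule integrable_const_bound[of _ C], use g in simp_all)
  have B: "0 \<le> B" using abs_ge_zero[of "f 0"] f(2)[of 0] by linarith
  have C: "0 \<le> C" using abs_ge_zero[of "g 0"] g(2)[of 0] by linarith
  have \<delta>: "0 \<le> \<delta>" using close[of 0] \<open>0 \<le> L\<close> by simp
  let ?A = "{\<omega> \<in> space M. L < norm (Y \<omega>)}"
  have "\<bar>expectation (\<lambda>\<omega>. g (Y \<omega>)) - expectation (\<lambda>\<omega>. f (Y \<omega>))\<bar> = \<bar>expectation (\<lambda>\<omega>. g (Y \<omega>) - f (Y \<omega>))\<bar>"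
    using int by simp
  also have "\<dots> \<le> expectation (\<lambda>\<omega>. \<bar>g (Y \<omega>) - f (Y \<omega>)\<bar>)" by (rule integral_abs_bound)
  also have "\<dots> \<le> expectation (\<lambda>\<omega>. \<delta> + (B + C) * indicator ?A \<omega>)"
  proof (rule integral_mono)
    show "integrable M (\<lambda>\<omega>. \<bar>g (Y \<omega>) - f (Y \<omega>)\<bar>)" using int by simp
    show "integrable M (\<lambda>\<omega>. \<delta> + (B + C) * indicator ?A \<omega>)"
      by (intro Bochner_Integration.integrable_add integrable_mult_right integrable_real_indicator) (auto simp: emeasure_eq_measure)
    fix \<omega> assume "\<omega> \<in> space M"
    show "\<bar>g (Y \<omega>) - f (Y \<omega>)\<bar> \<le> \<delta> + (B + C) * indicator ?A \<omega>"
    proof (cases "L < norm (Y \<omega>)")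
      case True
      have "\<bar>g (Y \<omega>) - f (Y \<omega>)\<bar> \<le> B + C" using f(2)[of "Y \<omega>"] g(2)[of "Y \<omega>"] by linarith
      then show ?thesis using True \<open>\<omega> \<in> space M\<close> \<delta> by simp
    next
      case False
      then show ?thesis using close[of "Y \<omega>"] by simp
    qed
  qed
  also have "\<dots> = \<delta> + (B + C) * prob ?A"
    by (subst Bochner_Integration.integral_add) (auto simp: prob_space emeasure_eq_measure)
  also have "\<dots> \<le> \<delta> + (B + C) * \<eta>"
    using B C tight by (intro add_left_mono mult_left_mono) auto
  finally show ?thesis .
qed

lemma (in prob_space) tight_single:
  fixes Y :: "'a \<Rightarrow> 'b::real_normed_vector"
  assumes [measurable]: "Y \<in> borel_measurable M" and "\<eta> > 0"
  obtains L where "L > 0" "prob {\<omega> \<in> space M. L < norm (Y \<omega>)} < \<eta>"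
proof -
  have "(\<lambda>k. prob {\<omega> \<in> space M. real k < norm (Y \<omega>)}) \<longlonglongrightarrow> prob (\<Inter>k. {\<omega> \<in> space M. real k < norm (Y \<omega>)})"
    by (rule finite_Lim_measure_decseq) (auto simp: decseq_def)
  also have "(\<Inter>k. {\<omega> \<in> space M. real k < norm (Y \<omega>)}) = {}"
  proof (intro equals0I)
    fix \<omega> assume *: "\<omega> \<in> (\<Inter>k. {\<omega> \<in> space M. real k < norm (Y \<omega>)})"
    obtain k where "norm (Y \<omega>) \<le> real k" using real_arch_simple by blast
    moreover have "real k < norm (Y \<omega>)" using * by blast
    ultimately show False by simp
  qed
  finally have "(\<lambda>k. prob {\<omega> \<in> space M. real k < norm (Y \<omega>)}) \<longlonglongrightarrow> 0" by simp
  then have "\<forall>\<^sub>F k in sequentially. prob {\<omega> \<in> space M. real k < norm (Y \<omega>)} < \<eta>"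
    using \<open>\<eta> > 0\<close> by (rule order_tendstoD)
  with eventually_gt_at_top[of 0] have "\<forall>\<^sub>F k in sequentially. k > 0 \<and> prob {\<omega> \<in> space M. real k < norm (Y \<omega>)} < \<eta>"
    by (rule eventually_conj)
  then obtain k :: nat where "k > 0" "prob {\<omega> \<in> space M. real k < norm (Y \<omega>)} < \<eta>"
    unfolding eventually_sequentially by blast
  then show thesis by (intro that[of "real k"]) auto
qed

text \<open>Levy's continuity theorem with tightness assumed: off a large ball both laws have little
  mass, and on the ball \<open>g\<close> is replaced by a trigonometric polynomial whose global
  bound barely exceeds that of \<open>g\<close>.\<close>

lemma weak_convergence_from_trig:
  fixes Y :: "nat \<Rightarrow> 'a \<Rightarrow> 'c::euclidean_space" and Z :: "'b \<Rightarrow> 'c"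
    and g :: "'c \<Rightarrow> real"
  assumes "prob_space M" "prob_space N"
    and Y: "\<And>n. Y n \<in> borel_measurable M" and Z: "Z \<in> borel_measurable N"
    and tight: "\<And>\<eta>. \<eta> > 0 \<Longrightarrow> \<exists>L. \<forall>n. measure M {\<omega> \<in> space M. L < norm (Y n \<omega>)} \<le> \<eta>"
    and conv: "\<And>v a. (\<lambda>n. \<integral>\<omega>. cos (v \<bullet> Y n \<omega> + a) \<partial>M) \<longlonglongrightarrow> (\<integral>\<omega>. cos (v \<bullet> Z \<omega> + a) \<partial>N)"
    and g: "continuous_on UNIV g" "\<And>x. \<bar>g x\<bar> \<le> C"
  shows "(\<lambda>n. \<integral>\<omega>. g (Y n \<omega>) \<partial>M) \<longlonglongrightarrow> (\<integral>\<omega>. g (Z \<omega>) \<partial>N)"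
proof -
  interpret M: prob_space M by fact
  interpret N: prob_space N by fact
  have C: "0 \<le> C" using abs_ge_zero[of "g 0"] g(2)[of 0] by linarith
  have trig_int: "integrable M (\<lambda>\<omega>. f (Y n \<omega>))" "integrable N (\<lambda>\<omega>. f (Z \<omega>))" if f: "trig_poly f" for f n
  proof -
    obtain B where B: "\<forall>x. \<bar>f x\<bar> \<le> B" using trig_poly_bounded[OF f] by blast
    have "f \<in> borel_measurable borel" using trig_poly_continuous[OF f] by (rule borel_measurable_continuous_onI)
    then show "integrable M (\<lambda>\<omega>. f (Y n \<omega>))" "integrable N (\<lambda>\<omega>. f (Z \<omega>))"
      using Y[of n] Z B
      by (auto intro!: M.integrable_const_bound[of _ B] N.integrable_const_bound[of _ B] intro: measurable_compose)
  qed
  have trig_conv: "(\<lambda>n. \<integral>\<omega>. f (Y n \<omega>) \<partial>M) \<longlonglongrightarrow> (\<integral>\<omega>. f (Z \<omega>) \<partial>N)" if "trig_poly f" for f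
    using that
  proof (induction rule: trig_poly.induct)
    case (trig_poly_cos v a)
    show ?case by (rule conv)
  next
    case (trig_poly_add f g)
    then show ?case by (simp add: trig_int tendsto_add)
  next
    case (trig_poly_scale f c)
    then show ?case by (simp add: tendsto_mult_left)
  qed
  show ?thesis
  proof (rule LIMSEQ_I)
    fix e :: real assume "e > 0"
    define D where "D = C + 2"
    have D: "D > 0" using C by (simp add: D_def)
    \<comment> \<open>Chosen so that the approximation error
      \<open>2 * \<eta> + ((C + \<eta>) + C) * \<eta>\<close> is at most
      \<open>2 * ((C + 2) * \<eta>)\<close>, hence at most \<open>e / 4\<close>, under either
      law.\<close>
    define \<eta> where "\<eta> = min 1 (e / (8 * D))"
    have "D * \<eta> \<le> D * (e / (8 * D))"
      using D by (intro mult_left_mono) (auto simp: \<eta>_def)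
    also have "\<dots> = e / 8" using D by simp
    finally have \<eta>: "0 < \<eta>" "\<eta> \<le> 1" "(C + 2) * \<eta> \<le> e / 8"
      using \<open>e > 0\<close> D by (auto simp: \<eta>_def D_def)
    obtain L1 where L1: "\<forall>n. measure M {\<omega> \<in> space M. L1 < norm (Y n \<omega>)} \<le> \<eta>" using tight[OF \<eta>(1)] by blast
    obtain L2 where L2: "measure N {\<omega> \<in> space N. L2 < norm (Z \<omega>)} < \<eta>"
      using N.tight_single[OF Z \<eta>(1)] by blast
    define L where "L = max 0 (max L1 L2)"
    have L0: "0 \<le> L" by (simp add: L_def)
    obtain f where f: "trig_poly f" "\<forall>x\<in>cball 0 L. \<bar>g x - f x\<bar> \<le> 2 * \<eta>" "\<forall>x. \<bar>f x\<bar> \<le> C + \<eta>"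
      using trig_poly_dense_bounded[OF compact_cball[of 0 L] g \<eta>(1)] .
    have [measurable]: "Y n \<in> borel_measurable M" "Z \<in> borel_measurable N" for n by (rule Y, rule Z)
    have "measure M {\<omega> \<in> space M. L < norm (Y n \<omega>)} \<le> measure M {\<omega> \<in> space M. L1 < norm (Y n \<omega>)}" for n
      by (intro M.finite_measure_mono) (auto simp: L_def)
    then have tY: "measure M {\<omega> \<in> space M. L < norm (Y n \<omega>)} \<le> \<eta>" for n using L1 order_trans by blast
    have "measure N {\<omega> \<in> space N. L < norm (Z \<omega>)} \<le> measure N {\<omega> \<in> space N. L2 < norm (Z \<omega>)}"
      by (intro N.finite_measure_mono) (auto simp: L_def)
    then have tZ: "measure N {\<omega> \<in> space N. L < norm (Z \<omega>)} \<le> \<eta>" using L2 by linarith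
    have bound: "2 * \<eta> + ((C + \<eta>) + C) * \<eta> \<le> e / 4"
    proof -
      have "((C + \<eta>) + C) * \<eta> \<le> ((C + 1) + C) * \<eta>" using \<eta> by (intro mult_right_mono) auto
      then have "2 * \<eta> + ((C + \<eta>) + C) * \<eta> \<le> 2 * ((C + 2) * \<eta>)" using \<eta>(1) by (simp add: algebra_simps)
      then show ?thesis using \<eta>(3) by linarith
    qed
    have cY: "\<bar>(\<integral>\<omega>. g (Y n \<omega>) \<partial>M) - (\<integral>\<omega>. f (Y n \<omega>) \<partial>M)\<bar> \<le> e / 4" for n
      using M.expectation_close_of_tight[OF Y trig_poly_continuous[OF f(1)] f(3)[rule_format] g, of L "2 * \<eta>" n \<eta>]
        f(2) tY[of n] bound L0 by auto
    have cZ: "\<bar>(\<integral>\<omega>. g (Z \<omega>) \<partial>N) - (\<integral>\<omega>. f (Z \<omega>) \<partial>N)\<bar> \<le> e / 4"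
      using N.expectation_close_of_tight[OF Z trig_poly_continuous[OF f(1)] f(3)[rule_format] g, of L "2 * \<eta>" \<eta>]
        f(2) tZ bound L0 by auto
    obtain n0 where n0: "\<forall>n\<ge>n0. norm ((\<integral>\<omega>. f (Y n \<omega>) \<partial>M) - (\<integral>\<omega>. f (Z \<omega>) \<partial>N)) < e / 4"
      using LIMSEQ_D[OF trig_conv[OF f(1)], of "e / 4"] \<open>e > 0\<close> by auto
    show "\<exists>n0. \<forall>n\<ge>n0. norm ((\<integral>\<omega>. g (Y n \<omega>) \<partial>M) - (\<integral>\<omega>. g (Z \<omega>) \<partial>N)) < e"
    proof (intro exI[of _ n0] allI impI)
      fix n assume "n \<ge> n0"
      then have "\<bar>(\<integral>\<omega>. f (Y n \<omega>) \<partial>M) - (\<integral>\<omega>. f (Z \<omega>) \<partial>N)\<bar> < e / 4" using n0 by auto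
      then show "norm ((\<integral>\<omega>. g (Y n \<omega>) \<partial>M) - (\<integral>\<omega>. g (Z \<omega>) \<partial>N)) < e"
        using cY[of n] cZ unfolding real_norm_def abs_less_iff abs_le_iff by linarith
    qed
  qed
qed

section \<open>Second moments and the weak law for independent vectors\<close>

lemma (in prob_space) expectation_inner_indep:
  fixes X :: "nat \<Rightarrow> 'a \<Rightarrow> 'b::euclidean_space"
  assumes indep: "indep_vars (\<lambda>_. borel) X UNIV"
    and int: "\<And>i. integrable M (X i)" and zero: "\<And>i. expectation (X i) = 0" and "i \<noteq> j"
  shows "expectation (\<lambda>\<omega>. X i \<omega> \<bullet> X j \<omega>) = 0"
proof -
  have *: "expectation (\<lambda>\<omega>. (X i \<omega> \<bullet> b) * (X j \<omega> \<bullet> b)) = 0 \<and> integrable M (\<lambda>\<omega>. (X i \<omega> \<bullet> b) * (X j \<omega> \<bullet> b))" for b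
  proof -
    have ind: "indep_vars (\<lambda>_. borel) (\<lambda>i \<omega>. X i \<omega> \<bullet> b) {i, j}"
      by (rule indep_vars_subset[OF indep_vars_compose2[OF indep]]) auto
    have int_b: "integrable M (\<lambda>\<omega>. X k \<omega> \<bullet> b)" for k using int by simp
    have "expectation (\<lambda>\<omega>. \<Prod>k\<in>{i, j}. X k \<omega> \<bullet> b) = (\<Prod>k\<in>{i, j}. expectation (\<lambda>\<omega>. X k \<omega> \<bullet> b))"
      by (rule indep_vars_lebesgue_integral[OF _ ind]) (simp_all only: int_b finite.intros)
    moreover have "integrable M (\<lambda>\<omega>. \<Prod>k\<in>{i, j}. X k \<omega> \<bullet> b)"
      by (rule indep_vars_integrable[OF _ ind]) (simp_all only: int_b finite.intros)
    moreover have "expectation (\<lambda>\<omega>. X i \<omega> \<bullet> b) = 0" using int zero by simp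
    ultimately show ?thesis using \<open>i \<noteq> j\<close> by simp
  qed
  have "expectation (\<lambda>\<omega>. X i \<omega> \<bullet> X j \<omega>) = expectation (\<lambda>\<omega>. \<Sum>b\<in>Basis. (X i \<omega> \<bullet> b) * (X j \<omega> \<bullet> b))"
    by (subst euclidean_inner) simp
  also have "\<dots> = 0" using * by (subst Bochner_Integration.integral_sum) auto
  finally show ?thesis .
qed

lemma (in prob_space) second_moment_sum_indep:
  fixes X :: "nat \<Rightarrow> 'a \<Rightarrow> 'b::euclidean_space"
  assumes indep: "indep_vars (\<lambda>_. borel) X UNIV" and zero: "\<And>i. expectation (X i) = 0"
    and sq: "\<And>i. integrable M (\<lambda>\<omega>. (norm (X i \<omega>))\<^sup>2)" "\<And>i. expectation (\<lambda>\<omega>. (norm (X i \<omega>))\<^sup>2) = s"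
  shows "integrable M (\<lambda>\<omega>. (norm (\<Sum>i<n. X i \<omega>))\<^sup>2) \<and> expectation (\<lambda>\<omega>. (norm (\<Sum>i<n. X i \<omega>))\<^sup>2) = real n * s"
proof (induction n)
  case (Suc n)
  have X_meas [measurable]: "X i \<in> borel_measurable M" for i using indep by (simp add: indep_vars_def)
  have int: "integrable M (X i)" for i
    using square_integrable_imp_integrable[of "\<lambda>\<omega>. norm (X i \<omega>)"] sq(1) by (simp add: integrable_norm_iff)
  have inner_int: "integrable M (\<lambda>\<omega>. X i \<omega> \<bullet> X j \<omega>)" for i j
  proof (rule Bochner_Integration.integrable_bound)
    show "integrable M (\<lambda>\<omega>. (norm (X i \<omega>))\<^sup>2 + (norm (X j \<omega>))\<^sup>2)" using sq by simp
    have "\<bar>x \<bullet> y\<bar> \<le> (norm x)\<^sup>2 + (norm y)\<^sup>2" for x y :: 'b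
    proof -
      have "\<bar>x \<bullet> y\<bar> \<le> norm x * norm y" by (rule Cauchy_Schwarz_ineq2)
      also have "\<dots> \<le> (norm x)\<^sup>2 + (norm y)\<^sup>2"
      proof -
        have "2 * (norm x * norm y) \<le> (norm x)\<^sup>2 + (norm y)\<^sup>2"
          using sum_squares_bound[of "norm x" "norm y"] by (simp add: mult.assoc)
        moreover have "0 \<le> norm x * norm y" by simp
        ultimately show ?thesis by linarith
      qed
      finally show ?thesis .
    qed
    then show "AE \<omega> in M. norm (X i \<omega> \<bullet> X j \<omega>) \<le> norm ((norm (X i \<omega>))\<^sup>2 + (norm (X j \<omega>))\<^sup>2)" by simp
  qed simp
  have eq: "(norm (\<Sum>i<Suc n. X i \<omega>))\<^sup>2 =
      (norm (\<Sum>i<n. X i \<omega>))\<^sup>2 + 2 * (\<Sum>i<n. X i \<omega> \<bullet> X n \<omega>) + (norm (X n \<omega>))\<^sup>2" for \<omega>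
    by (simp add: power2_norm_eq_inner inner_add_left inner_add_right inner_sum_left
        inner_commute[of "X n \<omega>" "\<Sum>i<n. X i \<omega>"])
  have "expectation (\<lambda>\<omega>. X i \<omega> \<bullet> X n \<omega>) = 0" if "i < n" for i
    using that by (intro expectation_inner_indep indep int zero) simp
  then have "expectation (\<lambda>\<omega>. \<Sum>i<n. X i \<omega> \<bullet> X n \<omega>) = 0" using inner_int by simp
  moreover have "integrable M (\<lambda>\<omega>. \<Sum>i<n. X i \<omega> \<bullet> X n \<omega>)" using inner_int by simp
  ultimately show ?case unfolding eq using Suc sq by (simp add: algebra_simps)
qed simp

lemma (in prob_space) chebyshev_sum_indep:
  fixes X :: "nat \<Rightarrow> 'a \<Rightarrow> 'b::euclidean_space"
  assumes indep: "indep_vars (\<lambda>_. borel) X UNIV" and zero: "\<And>i. expectation (X i) = 0"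
    and sq: "\<And>i. integrable M (\<lambda>\<omega>. (norm (X i \<omega>))\<^sup>2)" "\<And>i. expectation (\<lambda>\<omega>. (norm (X i \<omega>))\<^sup>2) = s"
    and "t > 0"
  shows "prob {\<omega> \<in> space M. t \<le> norm (\<Sum>i<n. X i \<omega>)} \<le> real n * s / t\<^sup>2"
proof -
  note m = second_moment_sum_indep[OF indep zero sq]
  have "{\<omega> \<in> space M. t \<le> norm (\<Sum>i<n. X i \<omega>)} = {\<omega> \<in> space M. t\<^sup>2 \<le> (norm (\<Sum>i<n. X i \<omega>))\<^sup>2}"
    using \<open>t > 0\<close> by (auto simp: abs_le_square_iff[symmetric])
  moreover have "prob {\<omega> \<in> space M. t\<^sup>2 \<le> (norm (\<Sum>i<n. X i \<omega>))\<^sup>2} \<le> expectation (\<lambda>\<omega>. (norm (\<Sum>i<n. X i \<omega>))\<^sup>2) / t\<^sup>2"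
    using m[of n] \<open>t > 0\<close> by (intro integral_Markov_inequality_measure[where A = "space M"]) auto
  ultimately show ?thesis using m[of n] by simp
qed

text \<open>Stated for bounded summands because it is applied only to functions of bounded fields.
  After centring, Chebyshev's inequality gives a bound of order \<open>1 / real n\<close>.\<close>

lemma (in prob_space) weak_law:
  fixes X :: "nat \<Rightarrow> 'a \<Rightarrow> 'b::euclidean_space"
  assumes indep: "indep_vars (\<lambda>_. borel) X UNIV" and ident: "\<And>i. distr M borel (X i) = D"
    and bounded: "\<And>i \<omega>. norm (X i \<omega>) \<le> B" and "e > 0"
  shows "(\<lambda>n. prob {\<omega> \<in> space M. e \<le> norm ((\<Sum>i<n. X i \<omega>) /\<^sub>R real n - (\<integral>x. x \<partial>D))}) \<longlonglongrightarrow> 0"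
proof -
  have X_meas [measurable]: "X i \<in> borel_measurable M" for i using indep by (simp add: indep_vars_def)
  have int: "integrable M (X i)" for i by (rule integrable_const_bound[of _ B]) (auto simp: bounded)
  define m where "m = (\<integral>x. x \<partial>D)"
  have mean: "expectation (X i) = m" for i
    unfolding m_def ident[of i, symmetric] by (subst integral_distr) auto
  define Y where "Y i \<omega> = X i \<omega> - m" for i \<omega>
  have Y_meas [measurable]: "Y i \<in> borel_measurable M" for i unfolding Y_def by measurable
  have indepY: "indep_vars (\<lambda>_. borel) Y UNIV"
    unfolding Y_def by (rule indep_vars_compose2[OF indep]) auto
  have zero: "expectation (Y i) = 0" for i
    using int[of i] mean[of i] by (simp add: Y_def[abs_def] prob_space)
  have normY: "norm (Y i \<omega>) \<le> B + norm m" for i \<omega>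
    unfolding Y_def using bounded[of i \<omega>] norm_triangle_ineq4[of "X i \<omega>" m] by linarith
  have sq: "integrable M (\<lambda>\<omega>. (norm (Y i \<omega>))\<^sup>2)" for i
    by (rule integrable_const_bound[of _ "(B + norm m)\<^sup>2"]) (auto intro!: power_mono normY)
  define s where "s = (\<integral>x. (norm (x - m))\<^sup>2 \<partial>D)"
  have var: "expectation (\<lambda>\<omega>. (norm (Y i \<omega>))\<^sup>2) = s" for i
    unfolding s_def Y_def ident[of i, symmetric] by (subst integral_distr) auto
  have bound: "prob {\<omega> \<in> space M. e \<le> norm ((\<Sum>i<n. X i \<omega>) /\<^sub>R real n - m)} \<le> s / e\<^sup>2 * (1 / real n)"
    if n: "n > 0" for n
  proof -
    have "(\<Sum>i<n. X i \<omega>) /\<^sub>R real n - m = (\<Sum>i<n. Y i \<omega>) /\<^sub>R real n" for \<omega>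
      using n by (simp add: Y_def sum_subtractf scaleR_diff_right sum_constant_scaleR)
    then have "{\<omega> \<in> space M. e \<le> norm ((\<Sum>i<n. X i \<omega>) /\<^sub>R real n - m)} = {\<omega> \<in> space M. real n * e \<le> norm (\<Sum>i<n. Y i \<omega>)}"
      using n by (auto simp: field_simps)
    then have "prob {\<omega> \<in> space M. e \<le> norm ((\<Sum>i<n. X i \<omega>) /\<^sub>R real n - m)} \<le> real n * s / (real n * e)\<^sup>2"
      using chebyshev_sum_indep[OF indepY zero sq var, of "real n * e" n] n \<open>e > 0\<close> by simp
    also have "\<dots> = s / e\<^sup>2 * (1 / real n)" using n by (simp add: power2_eq_square field_simps)
    finally show ?thesis .
  qed
  have "(\<lambda>n. s / e\<^sup>2 * (1 / real n)) \<longlonglongrightarrow> s / e\<^sup>2 * 0"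
    by (intro tendsto_mult tendsto_const lim_1_over_n)
  then have "(\<lambda>n. s / e\<^sup>2 * (1 / real n)) \<longlonglongrightarrow> 0" by simp
  then show ?thesis
    unfolding m_def[symmetric]
    by (rule tendsto_sandwich[OF always_eventually _ tendsto_const, rotated 2])
      (use bound in \<open>auto simp: eventually_at_top_dense intro!: eventually_sequentiallyI[of 1]\<close>)
qed

text \<open>A centred normal law is the image of the standard one under scaling, with the point mass
  as the case \<open>s = 0\<close>. This treats degenerate directions of a singular covariance
  matrix uniformly.\<close>

lemma integral_normal_law:
  fixes f :: "real \<Rightarrow> real"
  assumes "s \<ge> 0" and f: "f \<in> borel_measurable borel"
  shows "(\<integral>x. f x \<partial>normal_law 0 (s\<^sup>2)) = (\<integral>x. f (s * x) \<partial>std_normal_distribution)"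
proof (cases "s = 0")
  case True
  interpret prob_space std_normal_distribution by (rule prob_space_normal_density) simp
  have "prob UNIV = 1" using prob_space by simp
  then show ?thesis using True f by (simp add: normal_law_def integral_return)
next
  case False
  then have s: "s > 0" using assms by simp
  let ?N = "density lborel (\<lambda>x. ennreal (normal_density 0 s x))"
  interpret N: prob_space ?N using s by (rule prob_space_normal_density)
  have "distributed ?N lborel (\<lambda>x. x) (normal_density 0 s)"
    unfolding distributed_def by (auto intro!: measure_eqI simp: emeasure_distr)
  then have "distributed ?N lborel (\<lambda>x. (x - 0) / s) std_normal_density"
    using N.normal_standard_normal_convert[OF s, of "\<lambda>x. x" 0] by simp
  then have eq: "distr ?N lborel (\<lambda>x. (x - 0) / s) = std_normal_distribution"
    by (simp add: distributed_def)
  have "(\<integral>x. f (s * x) \<partial>std_normal_distribution) = (\<integral>x. f (s * ((x - 0) / s)) \<partial>?N)"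
    unfolding eq[symmetric] using f by (subst integral_distr) auto
  then show ?thesis using s by (simp add: normal_law_def)
qed

section \<open>The multivariate central limit theorem\<close>

lemma (in prob_space) normalized_sum_tight:
  fixes X :: "nat \<Rightarrow> 'a \<Rightarrow> 'b::euclidean_space"
  assumes indep: "indep_vars (\<lambda>_. borel) X UNIV" and zero: "\<And>i. expectation (X i) = 0"
    and sq: "\<And>i. integrable M (\<lambda>\<omega>. (norm (X i \<omega>))\<^sup>2)" "\<And>i. expectation (\<lambda>\<omega>. (norm (X i \<omega>))\<^sup>2) = s"
    and "\<eta> > 0"
  shows "\<exists>L. \<forall>n. prob {\<omega> \<in> space M. L < norm ((\<Sum>i<n. X i \<omega>) /\<^sub>R sqrt (real n))} \<le> \<eta>"
proof -
  have X_meas [measurable]: "X i \<in> borel_measurable M" for i using indep by (simp add: indep_vars_def)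
  have s: "s \<ge> 0" using sq(2)[of 0] by (metis integral_nonneg_AE AE_I2 zero_le_power2)
  \<comment> \<open>Chebyshev's bound is \<open>s / L\<^sup>2\<close> for every positive
    \<open>n\<close>; the summand 1 keeps \<open>L\<close> positive when
    \<open>s = 0\<close>.\<close>
  define L where "L = sqrt (s / \<eta>) + 1"
  have L: "L > 0" using s \<open>\<eta> > 0\<close> by (simp add: L_def add_nonneg_pos)
  have "s / \<eta> = (sqrt (s / \<eta>))\<^sup>2" using s \<open>\<eta> > 0\<close> by simp
  also have "\<dots> \<le> L\<^sup>2" using s \<open>\<eta> > 0\<close> by (intro power_mono) (auto simp: L_def)
  finally have sL: "s / L\<^sup>2 \<le> \<eta>" using L \<open>\<eta> > 0\<close> by (simp add: field_simps)
  show ?thesis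
  proof (intro exI[of _ L] allI)
    fix n
    show "prob {\<omega> \<in> space M. L < norm ((\<Sum>i<n. X i \<omega>) /\<^sub>R sqrt (real n))} \<le> \<eta>"
    proof (cases "n = 0")
      case True
      then show ?thesis using L \<open>\<eta> > 0\<close> by simp
    next
      case False
      then have n: "sqrt (real n) > 0" by simp
      have "norm ((\<Sum>i<n. X i \<omega>) /\<^sub>R sqrt (real n)) = norm (\<Sum>i<n. X i \<omega>) / sqrt (real n)" for \<omega>
        using n by (simp add: divide_inverse mult.commute)
      then have "prob {\<omega> \<in> space M. L < norm ((\<Sum>i<n. X i \<omega>) /\<^sub>R sqrt (real n))}
          \<le> prob {\<omega> \<in> space M. L * sqrt (real n) \<le> norm (\<Sum>i<n. X i \<omega>)}"
        using n by (intro finite_measure_mono) (auto simp: field_simps)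
      also have "\<dots> \<le> real n * s / (L * sqrt (real n))\<^sup>2"
        using L n by (intro chebyshev_sum_indep indep zero sq) auto
      also have "\<dots> = s / L\<^sup>2" using False by (simp add: power_mult_distrib)
      finally show ?thesis using sL by simp
    qed
  qed
qed

lemma second_moment_matrix_quadratic:
  fixes X :: "'a \<Rightarrow> real ^ 'r"
  assumes [measurable]: "X \<in> borel_measurable M" and sq: "integrable M (\<lambda>\<omega>. (norm (X \<omega>))\<^sup>2)"
  shows "v \<bullet> (second_moment_matrix M X *v v) = (\<integral>\<omega>. (v \<bullet> X \<omega>)\<^sup>2 \<partial>M)"
proof -
  have [measurable]: "(\<lambda>\<omega>. X \<omega> $ i) \<in> borel_measurable M" for i
    unfolding cart_eq_inner_axis by measurable
  have int: "integrable M (\<lambda>\<omega>. X \<omega> $ i * X \<omega> $ j)" for i j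
  proof (rule Bochner_Integration.integrable_bound[OF sq])
    have "\<bar>x $ i * x $ j\<bar> \<le> (norm x)\<^sup>2" for x :: "real ^ 'r"
      unfolding abs_mult power2_eq_square by (intro mult_mono component_le_norm_cart) auto
    then show "AE \<omega> in M. norm (X \<omega> $ i * X \<omega> $ j) \<le> norm ((norm (X \<omega>))\<^sup>2)" by simp
  qed measurable
  have "v \<bullet> (second_moment_matrix M X *v v) = (\<Sum>i\<in>UNIV. \<Sum>j\<in>UNIV. v $ i * v $ j * (\<integral>\<omega>. X \<omega> $ i * X \<omega> $ j \<partial>M))"
    by (simp add: inner_vec_def matrix_vector_mult_def second_moment_matrix_def sum_distrib_left mult_ac)
  also have "\<dots> = (\<integral>\<omega>. (\<Sum>i\<in>UNIV. \<Sum>j\<in>UNIV. v $ i * v $ j * (X \<omega> $ i * X \<omega> $ j)) \<partial>M)"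
    using int by simp
  also have "(\<lambda>\<omega>. \<Sum>i\<in>UNIV. \<Sum>j\<in>UNIV. v $ i * v $ j * (X \<omega> $ i * X \<omega> $ j)) = (\<lambda>\<omega>. (v \<bullet> X \<omega>)\<^sup>2)"
    by (simp add: inner_vec_def power2_eq_square sum_product mult_ac)
  finally show ?thesis .
qed

text \<open>Cramer-Wold device: each cosine involves only the projection on \<open>v\<close>, to
  which the univariate theorem applies. Tightness comes from second moments.\<close>

theorem (in prob_space) multivariate_central_limit_theorem:
  fixes X :: "nat \<Rightarrow> 'a \<Rightarrow> real ^ 'r" and H :: "'b \<Rightarrow> real ^ 'r" and g :: "real ^ 'r \<Rightarrow> real"
  assumes indep: "indep_vars (\<lambda>_. borel) X UNIV" and ident: "\<And>i. distr M borel (X i) = D"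
    and zero: "expectation (X 0) = 0" and sq: "integrable M (\<lambda>\<omega>. (norm (X 0 \<omega>))\<^sup>2)"
    and H: "centered_gaussian_vector N H (second_moment_matrix M (X 0))"
    and g: "continuous_on UNIV g" "\<And>x. \<bar>g x\<bar> \<le> C"
  shows "(\<lambda>n. expectation (\<lambda>\<omega>. g ((\<Sum>i<n. X i \<omega>) /\<^sub>R sqrt (real n)))) \<longlonglongrightarrow> (\<integral>\<omega>. g (H \<omega>) \<partial>N)"
proof (rule weak_convergence_from_trig[OF _ _ _ _ _ _ g])
  have X_meas [measurable]: "X i \<in> borel_measurable M" for i using indep by (simp add: indep_vars_def)
  have transfer: "expectation (\<lambda>\<omega>. F (X i \<omega>)) = expectation (\<lambda>\<omega>. F (X 0 \<omega>))"
      "integrable M (\<lambda>\<omega>. F (X i \<omega>)) \<longleftrightarrow> integrable M (\<lambda>\<omega>. F (X 0 \<omega>))"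
    if "F \<in> borel_measurable borel" for F :: "real ^ 'r \<Rightarrow> 'c::{banach, second_countable_topology}" and i
  proof -
    have "expectation (\<lambda>\<omega>. F (X j \<omega>)) = (\<integral>x. F x \<partial>D)" for j
      unfolding ident[of j, symmetric] by (rule integral_distr[OF X_meas that, symmetric])
    then show "expectation (\<lambda>\<omega>. F (X i \<omega>)) = expectation (\<lambda>\<omega>. F (X 0 \<omega>))" by (simp only:)
    have "integrable M (\<lambda>\<omega>. F (X j \<omega>)) \<longleftrightarrow> integrable D F" for j
      unfolding ident[of j, symmetric] by (rule integrable_distr_eq[OF X_meas that, symmetric])
    then show "integrable M (\<lambda>\<omega>. F (X i \<omega>)) \<longleftrightarrow> integrable M (\<lambda>\<omega>. F (X 0 \<omega>))" by (simp only:)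
  qed
  show "prob_space M" by unfold_locales
  show "prob_space N" and H_meas [measurable]: "H \<in> borel_measurable N"
    using H by (simp_all add: centered_gaussian_vector_def)
  show "(\<lambda>\<omega>. (\<Sum>i<n. X i \<omega>) /\<^sub>R sqrt (real n)) \<in> borel_measurable M" for n by measurable
  have zero': "expectation (X i) = 0" for i using transfer(1)[of "\<lambda>x. x" i] zero by simp
  have norm2: "(\<lambda>x :: real ^ 'r. (norm x)\<^sup>2) \<in> borel_measurable borel" by measurable
  show "\<exists>L. \<forall>n. prob {\<omega> \<in> space M. L < norm ((\<Sum>i<n. X i \<omega>) /\<^sub>R sqrt (real n))} \<le> \<eta>" if "\<eta> > 0" for \<eta>
  proof (rule normalized_sum_tight[OF indep zero' _ _ that])
    show "integrable M (\<lambda>\<omega>. (norm (X i \<omega>))\<^sup>2)" for i using transfer(2)[OF norm2, of i] sq by simp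
    show "expectation (\<lambda>\<omega>. (norm (X i \<omega>))\<^sup>2) = expectation (\<lambda>\<omega>. (norm (X 0 \<omega>))\<^sup>2)" for i
      by (rule transfer(1)[OF norm2])
  qed
  fix v :: "real ^ 'r" and a :: real
  define \<sigma> where "\<sigma> = sqrt (expectation (\<lambda>\<omega>. (v \<bullet> X 0 \<omega>)\<^sup>2))"
  have \<sigma>2: "\<sigma>\<^sup>2 = expectation (\<lambda>\<omega>. (v \<bullet> X 0 \<omega>)\<^sup>2)" and \<sigma>0: "\<sigma> \<ge> 0"
    by (simp_all add: \<sigma>_def)
  have int_sq0: "integrable M (\<lambda>\<omega>. (v \<bullet> X 0 \<omega>)\<^sup>2)"
  proof (rule Bochner_Integration.integrable_bound)
    show "integrable M (\<lambda>\<omega>. (norm v)\<^sup>2 * (norm (X 0 \<omega>))\<^sup>2)" using sq by simp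
    have "(v \<bullet> x)\<^sup>2 \<le> (norm v)\<^sup>2 * (norm x)\<^sup>2" for x
      using power_mono[OF Cauchy_Schwarz_ineq2[of v x], of 2] by (simp add: power_mult_distrib)
    then show "AE \<omega> in M. norm ((v \<bullet> X 0 \<omega>)\<^sup>2) \<le> norm ((norm v)\<^sup>2 * (norm (X 0 \<omega>))\<^sup>2)" by simp
  qed measurable
  have sqv: "(\<lambda>x. (v \<bullet> x)\<^sup>2) \<in> borel_measurable borel" by measurable
  have int_sq: "integrable M (\<lambda>\<omega>. (v \<bullet> X i \<omega>)\<^sup>2)" for i
    using transfer(2)[OF sqv, of i] int_sq0 by simp
  have exp_sq: "expectation (\<lambda>\<omega>. (v \<bullet> X i \<omega>)\<^sup>2) = \<sigma>\<^sup>2" for i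
    using transfer(1)[OF sqv, of i] by (simp add: \<sigma>2)
  have int_X: "integrable M (X i)" for i
  proof -
    have "integrable M (\<lambda>\<omega>. (norm (X i \<omega>))\<^sup>2)" using transfer(2)[OF norm2, of i] sq by simp
    then have "integrable M (\<lambda>\<omega>. norm (X i \<omega>))" by (rule square_integrable_imp_integrable[rotated]) measurable
    then show ?thesis by (simp add: integrable_norm_iff)
  qed
  have N_side: "(\<integral>\<omega>. cos (v \<bullet> H \<omega> + a) \<partial>N) = (\<integral>x. cos (\<sigma> * x + a) \<partial>std_normal_distribution)"
  proof -
    have "(\<integral>\<omega>. cos (v \<bullet> H \<omega> + a) \<partial>N) = (\<integral>x. cos (x + a) \<partial>distr N borel (\<lambda>\<omega>. v \<bullet> H \<omega>))"
      by (subst integral_distr) auto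
    also have "distr N borel (\<lambda>\<omega>. v \<bullet> H \<omega>) = normal_law 0 (\<sigma>\<^sup>2)"
      using H second_moment_matrix_quadratic[OF X_meas sq, of v] by (simp add: centered_gaussian_vector_def \<sigma>2)
    also have "(\<integral>x. cos (x + a) \<partial>normal_law 0 (\<sigma>\<^sup>2)) = (\<integral>x. cos (\<sigma> * x + a) \<partial>std_normal_distribution)"
      by (rule integral_normal_law[OF \<sigma>0]) measurable
    finally show ?thesis .
  qed
  have inner_sum: "v \<bullet> ((\<Sum>i<n. X i \<omega>) /\<^sub>R sqrt (real n)) = (\<Sum>i<n. v \<bullet> X i \<omega>) / sqrt (real n)" for n \<omega>
    by (simp add: inner_sum_right divide_inverse mult.commute)
  show "(\<lambda>n. expectation (\<lambda>\<omega>. cos (v \<bullet> ((\<Sum>i<n. X i \<omega>) /\<^sub>R sqrt (real n)) + a)))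
      \<longlonglongrightarrow> (\<integral>\<omega>. cos (v \<bullet> H \<omega> + a) \<partial>N)"
  proof (cases "\<sigma> = 0")
    case True
    have "AE \<omega> in M. v \<bullet> X i \<omega> = 0" for i
      using integral_nonneg_eq_0_iff_AE[OF int_sq[of i]] exp_sq[of i] True by auto
    then have "AE \<omega> in M. \<forall>i. v \<bullet> X i \<omega> = 0" by (simp add: AE_all_countable)
    then have "expectation (\<lambda>\<omega>. cos (v \<bullet> ((\<Sum>i<n. X i \<omega>) /\<^sub>R sqrt (real n)) + a)) = expectation (\<lambda>\<omega>. cos a)" for n
      unfolding inner_sum by (intro integral_cong_AE) (auto elim!: eventually_mono)
    moreover interpret S: prob_space std_normal_distribution by (rule prob_space_normal_density) simp
    have "S.prob UNIV = 1" using S.prob_space by simp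
    then have "(\<integral>\<omega>. cos (v \<bullet> H \<omega> + a) \<partial>N) = cos a" using True by (simp add: N_side)
    ultimately show ?thesis by (simp add: prob_space)
  next
    case False
    then have \<sigma>: "\<sigma> > 0" using \<sigma>0 by simp
    have mean: "expectation (\<lambda>\<omega>. v \<bullet> X i \<omega>) = 0" for i using int_X zero' by simp
    have "weak_conv_m (\<lambda>n. distr M borel (\<lambda>\<omega>. (\<Sum>i<n. v \<bullet> X i \<omega>) / sqrt (real n * \<sigma>\<^sup>2))) std_normal_distribution"
    proof (rule central_limit_theorem_zero_mean)
      show "indep_vars (\<lambda>i. borel) (\<lambda>i \<omega>. v \<bullet> X i \<omega>) UNIV"
        by (rule indep_vars_compose2[OF indep]) auto
      show "expectation (\<lambda>\<omega>. v \<bullet> X i \<omega>) = 0" for i by (rule mean)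
      show "integrable M (\<lambda>\<omega>. (v \<bullet> X i \<omega>)\<^sup>2)" for i by (rule int_sq)
      show "variance (\<lambda>\<omega>. v \<bullet> X i \<omega>) = \<sigma>\<^sup>2" for i by (simp only: mean diff_zero exp_sq)
      show "distr M borel (\<lambda>\<omega>. v \<bullet> X i \<omega>) = distr D borel (\<lambda>x. v \<bullet> x)" for i
        unfolding ident[of i, symmetric] by (subst distr_distr) (auto simp: comp_def)
    qed (rule \<sigma>)
    then have "(\<lambda>n. \<integral>x. cos (\<sigma> * x + a) \<partial>distr M borel (\<lambda>\<omega>. (\<Sum>i<n. v \<bullet> X i \<omega>) / sqrt (real n * \<sigma>\<^sup>2)))
        \<longlonglongrightarrow> (\<integral>x. cos (\<sigma> * x + a) \<partial>std_normal_distribution)"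
      by (intro weak_conv_imp_integral_bdd_continuous_conv[where B = 1] real_distribution_distr real_dist_normal_dist)
        (auto intro!: continuous_intros)
    moreover have "(\<integral>x. cos (\<sigma> * x + a) \<partial>distr M borel (\<lambda>\<omega>. (\<Sum>i<n. v \<bullet> X i \<omega>) / sqrt (real n * \<sigma>\<^sup>2)))
        = expectation (\<lambda>\<omega>. cos (v \<bullet> ((\<Sum>i<n. X i \<omega>) /\<^sub>R sqrt (real n)) + a))" for n
    proof -
      have "(\<integral>x. cos (\<sigma> * x + a) \<partial>distr M borel (\<lambda>\<omega>. (\<Sum>i<n. v \<bullet> X i \<omega>) / sqrt (real n * \<sigma>\<^sup>2)))
          = expectation (\<lambda>\<omega>. cos (\<sigma> * ((\<Sum>i<n. v \<bullet> X i \<omega>) / sqrt (real n * \<sigma>\<^sup>2)) + a))"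
        by (subst integral_distr) auto
      also have "\<dots> = expectation (\<lambda>\<omega>. cos (v \<bullet> ((\<Sum>i<n. X i \<omega>) /\<^sub>R sqrt (real n)) + a))"
        unfolding inner_sum using \<sigma> by (simp add: real_sqrt_mult)
      finally show ?thesis .
    qed
    ultimately show ?thesis by (simp add: N_side)
  qed
qed

section \<open>Perturbation of the sample\<close>

text \<open>Mean value inequality along the segment to the displaced point. Uniform continuity of
  the Jacobian term on compact sets makes the error small simultaneously for all base points and
  displacements of norm at most \<open>B\<close>.\<close>

lemma uniform_linearization:
  fixes h :: "real ^ 'm \<Rightarrow> real ^ 'r" and J :: "real ^ 'm \<Rightarrow> real ^ 'm ^ 'r"
  assumes deriv: "\<And>w. (h has_derivative (\<lambda>v. J w *v v)) (at w)"
    and cont: "continuous_on UNIV (\<lambda>x. J (fst x) *v snd x)" and "B > 0" "\<tau> > 0"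
  obtains n0 :: nat where "n0 > 0"
    "\<forall>n\<ge>n0. \<forall>w x. norm w \<le> B \<longrightarrow> norm x \<le> B \<longrightarrow>
       norm (sqrt (real n) *\<^sub>R (h (w + (1 / sqrt (real n)) *\<^sub>R x) - h w) - J w *v x) \<le> \<tau>"
proof -
  let ?K = "cball (0 :: real ^ 'm) (2 * B) \<times> cball (0 :: real ^ 'm) B"
  have "uniformly_continuous_on ?K (\<lambda>x. J (fst x) *v snd x)"
    by (intro compact_uniformly_continuous continuous_on_subset[OF cont] compact_Times compact_cball) auto
  then obtain d where d: "d > 0"
    "\<forall>x\<in>?K. \<forall>x'\<in>?K. dist x' x < d \<longrightarrow> dist (J (fst x') *v snd x') (J (fst x) *v snd x) < \<tau>"
    using \<open>\<tau> > 0\<close> unfolding uniformly_continuous_on_def by blast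
  \<comment> \<open>Ensures \<open>B / sqrt (real n) < d\<close> and \<open>n \<ge> 1\<close>; the
    latter keeps displaced points in the ball of radius \<open>2 * B\<close>.\<close>
  obtain n0 :: nat where n0: "(B / d)\<^sup>2 + 1 < real n0" using reals_Archimedean2 by blast
  show thesis
  proof (rule that[of n0])
    have "0 \<le> (B / d)\<^sup>2" by simp
    then have "0 < real n0" using n0 by linarith
    then show "n0 > 0" by simp
    show "\<forall>n\<ge>n0. \<forall>w x. norm w \<le> B \<longrightarrow> norm x \<le> B \<longrightarrow>
       norm (sqrt (real n) *\<^sub>R (h (w + (1 / sqrt (real n)) *\<^sub>R x) - h w) - J w *v x) \<le> \<tau>"
    proof (intro allI impI)
      fix n :: nat and w x :: "real ^ 'm" assume n: "n0 \<le> n" and w: "norm w \<le> B" and x: "norm x \<le> B"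
      define r where "r = sqrt (real n)"
      have "(B / d)\<^sup>2 + 1 < real n" using n0 n by linarith
      then have sq: "(B / d)\<^sup>2 < real n" "1 \<le> real n" using \<open>0 \<le> (B / d)\<^sup>2\<close> by linarith+
      then have r: "r \<ge> 1" by (simp add: r_def)
      then have "r \<noteq> 0" by linarith
      have "B / d < r" unfolding r_def using sq(1) by (rule real_less_rsqrt)
      then have Br: "B / r < d" using r d(1) by (simp add: field_simps)
      define z where "z t = w + (t / r) *\<^sub>R x" for t
      \<comment> \<open>\<open>g 1 - g 0\<close> is the quantity to be bounded, and the derivative
        of \<open>g\<close> is the difference of the Jacobian terms at the moving and at the initial
        point.\<close>
      define g where "g t = r *\<^sub>R h (z t) - t *\<^sub>R (J w *v x)" for t
      have "norm (g 1 - g 0) \<le> \<tau> * norm (1 - 0 :: real)"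
      proof (rule differentiable_bound[of "{0..1}" g "\<lambda>t s. s *\<^sub>R (J (z t) *v x - J w *v x)"])
        fix t :: real assume t: "t \<in> {0..1}"
        have "((\<lambda>t. h (z t)) has_derivative (\<lambda>s. J (z t) *v ((s / r) *\<^sub>R x))) (at t within {0..1})"
          unfolding z_def
          using \<open>r \<noteq> 0\<close> by (intro has_derivative_compose[OF _ deriv]) (auto intro!: derivative_eq_intros)
        then have "(g has_derivative (\<lambda>s. r *\<^sub>R (J (z t) *v ((s / r) *\<^sub>R x)) - s *\<^sub>R (J w *v x))) (at t within {0..1})"
          unfolding g_def by (intro has_derivative_diff has_derivative_scaleR_right has_derivative_scaleR_left has_derivative_ident)
        moreover have "r *\<^sub>R (J (z t) *v ((s / r) *\<^sub>R x)) - s *\<^sub>R (J w *v x) = s *\<^sub>R (J (z t) *v x - J w *v x)" for s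
          using \<open>r \<noteq> 0\<close> by (simp add: matrix_vector_mult_scaleR scaleR_diff_right)
        ultimately show "(g has_derivative (\<lambda>s. s *\<^sub>R (J (z t) *v x - J w *v x))) (at t within {0..1})"
          by (simp only:)
        have "norm ((t / r) *\<^sub>R x) \<le> B / r"
          using t x r by (simp add: divide_right_mono mult_mono mult_left_le_one_le order_trans[OF mult_left_le_one_le])
        moreover have "B / r \<le> B" using r \<open>B > 0\<close> by (simp add: field_simps)
        ultimately have dist: "norm ((t / r) *\<^sub>R x) < d" "norm ((t / r) *\<^sub>R x) \<le> B" using Br by linarith+
        have "norm (z t) \<le> 2 * B"
          unfolding z_def using norm_triangle_ineq[of w "(t / r) *\<^sub>R x"] w dist(2) by linarith
        then have mem: "(z t, x) \<in> ?K" "(w, x) \<in> ?K" using w x \<open>B > 0\<close> by auto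
        have "dist (z t, x) (w, x) < d" using dist(1) by (simp add: dist_Pair_Pair z_def dist_norm)
        then have "dist (J (z t) *v x) (J w *v x) < \<tau>" using d(2) mem by fastforce
        then have le: "norm (J (z t) *v x - J w *v x) \<le> \<tau>" by (simp add: dist_norm)
        show "onorm (\<lambda>s. s *\<^sub>R (J (z t) *v x - J w *v x)) \<le> \<tau>"
        proof (rule onorm_bound)
          show "norm (s *\<^sub>R (J (z t) *v x - J w *v x)) \<le> \<tau> * norm s" for s
            using mult_right_mono[OF le norm_ge_zero[of s]] by (simp add: mult.commute)
        qed (use \<open>\<tau> > 0\<close> in simp)
      qed auto
      moreover have "g 1 - g 0 = sqrt (real n) *\<^sub>R (h (w + (1 / sqrt (real n)) *\<^sub>R x) - h w) - J w *v x"
        by (simp add: g_def z_def r_def scaleR_diff_right)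
      ultimately show "norm (sqrt (real n) *\<^sub>R (h (w + (1 / sqrt (real n)) *\<^sub>R x) - h w) - J w *v x) \<le> \<tau>"
        by simp
    qed
  qed
qed

text \<open>A small correction in \<open>r\<close> directions is added to a nearly optimal field, so that Brouwer's theorem
  can make the moment condition hold exactly. \<open>\<Phi>\<close> collects the quantities for which a law of large
  numbers is needed.\<close>

lemma (in jacobian_field) profile_function_local_bound:
  fixes h :: "real ^ 'm \<Rightarrow> 't \<Rightarrow> real ^ 'r"
  defines "c \<equiv> \<lambda>u w. lp_norm q (u - w) powr \<rho>"
  assumes deriv: "\<And>w. ((\<lambda>w. h w \<theta>) has_derivative (\<lambda>v. J w *v v)) (at w)"
    and less: "real_bound y < a"
  obtains \<delta> \<tau> :: real and n0 :: nat and \<Phi> :: "real ^ 'm \<Rightarrow> (real ^ 'r) \<times> ((real ^ 'r) ^ 'r) \<times> real"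
  where "\<delta> > 0" "\<tau> > 0" "\<Phi> \<in> borel_measurable borel" "\<exists>B. \<forall>w. norm (\<Phi> w) \<le> B"
    "\<forall>n\<ge>n0. \<forall>w. norm ((\<Sum>i\<in>{1..n}. h (w i) \<theta>) /\<^sub>R sqrt (real n) - y) \<le> \<delta> \<longrightarrow>
       norm ((\<Sum>i\<in>{1..n}. \<Phi> (w i)) /\<^sub>R real n - (\<integral>w. \<Phi> w \<partial>\<mu>)) < \<tau> \<longrightarrow>
       ennreal (real n powr (\<rho> / 2)) * profile_function c h (empirical_measure n w) \<theta> \<le> ennreal a"
proof -
  \<comment> \<open>The gap is split: the field \<open>v\<close> may cost up to \<open>a'\<close>,
    and of the remaining \<open>2 * \<epsilon>\<close> one \<open>\<epsilon>\<close> pays for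
    correcting the field and one for the law of large numbers.\<close>
  define a' where "a' = (real_bound y + a) / 2"
  define \<epsilon> where "\<epsilon> = (a - a') / 2"
  have \<epsilon>: "\<epsilon> > 0" and a': "a' + 2 * \<epsilon> = a" "real_bound y < a'"
    using less by (simp_all add: \<epsilon>_def a'_def field_simps)
  have "limit_bound p \<rho> \<mu> J y < ereal a'" using a' by (simp add: limit_bound_eq)
  then obtain v where v: "bounded_field v" "drift v = - y" "energy v \<le> a'"
    by (rule exists_optimal_field)
  \<comment> \<open>Correction directions: in the mean and to first order, \<open>u k\<close> moves
    the \<open>k\<close>-th moment equation alone.\<close>
  have "\<forall>k. \<exists>u. bounded_field u \<and> drift u = axis k 1" using drift_surjective by blast
  then obtain u where u: "\<And>k. bounded_field (u k)" "\<And>k. drift (u k) = axis k 1" by metis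
  obtain Bv where Bv: "Bv > 0" "\<And>w. norm (v w) \<le> Bv" "\<And>w. Bv < norm w \<Longrightarrow> v w = 0"
    by (rule bounded_fieldE[OF v(1)]) blast
  have "\<forall>k. \<exists>B. B > 0 \<and> (\<forall>w. norm (u k w) \<le> B) \<and> (\<forall>w. B < norm w \<longrightarrow> u k w = 0)"
  proof
    fix k show "\<exists>B. B > 0 \<and> (\<forall>w. norm (u k w) \<le> B) \<and> (\<forall>w. B < norm w \<longrightarrow> u k w = 0)"
      by (rule bounded_fieldE[OF u(1)[of k]]) blast
  qed
  then obtain Bu where Bu: "\<And>k. Bu k > 0" "\<And>k w. norm (u k w) \<le> Bu k" "\<And>k w. Bu k < norm w \<Longrightarrow> u k w = 0"
    by metis
  define SB where "SB = (\<Sum>k\<in>UNIV. Bu k)"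
  have SB: "SB \<ge> 0" using less_imp_le[OF Bu(1)] by (simp add: SB_def sum_nonneg)
  have Bu_le: "Bu k \<le> SB" for k unfolding SB_def using Bu(1) by (intro member_le_sum) (auto intro: less_imp_le)
  define B where "B = Bv + SB"
  have B: "B > 0" using Bv(1) SB by (simp add: B_def)
  define field where "field s w = v w + (\<Sum>k\<in>UNIV. (s $ k) *\<^sub>R u k w)" for s :: "real ^ 'r" and w
  have corr: "norm (\<Sum>k\<in>UNIV. (s $ k) *\<^sub>R u k w) \<le> norm s * SB" for s :: "real ^ 'r" and w
  proof -
    have "norm (\<Sum>k\<in>UNIV. (s $ k) *\<^sub>R u k w) \<le> (\<Sum>k\<in>UNIV. \<bar>s $ k\<bar> * norm (u k w))"
      by (rule order_trans[OF norm_sum]) simp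
    also have "\<dots> \<le> (\<Sum>k\<in>UNIV. norm s * Bu k)"
      using Bu by (intro sum_mono mult_mono component_le_norm_cart) auto
    finally show ?thesis by (simp add: SB_def sum_distrib_left)
  qed
  have field_bound: "norm (field s w) \<le> B" if "norm s \<le> 1" for s w
  proof -
    have "norm (field s w) \<le> norm (v w) + norm (\<Sum>k\<in>UNIV. (s $ k) *\<^sub>R u k w)"
      unfolding field_def by (rule norm_triangle_ineq)
    also have "\<dots> \<le> Bv + norm s * SB" by (intro add_mono Bv corr)
    also have "\<dots> \<le> B" using that SB by (simp add: B_def mult_left_le_one_le)
    finally show ?thesis .
  qed
  have field_zero: "field s w = 0" if "B < norm w" for s w
  proof -
    have "v w = 0" using that SB by (intro Bv(3)) (simp add: B_def)
    moreover have "u k w = 0" for k using that Bu_le[of k] Bv(1) by (intro Bu(3)) (simp add: B_def)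
    ultimately show ?thesis by (simp add: field_def)
  qed
  define E where "E x = lp_norm q x powr \<rho>" for x :: "real ^ 'm"
  have contE: "continuous_on UNIV E"
    unfolding E_def using \<rho>_ge_1
    by (intro continuous_on_powr' continuous_on_lp_norm[OF q_ge_1] continuous_on_id continuous_on_const)
      (auto simp: lp_norm_nonneg)
  have "uniformly_continuous_on (cball 0 B) E"
    by (intro compact_uniformly_continuous continuous_on_subset[OF contE]) auto
  then obtain d1 where d1: "d1 > 0"
    "\<forall>x\<in>cball 0 B. \<forall>x'\<in>cball 0 B. dist x' x < d1 \<longrightarrow> dist (E x') (E x) < \<epsilon>"
    using \<epsilon> unfolding uniformly_continuous_on_def by blast
  \<comment> \<open>A correction \<open>s\<close> of norm at most \<open>\<eta>\<close> shifts every
    displacement by less than \<open>d1\<close>, hence its cost by less than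
    \<open>\<epsilon>\<close>.\<close>
  define \<eta> where "\<eta> = min 1 (d1 / (2 * (SB + 1)))"
  have \<eta>: "\<eta> > 0" "\<eta> \<le> 1" using d1 SB by (auto simp: \<eta>_def)
  have "\<eta> * SB \<le> d1 / (2 * (SB + 1)) * (SB + 1)"
    using SB \<eta> by (intro mult_mono) (auto simp: \<eta>_def)
  also have "\<dots> = d1 / 2" using SB by (simp add: field_simps)
  finally have \<eta>SB: "\<eta> * SB < d1" using d1 by linarith
  define R where "R = real CARD('r)"
  have R: "R \<ge> 0" by (simp add: R_def)
  \<comment> \<open>The self-map condition for Brouwer's theorem collects the errors
    \<open>\<tau> + (1 + R) * \<tau> + \<eta> / 2\<close>; this choice keeps their sum at most
    \<open>\<eta>\<close>.\<close>
  define \<tau> where "\<tau> = min \<epsilon> (\<eta> / (2 * (2 + R)))"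
  have \<tau>: "\<tau> > 0" "\<tau> \<le> \<epsilon>" using \<epsilon> \<eta> R by (auto simp: \<tau>_def)
  have "(2 + R) * \<tau> \<le> (2 + R) * (\<eta> / (2 * (2 + R)))"
    using R by (intro mult_left_mono) (auto simp: \<tau>_def)
  also have "\<dots> = \<eta> / 2"
  proof -
    define T where "T = 2 + R"
    have "T > 0" using R by (simp add: T_def)
    then show ?thesis unfolding T_def[symmetric] by simp
  qed
  finally have R\<tau>: "(2 + R) * \<tau> \<le> \<eta> / 2" .
  obtain n0 where n0: "n0 > 0"
    "\<forall>n\<ge>n0. \<forall>w x. norm w \<le> B \<longrightarrow> norm x \<le> B \<longrightarrow>
       norm (sqrt (real n) *\<^sub>R (h (w + (1 / sqrt (real n)) *\<^sub>R x) \<theta> - h w \<theta>) - J w *v x) \<le> \<tau>"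
    by (rule uniform_linearization[OF deriv continuous_drift_term B \<tau>(1)])
  define \<Phi> where "\<Phi> w = (J w *v v w, (\<chi> k. J w *v u k w), E (v w))" for w
  have Jf_meas: "(\<lambda>w. J w *v f w) \<in> borel_measurable borel" if "bounded_field f" for f
    by (rule bounded_field_compose_measurable[of _ "\<lambda>w x. J w *v x", OF bounded_field_measurable[OF that] continuous_drift_term])
  have chi_meas: "(\<lambda>w. \<chi> k. J w *v u k w) \<in> borel_measurable borel"
    unfolding borel_measurable_euclidean_space[where f = "\<lambda>w. \<chi> k. J w *v u k w"]
  proof
    fix b :: "(real ^ 'r) ^ 'r" assume "b \<in> Basis"
    then obtain k b' where "b = axis k b'" by (auto simp: Basis_vec_def)
    then show "(\<lambda>w. (\<chi> k. J w *v u k w) \<bullet> b) \<in> borel_measurable borel"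
      using Jf_meas[OF u(1)[of k]] by (simp add: inner_axis)
  qed
  have E_meas: "(\<lambda>w. E (v w)) \<in> borel_measurable borel"
    using bounded_field_measurable[OF v(1)] borel_measurable_continuous_onI[OF contE] by (rule measurable_compose)
  have \<Phi>_meas: "\<Phi> \<in> borel_measurable borel"
    unfolding \<Phi>_def borel_prod[symmetric] using Jf_meas[OF v(1)] chi_meas E_meas
    by (intro measurable_Pair) (simp_all only: borel_prod)
  have "\<exists>C. \<forall>w. norm (\<Phi> w) \<le> C"
  proof -
    have bd: "\<exists>C. \<forall>w. norm (J w *v f w) \<le> C" if f: "bounded_field f" for f
    proof -
      have "J w *v 0 = 0" for w by simp
      from bounded_field_compose_bounded[of f "\<lambda>w x. J w *v x", OF f continuous_drift_term this]
      obtain C where "\<forall>w. norm (J w *v f w) \<le> C" .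
      then show ?thesis ..
    qed
    obtain C1 where C1: "\<And>w. norm (J w *v v w) \<le> C1" using bd[OF v(1)] by blast
    have "\<forall>k. \<exists>C. \<forall>w. norm (J w *v u k w) \<le> C" using bd u(1) by blast
    then obtain C2 where C2: "\<And>k w. norm (J w *v u k w) \<le> C2 k" by metis
    obtain C3 where C3: "\<forall>w. norm (lp_norm q (v w) powr \<rho>) \<le> C3"
    proof -
      have "lp_norm q (0 :: real ^ 'm) powr \<rho> = 0" by simp
      from bounded_field_compose_bounded[of v "\<lambda>w x. lp_norm q x powr \<rho>", OF v(1) continuous_energy_term this]
      show ?thesis using that .
    qed
    have "norm (\<Phi> w) \<le> C1 + ((\<Sum>k\<in>UNIV. C2 k) + C3)" for w
    proof -
      have "norm (\<Phi> w) \<le> norm (J w *v v w) + (norm (\<chi> k. J w *v u k w) + norm (E (v w)))"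
        unfolding \<Phi>_def by (rule order_trans[OF norm_Pair_le add_left_mono[OF norm_Pair_le]])
      moreover have "norm (\<chi> k. J w *v u k w) \<le> (\<Sum>k\<in>UNIV. norm ((\<chi> k. J w *v u k w) $ k))"
        unfolding norm_vec_def by (rule L2_set_le_sum) simp
      moreover have "(\<Sum>k\<in>UNIV. norm ((\<chi> k. J w *v u k w) $ k)) \<le> (\<Sum>k\<in>UNIV. C2 k)"
        using C2 by (intro sum_mono) simp
      moreover have "norm (E (v w)) \<le> C3" using C3 by (simp add: E_def)
      ultimately show ?thesis using C1[of w] by linarith
    qed
    then show ?thesis by blast
  qed
  then obtain C where C: "\<forall>w. norm (\<Phi> w) \<le> C" by blast
  have \<Phi>_int: "integrable \<mu> \<Phi>"
    by (rule integrable_const_bound[of _ C]) (use C \<Phi>_meas in auto)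
  have "fst (\<integral>w. \<Phi> w \<partial>\<mu>) = (\<integral>w. fst (\<Phi> w) \<partial>\<mu>)"
    by (rule integral_bounded_linear[OF bounded_linear_fst \<Phi>_int, symmetric])
  then have int1: "fst (\<integral>w. \<Phi> w \<partial>\<mu>) = - y" using v(2) by (simp add: \<Phi>_def drift_def)
  have "fst (snd (\<integral>w. \<Phi> w \<partial>\<mu>)) $ k = (\<integral>w. fst (snd (\<Phi> w)) $ k \<partial>\<mu>)" for k
    by (rule integral_bounded_linear[OF bounded_linear_compose[OF bounded_linear_vec_nth
        bounded_linear_compose[OF bounded_linear_fst bounded_linear_snd]] \<Phi>_int, symmetric])
  then have int2: "fst (snd (\<integral>w. \<Phi> w \<partial>\<mu>)) $ k = axis k 1" for k
    using u(2)[of k] by (simp add: \<Phi>_def drift_def)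
  have "snd (snd (\<integral>w. \<Phi> w \<partial>\<mu>)) = (\<integral>w. snd (snd (\<Phi> w)) \<partial>\<mu>)"
    by (rule integral_bounded_linear[OF bounded_linear_compose[OF bounded_linear_snd bounded_linear_snd] \<Phi>_int, symmetric])
  then have int3: "snd (snd (\<integral>w. \<Phi> w \<partial>\<mu>)) = energy v" by (simp add: \<Phi>_def energy_def E_def)
  have h_cont: "continuous_on UNIV (\<lambda>w. h w \<theta>)"
    using has_derivative_continuous[OF deriv] by (intro continuous_at_imp_continuous_on) simp
  have main: "ennreal (real n powr (\<rho> / 2)) * profile_function c h (empirical_measure n w) \<theta> \<le> ennreal a"
    if n: "n \<ge> n0" and close: "norm ((\<Sum>i\<in>{1..n}. h (w i) \<theta>) /\<^sub>R sqrt (real n) - y) \<le> \<eta> / 2"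
      and lln: "norm ((\<Sum>i\<in>{1..n}. \<Phi> (w i)) /\<^sub>R real n - (\<integral>w. \<Phi> w \<partial>\<mu>)) < \<tau>" for n and w :: "nat \<Rightarrow> real ^ 'm"
  proof -
    have npos: "n > 0" "real n > 0" using n n0(1) by auto
    define r where "r = sqrt (real n)"
    have r: "r > 0" "r * r = real n" using npos by (simp_all add: r_def)
    let ?I = "{1..n}"
    define av :: "(real ^ 'm \<Rightarrow> real ^ 'r) \<Rightarrow> real ^ 'r" where "av f = (\<Sum>i\<in>?I. f (w i)) /\<^sub>R real n" for f
    define D where "D = (\<Sum>i\<in>?I. \<Phi> (w i)) /\<^sub>R real n - (\<integral>w. \<Phi> w \<partial>\<mu>)"
    have D: "norm D < \<tau>" using lln by (simp add: D_def)
    have D1: "fst D = av (\<lambda>w. J w *v v w) + y"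
      unfolding D_def fst_diff int1 by (simp add: fst_sum \<Phi>_def av_def)
    have D2: "fst (snd D) $ k = av (\<lambda>w. J w *v u k w) - axis k 1" for k
      unfolding D_def fst_diff snd_diff vector_minus_component int2
      by (simp add: fst_sum snd_sum \<Phi>_def av_def)
    have D3: "snd (snd D) = (\<Sum>i\<in>?I. E (v (w i))) / real n - energy v"
      unfolding D_def snd_diff int3 by (simp add: snd_sum \<Phi>_def divide_inverse mult.commute)
    have "norm (fst D) \<le> norm D" using norm_fst_le[of "fst D" "snd D"] by simp
    then have "norm (fst D) \<le> \<tau>" using D by linarith
    then have nD1: "norm (av (\<lambda>w. J w *v v w) + y) \<le> \<tau>" by (simp only: D1)
    have snd_D: "norm (snd D) \<le> \<tau>" using norm_snd_le[of "snd D" "fst D"] D by simp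
    have "norm (fst (snd D)) \<le> norm (snd D)" using norm_fst_le[of "fst (snd D)" "snd (snd D)"] by simp
    then have "norm (fst (snd D) $ k) \<le> \<tau>" for k
      using Finite_Cartesian_Product.norm_nth_le[of "fst (snd D)" k] snd_D by linarith
    then have nD2: "norm (av (\<lambda>w. J w *v u k w) - axis k 1) \<le> \<tau>" for k by (simp only: D2)
    have "norm (snd (snd D)) \<le> norm (snd D)" using norm_snd_le[of "snd (snd D)" "fst (snd D)"] by simp
    then have "norm (snd (snd D)) \<le> \<tau>" using snd_D by linarith
    then have nD3: "(\<Sum>i\<in>?I. E (v (w i))) / real n \<le> energy v + \<tau>" unfolding D3 by simp
    define x where "x s i = w i + (1 / r) *\<^sub>R field s (w i)" for s i
    define G where "G s = (\<Sum>i\<in>?I. h (x s i) \<theta>) /\<^sub>R r" for s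
    define H where "H = (\<Sum>i\<in>?I. h (w i) \<theta>) /\<^sub>R r"
    have H: "norm (H - y) \<le> \<eta> / 2" using close by (simp add: H_def r_def)
    have lin: "norm (G s - H - av (\<lambda>w. J w *v field s w)) \<le> \<tau>" if s: "norm s \<le> 1" for s
    proof -
      define e where "e i = r *\<^sub>R (h (x s i) \<theta> - h (w i) \<theta>) - J (w i) *v field s (w i)" for i
      \<comment> \<open>Inside the ball this is the uniform linearisation; outside it the field
        vanishes and there is no error.\<close>
      have "norm (e i) \<le> \<tau>" for i
      proof (cases "norm (w i) \<le> B")
        case True
        then show ?thesis using n0(2) n field_bound[OF s] by (simp add: e_def x_def r_def)
      next
        case False
        then show ?thesis using \<tau> field_zero[of "w i" s] by (simp add: e_def x_def)
      qed
      then have "norm (\<Sum>i\<in>?I. e i) \<le> real (card ?I) * \<tau>" by (intro sum_norm_bound)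
      moreover have "G s - H - av (\<lambda>w. J w *v field s w) = (\<Sum>i\<in>?I. e i) /\<^sub>R real n"
      proof -
        have "(\<Sum>i\<in>?I. e i) = r *\<^sub>R ((\<Sum>i\<in>?I. h (x s i) \<theta>) - (\<Sum>i\<in>?I. h (w i) \<theta>)) - (\<Sum>i\<in>?I. J (w i) *v field s (w i))"
          by (simp add: e_def sum_subtractf scaleR_sum_right[symmetric])
        moreover have "inverse (real n) * r = inverse r" using r by (simp add: r(2)[symmetric])
        ultimately show ?thesis
          by (simp add: G_def H_def av_def scaleR_diff_right)
      qed
      ultimately show ?thesis using npos by (simp add: field_simps)
    qed
    \<comment> \<open>The averaged drift of \<open>v\<close> nearly cancels \<open>y\<close> and the
      corrections contribute nearly \<open>s\<close>: one error \<open>\<tau>\<close> for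
      \<open>v\<close> and one for each of the \<open>R\<close> corrections.\<close>
    have av_field: "norm (av (\<lambda>w. J w *v field s w) + y - s) \<le> (1 + R) * \<tau>" if s: "norm s \<le> 1" for s
    proof -
      have "av (\<lambda>w. J w *v field s w) = av (\<lambda>w. J w *v v w) + (\<Sum>k\<in>UNIV. (s $ k) *\<^sub>R av (\<lambda>w. J w *v u k w))"
      proof -
        have "J z *v field s z = J z *v v z + (\<Sum>k\<in>UNIV. (s $ k) *\<^sub>R (J z *v u k z))" for z
          unfolding field_def matrix_vector_right_distrib
          by (simp add: linear_sum[OF matrix_vector_mul_linear] matrix_vector_mult_scaleR)
        then have "(\<Sum>i\<in>?I. J (w i) *v field s (w i))
            = (\<Sum>i\<in>?I. J (w i) *v v (w i)) + (\<Sum>k\<in>UNIV. (s $ k) *\<^sub>R (\<Sum>i\<in>?I. J (w i) *v u k (w i)))"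
          by (simp add: sum.distrib scaleR_sum_right) (rule sum.swap)
        then show ?thesis by (simp add: av_def scaleR_add_right scaleR_sum_right mult.commute)
      qed
      moreover have "(\<Sum>k\<in>UNIV. (s $ k) *\<^sub>R axis k 1) = s"
        by (simp add: basis_expansion flip: scalar_mult_eq_scaleR)
      ultimately have eq: "av (\<lambda>w. J w *v field s w) + y - s
          = (av (\<lambda>w. J w *v v w) + y) + (\<Sum>k\<in>UNIV. (s $ k) *\<^sub>R (av (\<lambda>w. J w *v u k w) - axis k 1))"
        by (simp add: scaleR_diff_right sum_subtractf)
      have "norm (\<Sum>k\<in>UNIV. (s $ k) *\<^sub>R (av (\<lambda>w. J w *v u k w) - axis k 1)) \<le> (\<Sum>k\<in>(UNIV :: 'r set). \<tau>)"
      proof (rule order_trans[OF norm_sum sum_mono])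
        fix k
        have "norm ((s $ k) *\<^sub>R (av (\<lambda>w. J w *v u k w) - axis k 1)) = \<bar>s $ k\<bar> * norm (av (\<lambda>w. J w *v u k w) - axis k 1)"
          by simp
        also have "\<dots> \<le> 1 * \<tau>"
          using component_le_norm_cart[of s k] s nD2[of k] by (intro mult_mono) auto
        finally show "norm ((s $ k) *\<^sub>R (av (\<lambda>w. J w *v u k w) - axis k 1)) \<le> \<tau>" by simp
      qed
      then show ?thesis
        unfolding eq using nD1 norm_triangle_ineq[of "av (\<lambda>w. J w *v v w) + y" "\<Sum>k\<in>UNIV. (s $ k) *\<^sub>R (av (\<lambda>w. J w *v u k w) - axis k 1)"]
        by (simp add: R_def distrib_right)
    qed
    \<comment> \<open>\<open>G s\<close> differs from \<open>s\<close> by at most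
      \<open>\<eta>\<close> on this ball, so the map preserves it, and a fixed point is exactly a
      zero of the empirical moment \<open>G\<close>.\<close>
    have maps: "(\<lambda>s. s - G s) \<in> cball 0 \<eta> \<rightarrow> cball 0 \<eta>"
    proof
      fix s assume "s \<in> cball (0 :: real ^ 'r) \<eta>"
      then have s: "norm s \<le> 1" using \<eta> by simp
      let ?A = "av (\<lambda>w. J w *v field s w)"
      have "(G s - H - ?A) + (?A + y - s) + (H - y) = - (s - G s)" by simp
      then have "norm (s - G s) = norm ((G s - H - ?A) + (?A + y - s) + (H - y))" by (simp only: norm_minus_cancel)
      also have "\<dots> \<le> norm (G s - H - ?A) + norm (?A + y - s) + norm (H - y)"
        by (intro norm_triangle_mono order_refl)
      also have "\<dots> \<le> \<tau> + (1 + R) * \<tau> + \<eta> / 2"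
        by (intro add_mono lin[OF s] av_field[OF s] H)
      also have "\<dots> \<le> \<eta>" using R\<tau> by (simp add: algebra_simps)
      finally show "s - G s \<in> cball 0 \<eta>" by simp
    qed
    have contG: "continuous_on (cball 0 \<eta>) (\<lambda>s. s - G s)"
    proof -
      have "continuous_on (cball 0 \<eta>) (\<lambda>s. h (x s i) \<theta>)" for i
      proof (rule continuous_on_compose2[OF h_cont])
        show "continuous_on (cball 0 \<eta>) (\<lambda>s. x s i)"
          unfolding x_def field_def
          by (intro continuous_on_add continuous_on_const continuous_on_scaleR continuous_on_sum
              continuous_on_component continuous_on_id)
      qed simp
      then show ?thesis
        unfolding G_def
        by (intro continuous_on_diff continuous_on_id continuous_on_scaleR continuous_on_const continuous_on_sum) simp
    qed
    obtain s where s: "s \<in> cball 0 \<eta>" "s - G s = s"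
      using brouwer_ball[OF \<eta>(1) contG maps] .
    have s1: "norm s \<le> 1" and s\<eta>: "norm s \<le> \<eta>" using s(1) \<eta> by auto
    have zero: "(\<Sum>i\<in>?I. h (x s i) \<theta>) = 0" using s(2) r by (simp add: G_def)
    have c_eq: "c (x s i) (w i) = real n powr (- \<rho> / 2) * E (field s (w i))" for i
    proof -
      have "c (x s i) (w i) = (lp_norm q (field s (w i)) / r) powr \<rho>"
        using r by (simp add: c_def x_def lp_norm_scaleR[OF q_ge_1])
      also have "\<dots> = E (field s (w i)) / r powr \<rho>"
        using r by (simp add: E_def powr_divide lp_norm_nonneg)
      also have "r powr \<rho> = real n powr (\<rho> / 2)"
        unfolding r_def powr_half_sqrt[OF of_nat_0_le_iff, symmetric] powr_powr by simp
      finally have "c (x s i) (w i) = E (field s (w i)) / real n powr (\<rho> / 2)" .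
      moreover have "real n powr (- \<rho> / 2) = 1 / real n powr (\<rho> / 2)"
        using powr_minus_divide[of "real n" "\<rho> / 2"] by simp
      ultimately show ?thesis by simp
    qed
    have E_field: "E (field s (w i)) \<le> E (v (w i)) + \<epsilon>" for i
    proof -
      have "dist (field s (w i)) (v (w i)) \<le> norm s * SB" using corr[of s "w i"] by (simp add: field_def dist_norm)
      also have "\<dots> \<le> \<eta> * SB" using s\<eta> SB by (intro mult_right_mono)
      finally have "dist (field s (w i)) (v (w i)) < d1" using \<eta>SB by simp
      moreover have "field s (w i) \<in> cball 0 B" using field_bound[OF s1] by simp
      moreover have "v (w i) \<in> cball 0 B" using Bv(2)[of "w i"] SB by (simp add: B_def)
      ultimately have "dist (E (field s (w i))) (E (v (w i))) < \<epsilon>" using d1(2) by blast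
      then show ?thesis by (simp add: dist_norm abs_less_iff)
    qed
    have "(\<Sum>i\<in>?I. E (field s (w i))) \<le> (\<Sum>i\<in>?I. E (v (w i)) + \<epsilon>)" by (intro sum_mono E_field)
    also have "\<dots> = (\<Sum>i\<in>?I. E (v (w i))) + real n * \<epsilon>" by (simp add: sum.distrib)
    finally have "(\<Sum>i\<in>?I. E (field s (w i))) / real n \<le> (\<Sum>i\<in>?I. E (v (w i))) / real n + \<epsilon>"
      using npos by (simp add: field_simps)
    also have "\<dots> \<le> a" using nD3 v(3) \<tau>(2) a'(1) by linarith
    finally have le_a: "(\<Sum>i\<in>?I. E (field s (w i))) / real n \<le> a" .
    have "profile_function c h (empirical_measure n w) \<theta> \<le> ennreal ((\<Sum>i\<in>?I. c (x s i) (w i)) / real n)"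
    proof (rule profile_function_le_points[OF npos(1)])
      show "(\<lambda>w. h w \<theta>) \<in> borel_measurable borel" by (rule borel_measurable_continuous_onI[OF h_cont])
      have "continuous_on UNIV (\<lambda>z :: (real ^ 'm) \<times> (real ^ 'm). E (fst z - snd z))"
        by (rule continuous_on_compose2[OF contE]) (auto intro!: continuous_intros)
      then show "(\<lambda>z. c (fst z) (snd z)) \<in> borel_measurable borel"
        unfolding c_def E_def by (rule borel_measurable_continuous_onI)
      show "(\<Sum>i\<in>?I. h (x s i) \<theta>) = 0" by (rule zero)
    qed (simp add: c_def)
    also have "(\<Sum>i\<in>?I. c (x s i) (w i)) / real n = real n powr (- \<rho> / 2) * ((\<Sum>i\<in>?I. E (field s (w i))) / real n)"
      by (simp add: c_eq sum_distrib_left)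
    finally have "ennreal (real n powr (\<rho> / 2)) * profile_function c h (empirical_measure n w) \<theta>
        \<le> ennreal (real n powr (\<rho> / 2)) * ennreal (real n powr (- \<rho> / 2) * ((\<Sum>i\<in>?I. E (field s (w i))) / real n))"
      by (intro mult_left_mono) auto
    also have "\<dots> = ennreal (real n powr (\<rho> / 2) * (real n powr (- \<rho> / 2) * ((\<Sum>i\<in>?I. E (field s (w i))) / real n)))"
      by (rule ennreal_mult'[symmetric]) simp
    also have "real n powr (\<rho> / 2) * (real n powr (- \<rho> / 2) * ((\<Sum>i\<in>?I. E (field s (w i))) / real n))
        = (\<Sum>i\<in>?I. E (field s (w i))) / real n"
      using npos by (simp add: mult.assoc[symmetric] powr_add[symmetric])
    also have "ennreal ((\<Sum>i\<in>?I. E (field s (w i))) / real n) \<le> ennreal a" using le_a by (rule ennreal_leI)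
    finally show ?thesis .
  qed
  show thesis
  proof (rule that[of "\<eta> / 2" \<tau> \<Phi> n0])
    show "\<eta> / 2 > 0" using \<eta> by simp
    show "\<exists>B. \<forall>w. norm (\<Phi> w) \<le> B" using C by blast
  qed (use \<tau> \<Phi>_meas main in blast)+
qed

section \<open>The asymptotic upper bound\<close>

text \<open>Applied with \<open>Suc\<close>: the samples carry the indices from 1 on, while the
  partial sums of the limit theorems start at 0.\<close>

lemma (in prob_space) indep_vars_reindex_inj:
  assumes indep: "indep_vars (\<lambda>_. N) X UNIV" and f: "inj f"
  shows "indep_vars (\<lambda>_. N) (\<lambda>i. X (f i)) UNIV"
proof -
  have "indep_sets (\<lambda>i. F (f i)) UNIV" if F: "indep_sets F UNIV" for F
    unfolding indep_sets_def
  proof (intro conjI ballI allI impI)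
    show "F (f i) \<subseteq> events" for i using F by (simp add: indep_sets_def)
    fix J A assume J: "J \<noteq> {}" "finite J" and A: "A \<in> (\<Pi> i\<in>J. F (f i))"
    define B where "B k = A (inv f k)" for k
    have Bf: "B (f i) = A i" for i using f by (simp add: B_def)
    have "f ` J \<noteq> {}" "finite (f ` J)" "B \<in> Pi (f ` J) F" using J A by (auto simp: Bf)
    then have "prob (\<Inter>k\<in>f ` J. B k) = (\<Prod>k\<in>f ` J. prob (B k))"
      by (rule F[unfolded indep_sets_def, THEN conjunct2, rule_format, OF subset_UNIV])
    moreover have "(\<Inter>k\<in>f ` J. B k) = (\<Inter>i\<in>J. A i)" by (simp add: Bf)
    moreover have "(\<Prod>k\<in>f ` J. prob (B k)) = (\<Prod>i\<in>J. prob (A i))"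
      using f by (subst prod.reindex) (auto simp: Bf intro: inj_on_subset)
    ultimately show "prob (\<Inter>i\<in>J. A i) = (\<Prod>i\<in>J. prob (A i))" by (simp only:)
  qed
  from this[of "\<lambda>i. sigma_sets (space M) {X i -` A \<inter> space M |A. A \<in> sets N}"] indep
  show ?thesis by (simp add: indep_vars_def)
qed

lemma limit_values_distr:
  fixes J :: "real ^ 'm \<Rightarrow> real ^ 'm ^ 'r"
  assumes [measurable]: "X \<in> borel_measurable M" and J: "continuous_on UNIV J"
  shows "limit_values p \<rho> M (\<lambda>\<omega>. J (X \<omega>)) y = limit_values p \<rho> (distr M borel X) J y"
proof -
  have "continuous_on UNIV (\<lambda>w. \<zeta> v* J w)" for \<zeta>
    unfolding vector_matrix_mult_def
    by (intro continuous_on_vec_lambda continuous_on_sum continuous_on_mult continuous_on_component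
        continuous_on_const J)
  then have [measurable]: "(\<lambda>w. \<zeta> v* J w) \<in> borel_measurable borel" for \<zeta>
    by (rule borel_measurable_continuous_onI)
  have "measure (distr M borel X) {w \<in> space (distr M borel X). lp_norm p (\<zeta> v* J w) > 1}
      = measure M {\<omega> \<in> space M. lp_norm p (\<zeta> v* J (X \<omega>)) > 1}" for \<zeta>
  proof -
    have "{w \<in> space borel. lp_norm p (\<zeta> v* J w) > 1} \<in> sets borel" by measurable
    then have "measure (distr M borel X) {w \<in> space borel. lp_norm p (\<zeta> v* J w) > 1}
        = measure M (X -` {w \<in> space borel. lp_norm p (\<zeta> v* J w) > 1} \<inter> space M)"
      by (intro measure_distr) simp_all
    also have "X -` {w \<in> space borel. lp_norm p (\<zeta> v* J w) > 1} \<inter> space M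
        = {\<omega> \<in> space M. lp_norm p (\<zeta> v* J (X \<omega>)) > 1}" by auto
    finally show ?thesis by simp
  qed
  moreover have "(\<integral>\<^sup>+ w. ennreal (lp_norm p (\<zeta> v* J w) powr r) \<partial>distr M borel X)
      = (\<integral>\<^sup>+ \<omega>. ennreal (lp_norm p (\<zeta> v* J (X \<omega>)) powr r) \<partial>M)" for \<zeta> r
    by (rule nn_integral_distr) measurable
  ultimately show ?thesis by (simp only: limit_values_def)
qed

lemma extend_mono_bounded:
  assumes "\<And>x. \<bar>f x\<bar> \<le> C" shows "\<bar>extend_mono f x\<bar> \<le> C"
proof -
  have le: "f x \<le> C" and ge: "- C \<le> f x" for x using assms[of x] by linarith+
  have bdd: "bdd_above (range f)" by (rule bdd_aboveI[of _ C]) (auto simp: le)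
  have bdd': "bdd_below (range f)" by (rule bdd_belowI[of _ "- C"]) (auto simp: ge)
  have "(SUP r. f r) \<le> C" by (rule cSUP_least) (simp_all add: le)
  moreover have "- C \<le> (INF r. f r)" by (rule cINF_greatest) (simp_all add: ge)
  moreover have "f 0 \<le> (SUP r. f r)" using bdd by (rule cSUP_upper[rotated]) simp
  moreover have "(INF r. f r) \<le> f 0" using bdd' by (rule cINF_lower) simp
  ultimately have "\<bar>SUP r. f r\<bar> \<le> C" "\<bar>INF r. f r\<bar> \<le> C" using le[of 0] ge[of 0] by linarith+
  then show ?thesis using assms by (cases x) (simp_all add: extend_mono_def)
qed

lemma extend_mono_measurable:
  assumes "continuous_on UNIV f" shows "extend_mono f \<in> borel_measurable borel"
proof -
  have [measurable]: "f \<in> borel_measurable borel" using assms by (rule borel_measurable_continuous_onI)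
  have "extend_mono f = (\<lambda>x. if x = \<infinity> then (SUP r. f r) else if x = - \<infinity> then (INF r. f r) else f (real_of_ereal x))"
  proof
    fix x show "extend_mono f x = (if x = \<infinity> then (SUP r. f r) else if x = - \<infinity> then (INF r. f r) else f (real_of_ereal x))"
      by (cases x) (auto simp: extend_mono_def)
  qed
  then show ?thesis by (simp only:) measurable
qed

lemma extend_mono_le:
  assumes "mono f" "0 \<le> x" "x \<le> ereal r" shows "extend_mono f x \<le> f r"
  using assms by (cases x) (simp_all add: extend_mono_def monoD)

text \<open>Monotonicity bounds \<open>extend_mono f (A n \<omega>)\<close> by
  \<open>f (b (S n \<omega>) + \<epsilon>)\<close> off an event of small probability, on which the
  error is at most \<open>2 * C\<close>. Weak convergence settles the limit in \<open>n\<close> for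
  fixed \<open>\<epsilon>\<close>, and dominated convergence then removes
  \<open>\<epsilon>\<close>.\<close>

lemma asymp_stoch_leI:
  fixes S :: "nat \<Rightarrow> 'a \<Rightarrow> 'c::euclidean_space" and H :: "'b \<Rightarrow> 'c" and b :: "'c \<Rightarrow> real"
  assumes "prob_space M" "prob_space N"
    and A [measurable]: "\<And>n. A n \<in> borel_measurable M" and A_nonneg: "\<And>n \<omega>. 0 \<le> A n \<omega>"
    and S [measurable]: "\<And>n. S n \<in> borel_measurable M" and H [measurable]: "H \<in> borel_measurable N"
    and b: "continuous_on UNIV b"
    and weak: "\<And>(g :: 'c \<Rightarrow> real) C. continuous_on UNIV g \<Longrightarrow> (\<And>x. \<bar>g x\<bar> \<le> C) \<Longrightarrow>
      (\<lambda>n. \<integral>\<omega>. g (S n \<omega>) \<partial>M) \<longlonglongrightarrow> (\<integral>\<omega>. g (H \<omega>) \<partial>N)"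
    and tail: "\<And>\<epsilon> \<eta>. \<epsilon> > 0 \<Longrightarrow> \<eta> > 0 \<Longrightarrow>
      \<forall>\<^sub>F n in sequentially. measure M {\<omega> \<in> space M. ereal (b (S n \<omega>) + \<epsilon>) < A n \<omega>} \<le> \<eta>"
  shows "asymp_stoch_le M A N (\<lambda>\<omega>. ereal (b (H \<omega>)))"
proof -
  interpret M: prob_space M by fact
  interpret N: prob_space N by fact
  have b_meas [measurable]: "b \<in> borel_measurable borel" using b by (rule borel_measurable_continuous_onI)
  have main: "limsup (\<lambda>n. ereal (\<integral>\<omega>. extend_mono f (A n \<omega>) \<partial>M)) \<le> ereal (\<integral>\<omega>. extend_mono f (ereal (b (H \<omega>))) \<partial>N)"
    if f: "continuous_on UNIV f" "bounded (range f)" "mono f" for f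
  proof -
    obtain C where C: "\<And>x. \<bar>f x\<bar> \<le> C" using f(2) unfolding bounded_iff by auto
    have C0: "0 \<le> C" using C[of 0] abs_ge_zero[of "f 0"] by linarith
    have f_meas [measurable]: "f \<in> borel_measurable borel" using f(1) by (rule borel_measurable_continuous_onI)
    note ext_meas [measurable] = extend_mono_measurable[OF f(1)]
    have ext_int: "integrable M (\<lambda>\<omega>. extend_mono f (A n \<omega>))" for n
      by (rule M.integrable_const_bound[of _ C]) (simp_all add: extend_mono_bounded[OF C])
    have f_int: "integrable M (\<lambda>\<omega>. f (b (S n \<omega>) + \<epsilon>))" for n \<epsilon>
      by (rule M.integrable_const_bound[of _ C]) (simp_all add: C)
    have step: "limsup (\<lambda>n. ereal (\<integral>\<omega>. extend_mono f (A n \<omega>) \<partial>M)) \<le> ereal ((\<integral>\<omega>. f (b (H \<omega>) + \<epsilon>) \<partial>N) + 2 * C * \<epsilon>)"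
      if \<epsilon>: "\<epsilon> > 0" for \<epsilon>
    proof -
      \<comment> \<open>The probability level of the tail bound is also taken to be
        \<open>\<epsilon>\<close>, so that one parameter controls both errors.\<close>
      have "\<forall>\<^sub>F n in sequentially. ereal (\<integral>\<omega>. extend_mono f (A n \<omega>) \<partial>M) \<le> ereal ((\<integral>\<omega>. f (b (S n \<omega>) + \<epsilon>) \<partial>M) + 2 * C * \<epsilon>)"
        using tail[OF \<epsilon> \<epsilon>]
      proof (rule eventually_mono)
        fix n let ?B = "{\<omega> \<in> space M. ereal (b (S n \<omega>) + \<epsilon>) < A n \<omega>}"
        assume B: "measure M ?B \<le> \<epsilon>"
        have B_int: "integrable M (\<lambda>\<omega>. 2 * C * indicator ?B \<omega>)"
          by (intro integrable_mult_right integrable_real_indicator) (auto simp: M.emeasure_eq_measure)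
        have "(\<integral>\<omega>. extend_mono f (A n \<omega>) \<partial>M) \<le> (\<integral>\<omega>. f (b (S n \<omega>) + \<epsilon>) + 2 * C * indicator ?B \<omega> \<partial>M)"
        proof (rule integral_mono[OF ext_int Bochner_Integration.integrable_add[OF f_int B_int]])
          fix \<omega> assume \<omega>: "\<omega> \<in> space M"
          show "extend_mono f (A n \<omega>) \<le> f (b (S n \<omega>) + \<epsilon>) + 2 * C * indicator ?B \<omega>"
          proof (cases "\<omega> \<in> ?B")
            case True
            then show ?thesis using extend_mono_bounded[of f C "A n \<omega>", OF C] C[of "b (S n \<omega>) + \<epsilon>"] by simp
          next
            case False
            then have "A n \<omega> \<le> ereal (b (S n \<omega>) + \<epsilon>)" using \<omega> by (simp add: not_less)
            then show ?thesis using False extend_mono_le[OF f(3) A_nonneg] by simp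
          qed
        qed
        also have "\<dots> = (\<integral>\<omega>. f (b (S n \<omega>) + \<epsilon>) \<partial>M) + 2 * C * measure M ?B"
          by (subst Bochner_Integration.integral_add[OF f_int B_int]) simp
        also have "\<dots> \<le> (\<integral>\<omega>. f (b (S n \<omega>) + \<epsilon>) \<partial>M) + 2 * C * \<epsilon>"
          using B C0 by (intro add_left_mono mult_left_mono) auto
        finally show "ereal (\<integral>\<omega>. extend_mono f (A n \<omega>) \<partial>M) \<le> ereal ((\<integral>\<omega>. f (b (S n \<omega>) + \<epsilon>) \<partial>M) + 2 * C * \<epsilon>)" by simp
      qed
      then have "limsup (\<lambda>n. ereal (\<integral>\<omega>. extend_mono f (A n \<omega>) \<partial>M))
          \<le> limsup (\<lambda>n. ereal ((\<integral>\<omega>. f (b (S n \<omega>) + \<epsilon>) \<partial>M) + 2 * C * \<epsilon>))"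
        by (rule Limsup_mono)
      also have "\<dots> = ereal ((\<integral>\<omega>. f (b (H \<omega>) + \<epsilon>) \<partial>N) + 2 * C * \<epsilon>)"
      proof (rule lim_imp_Limsup[OF sequentially_bot], intro tendsto_ereal tendsto_add tendsto_const)
        have "continuous_on UNIV (\<lambda>x. f (b x + \<epsilon>))"
          by (rule continuous_on_compose2[OF f(1)]) (auto intro!: continuous_intros b)
        from weak[OF this C]
        show "(\<lambda>n. (\<integral>\<omega>. f (b (S n \<omega>) + \<epsilon>) \<partial>M)) \<longlonglongrightarrow> (\<integral>\<omega>. f (b (H \<omega>) + \<epsilon>) \<partial>N)" .
      qed
      finally show ?thesis .
    qed
    have lim0: "(\<lambda>k. 1 / real (Suc k)) \<longlonglongrightarrow> 0"
      using LIMSEQ_inverse_real_of_nat by (simp add: inverse_eq_divide)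
    have "(\<lambda>k. \<integral>\<omega>. f (b (H \<omega>) + 1 / real (Suc k)) \<partial>N) \<longlonglongrightarrow> (\<integral>\<omega>. f (b (H \<omega>)) \<partial>N)"
    proof (rule integral_dominated_convergence[where w = "\<lambda>_. C"])
      show "AE \<omega> in N. (\<lambda>k. f (b (H \<omega>) + 1 / real (Suc k))) \<longlonglongrightarrow> f (b (H \<omega>))"
      proof (rule AE_I2)
        fix \<omega>
        have "(\<lambda>k. b (H \<omega>) + 1 / real (Suc k)) \<longlonglongrightarrow> b (H \<omega>) + 0"
          by (intro tendsto_add tendsto_const lim0)
        then show "(\<lambda>k. f (b (H \<omega>) + 1 / real (Suc k))) \<longlonglongrightarrow> f (b (H \<omega>))"
          using continuous_on_tendsto_compose[OF f(1)] by simp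
      qed
      show "AE \<omega> in N. norm (f (b (H \<omega>) + 1 / real (Suc k))) \<le> C" for k using C by simp
    qed simp_all
    then have "(\<lambda>k. (\<integral>\<omega>. f (b (H \<omega>) + 1 / real (Suc k)) \<partial>N) + 2 * C * (1 / real (Suc k)))
        \<longlonglongrightarrow> (\<integral>\<omega>. f (b (H \<omega>)) \<partial>N) + 2 * C * 0"
      by (intro tendsto_add tendsto_mult tendsto_const lim0)
    then have "(\<lambda>k. ereal ((\<integral>\<omega>. f (b (H \<omega>) + 1 / real (Suc k)) \<partial>N) + 2 * C * (1 / real (Suc k))))
        \<longlonglongrightarrow> ereal (\<integral>\<omega>. f (b (H \<omega>)) \<partial>N)"
      by (intro tendsto_ereal) simp
    then have "limsup (\<lambda>n. ereal (\<integral>\<omega>. extend_mono f (A n \<omega>) \<partial>M)) \<le> ereal (\<integral>\<omega>. f (b (H \<omega>)) \<partial>N)"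
    proof (rule LIMSEQ_le_const)
      show "\<exists>k0. \<forall>k\<ge>k0. limsup (\<lambda>n. ereal (\<integral>\<omega>. extend_mono f (A n \<omega>) \<partial>M))
          \<le> ereal ((\<integral>\<omega>. f (b (H \<omega>) + 1 / real (Suc k)) \<partial>N) + 2 * C * (1 / real (Suc k)))"
        by (intro exI[of _ 0] allI impI step) simp
    qed
    then show ?thesis by (simp add: extend_mono_def)
  qed
  show ?thesis
    unfolding asymp_stoch_le_def using main by auto
qed

text \<open>Tightness confines \<open>S n\<close> to a compact ball up to probability
  \<open>\<eta> / 2\<close>, and finitely many neighbourhoods from the local bound cover that ball.
  Each centre has its own fields and its own law of large numbers, so finitely many deviation events
  share the other \<open>\<eta> / 2\<close>.\<close>

lemma (in jacobian_field) profile_function_tail: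
  fixes M :: "'a measure" and W :: "nat \<Rightarrow> 'a \<Rightarrow> real ^ 'm" and h :: "real ^ 'm \<Rightarrow> 't \<Rightarrow> real ^ 'r" and \<theta> :: 't
  defines "c \<equiv> \<lambda>u w. lp_norm q (u - w) powr \<rho>"
  defines "S \<equiv> \<lambda>n \<omega>. (\<Sum>i<n. h (W (Suc i) \<omega>) \<theta>) /\<^sub>R sqrt (real n)"
  assumes "prob_space M" and indep: "prob_space.indep_vars M (\<lambda>_. borel) W UNIV"
    and ident: "\<And>i. distr M borel (W i) = \<mu>"
    and deriv: "\<And>w. ((\<lambda>w. h w \<theta>) has_derivative (\<lambda>v. J w *v v)) (at w)"
    and mean: "(\<integral>w. h w \<theta> \<partial>\<mu>) = 0" and sq: "integrable \<mu> (\<lambda>w. (norm (h w \<theta>))\<^sup>2)"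
    and "\<epsilon> > 0" "\<eta> > 0"
  shows "\<forall>\<^sub>F n in sequentially. measure M {\<omega> \<in> space M. ereal (real_bound (S n \<omega>) + \<epsilon>) <
    enn2ereal (ennreal (real n powr (\<rho> / 2)) * profile_function c h (empirical_measure n (\<lambda>i. W i \<omega>)) \<theta>)} \<le> \<eta>"
proof -
  interpret M: prob_space M by fact
  have W_meas [measurable]: "W i \<in> borel_measurable M" for i using indep by (simp add: M.indep_vars_def)
  have h_cont: "continuous_on UNIV (\<lambda>w. h w \<theta>)"
    using has_derivative_continuous[OF deriv] by (intro continuous_at_imp_continuous_on) simp
  then have h_meas [measurable]: "(\<lambda>w. h w \<theta>) \<in> borel_measurable borel" by (rule borel_measurable_continuous_onI)
  have indep_Suc: "M.indep_vars (\<lambda>_. borel) (\<lambda>i \<omega>. F (W (Suc i) \<omega>)) UNIV"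
    if [measurable]: "F \<in> borel_measurable borel" for F :: "real ^ 'm \<Rightarrow> 'c::euclidean_space"
  proof -
    have "M.indep_vars (\<lambda>_. borel) (\<lambda>i. W (Suc i)) UNIV"
      by (rule M.indep_vars_reindex_inj[OF indep]) simp
    then show ?thesis by (rule M.indep_vars_compose2) simp
  qed
  have transfer: "(\<integral>\<omega>. F (W i \<omega>) \<partial>M) = (\<integral>w. F w \<partial>\<mu>)" "integrable M (\<lambda>\<omega>. F (W i \<omega>)) \<longleftrightarrow> integrable \<mu> F"
    if "F \<in> borel_measurable borel" for F :: "real ^ 'm \<Rightarrow> 'c::{banach, second_countable_topology}" and i
    using integral_distr[OF W_meas[of i] that] integrable_distr_eq[OF W_meas[of i] that] by (simp_all add: ident)
  have norm2: "(\<lambda>w. (norm (h w \<theta>))\<^sup>2) \<in> borel_measurable borel" by measurable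
  have S_meas [measurable]: "S n \<in> borel_measurable M" for n unfolding S_def by measurable
  have "\<exists>L. \<forall>n. M.prob {\<omega> \<in> space M. L < norm ((\<Sum>i<n. h (W (Suc i) \<omega>) \<theta>) /\<^sub>R sqrt (real n))} \<le> \<eta> / 2"
  proof (rule M.normalized_sum_tight[OF indep_Suc[OF h_meas]])
    show "M.expectation (\<lambda>\<omega>. h (W (Suc i) \<omega>) \<theta>) = 0" for i using transfer(1)[OF h_meas] mean by simp
    show "integrable M (\<lambda>\<omega>. (norm (h (W (Suc i) \<omega>) \<theta>))\<^sup>2)" for i using transfer(2)[OF norm2] sq by simp
    show "M.expectation (\<lambda>\<omega>. (norm (h (W (Suc i) \<omega>) \<theta>))\<^sup>2) = (\<integral>w. (norm (h w \<theta>))\<^sup>2 \<partial>\<mu>)" for i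
      by (rule transfer(1)[OF norm2])
  qed (use \<open>\<eta> > 0\<close> in simp)
  then obtain L where L: "\<forall>n. M.prob {\<omega> \<in> space M. L < norm (S n \<omega>)} \<le> \<eta> / 2" unfolding S_def by blast
  let ?A = "\<lambda>n w. ennreal (real n powr (\<rho> / 2)) * profile_function c h (empirical_measure n w) \<theta>"
  \<comment> \<open>\<open>good\<close> restates the local bound with the limiting variable
    evaluated at the actual normalised sum instead of the centre \<open>y\<close>; continuity of
    \<open>real_bound\<close> permits this on a smaller neighbourhood.\<close>
  define good where "good y d \<tau> n0 \<Phi> \<longleftrightarrow> d > 0 \<and> \<tau> > 0 \<and> \<Phi> \<in> borel_measurable borel \<and> (\<exists>B. \<forall>w. norm (\<Phi> w) \<le> B) \<and>
    (\<forall>n\<ge>n0. \<forall>w. norm ((\<Sum>i\<in>{1..n}. h (w i) \<theta>) /\<^sub>R sqrt (real n) - y) < d \<longrightarrow>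
       norm ((\<Sum>i\<in>{1..n}. \<Phi> (w i)) /\<^sub>R real n - (\<integral>w. \<Phi> w \<partial>\<mu>)) < \<tau> \<longrightarrow>
       ?A n w \<le> ennreal (real_bound ((\<Sum>i\<in>{1..n}. h (w i) \<theta>) /\<^sub>R sqrt (real n)) + \<epsilon>))"
    for y :: "real ^ 'r" and d \<tau> :: real and n0 :: nat and \<Phi> :: "real ^ 'm \<Rightarrow> (real ^ 'r) \<times> ((real ^ 'r) ^ 'r) \<times> real"
  have "\<exists>d \<tau> n0 \<Phi>. good y d \<tau> n0 \<Phi>" for y
  proof -
    \<comment> \<open>Half of \<open>\<epsilon>\<close> is spent on the local bound, the other half
      on the variation of \<open>real_bound\<close> near \<open>y\<close>.\<close>
    have "real_bound y < real_bound y + \<epsilon> / 2" using \<open>\<epsilon> > 0\<close> by simp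
    then obtain \<delta> \<tau> n0 and \<Phi> :: "real ^ 'm \<Rightarrow> (real ^ 'r) \<times> ((real ^ 'r) ^ 'r) \<times> real"
      where 1: "\<delta> > 0" "\<tau> > 0" "\<Phi> \<in> borel_measurable borel" "\<exists>B. \<forall>w. norm (\<Phi> w) \<le> B"
        "\<forall>n\<ge>n0. \<forall>w. norm ((\<Sum>i\<in>{1..n}. h (w i) \<theta>) /\<^sub>R sqrt (real n) - y) \<le> \<delta> \<longrightarrow>
          norm ((\<Sum>i\<in>{1..n}. \<Phi> (w i)) /\<^sub>R real n - (\<integral>w. \<Phi> w \<partial>\<mu>)) < \<tau> \<longrightarrow>
          ?A n w \<le> ennreal (real_bound y + \<epsilon> / 2)"
      unfolding c_def by (rule profile_function_local_bound[where h = h and \<theta> = \<theta>, OF deriv])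
    have "isCont real_bound y" using continuous_real_bound by (simp add: continuous_on_eq_continuous_at)
    then obtain e where e: "e > 0" "\<forall>x. dist x y < e \<longrightarrow> dist (real_bound x) (real_bound y) < \<epsilon> / 2"
      using half_gt_zero[OF \<open>\<epsilon> > 0\<close>] unfolding continuous_at_eps_delta by blast
    have "?A n w \<le> ennreal (real_bound ((\<Sum>i\<in>{1..n}. h (w i) \<theta>) /\<^sub>R sqrt (real n)) + \<epsilon>)"
      if "n \<ge> n0" and near: "norm ((\<Sum>i\<in>{1..n}. h (w i) \<theta>) /\<^sub>R sqrt (real n) - y) < min \<delta> e"
        and "norm ((\<Sum>i\<in>{1..n}. \<Phi> (w i)) /\<^sub>R real n - (\<integral>w. \<Phi> w \<partial>\<mu>)) < \<tau>" for n w
    proof -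
      have "?A n w \<le> ennreal (real_bound y + \<epsilon> / 2)" using 1(5) that by simp
      also have "dist (real_bound ((\<Sum>i\<in>{1..n}. h (w i) \<theta>) /\<^sub>R sqrt (real n))) (real_bound y) < \<epsilon> / 2"
        using e(2) near by (simp add: dist_norm)
      then have "ennreal (real_bound y + \<epsilon> / 2) \<le> ennreal (real_bound ((\<Sum>i\<in>{1..n}. h (w i) \<theta>) /\<^sub>R sqrt (real n)) + \<epsilon>)"
        unfolding dist_real_def by (intro ennreal_leI) linarith
      finally show ?thesis .
    qed
    then have "good y (min \<delta> e) \<tau> n0 \<Phi>" unfolding good_def using 1(1-4) e(1) by auto
    then show ?thesis by blast
  qed
  then obtain d \<tau> n0 \<Phi> where good: "\<And>y. good y (d y) (\<tau> y) (n0 y) (\<Phi> y)" by metis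
  have goodD: "?A n w \<le> ennreal (real_bound ((\<Sum>i\<in>{1..n}. h (w i) \<theta>) /\<^sub>R sqrt (real n)) + \<epsilon>)"
    if "n0 y \<le> n" "norm ((\<Sum>i\<in>{1..n}. h (w i) \<theta>) /\<^sub>R sqrt (real n) - y) < d y"
      "norm ((\<Sum>i\<in>{1..n}. \<Phi> y (w i)) /\<^sub>R real n - (\<integral>w. \<Phi> y w \<partial>\<mu>)) < \<tau> y" for y n w
    using good[of y] that unfolding good_def by simp
  have "cball 0 L \<subseteq> (\<Union>y\<in>UNIV. ball y (d y))"
  proof
    fix x :: "real ^ 'r"
    show "x \<in> (\<Union>y\<in>UNIV. ball y (d y))"
      using good[of x] by (intro UN_I[of x]) (simp_all add: good_def)
  qed
  then obtain T where T: "finite T" "cball 0 L \<subseteq> (\<Union>y\<in>T. ball y (d y))"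
    by (rule compactE_image[OF compact_cball, rotated]) auto
  define bad where "bad y n = {\<omega> \<in> space M. \<tau> y \<le> norm ((\<Sum>i<n. \<Phi> y (W (Suc i) \<omega>)) /\<^sub>R real n - (\<integral>w. \<Phi> y w \<partial>\<mu>))}" for y n
  have \<Phi>_meas [measurable]: "\<Phi> y \<in> borel_measurable borel" for y using good by (simp add: good_def)
  have bad_sets [measurable]: "bad y n \<in> sets M" for y n unfolding bad_def by measurable
  have "(\<lambda>n. M.prob (bad y n)) \<longlonglongrightarrow> 0" for y
  proof -
    obtain B where B: "\<forall>w. norm (\<Phi> y w) \<le> B" using good[of y] by (auto simp: good_def)
    have "distr M borel (\<lambda>\<omega>. \<Phi> y (W (Suc i) \<omega>)) = distr \<mu> borel (\<Phi> y)" for i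
      unfolding ident[of "Suc i", symmetric] by (subst distr_distr) (auto simp: comp_def)
    from M.weak_law[OF indep_Suc[OF \<Phi>_meas] this, of B "\<tau> y"]
    have "(\<lambda>n. M.prob {\<omega> \<in> space M. \<tau> y \<le> norm ((\<Sum>i<n. \<Phi> y (W (Suc i) \<omega>)) /\<^sub>R real n - (\<integral>x. x \<partial>distr \<mu> borel (\<Phi> y)))}) \<longlonglongrightarrow> 0"
      using B good[of y] by (simp add: good_def)
    moreover have "(\<integral>x. x \<partial>distr \<mu> borel (\<Phi> y)) = (\<integral>w. \<Phi> y w \<partial>\<mu>)"
      by (subst integral_distr) auto
    ultimately show ?thesis by (simp add: bad_def)
  qed
  then have "(\<lambda>n. \<Sum>y\<in>T. M.prob (bad y n)) \<longlonglongrightarrow> (\<Sum>y\<in>T. 0)" by (intro tendsto_sum)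
  then have "\<forall>\<^sub>F n in sequentially. (\<Sum>y\<in>T. M.prob (bad y n)) < \<eta> / 2"
    using \<open>\<eta> > 0\<close> by (intro order_tendstoD(2)[where y = 0]) simp_all
  moreover have "\<forall>\<^sub>F n in sequentially. \<forall>y\<in>T. n0 y \<le> n"
    using T(1) by (intro eventually_ball_finite) (auto intro: eventually_ge_at_top)
  ultimately show ?thesis
  proof eventually_elim
    case (elim n)
    let ?bad = "{\<omega> \<in> space M. ereal (real_bound (S n \<omega>) + \<epsilon>) < enn2ereal (?A n (\<lambda>i. W i \<omega>))}"
    have "?bad \<subseteq> {\<omega> \<in> space M. L < norm (S n \<omega>)} \<union> (\<Union>y\<in>T. bad y n)"
    proof
      fix \<omega> assume \<omega>: "\<omega> \<in> ?bad"
      show "\<omega> \<in> {\<omega> \<in> space M. L < norm (S n \<omega>)} \<union> (\<Union>y\<in>T. bad y n)"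
      proof (rule ccontr)
        assume *: "\<not> ?thesis"
        then have "S n \<omega> \<in> cball 0 L" using \<omega> by auto
        then obtain y where y: "y \<in> T" "norm (S n \<omega> - y) < d y"
          using T(2) by (auto simp: dist_norm norm_minus_commute)
        have sums: "(\<Sum>i\<in>{1..n}. F (W i \<omega>)) = (\<Sum>i<n. F (W (Suc i) \<omega>))" for F :: "real ^ 'm \<Rightarrow> 'c::real_vector"
          by (simp add: sum.atLeast1_atMost_eq)
        have Seq: "(\<Sum>i\<in>{1..n}. h (W i \<omega>) \<theta>) /\<^sub>R sqrt (real n) = S n \<omega>"
          unfolding S_def by (subst sums) simp
        have "norm ((\<Sum>i<n. \<Phi> y (W (Suc i) \<omega>)) /\<^sub>R real n - (\<integral>w. \<Phi> y w \<partial>\<mu>)) < \<tau> y"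
          using * \<omega> y(1) by (auto simp: bad_def)
        then have "norm ((\<Sum>i\<in>{1..n}. \<Phi> y (W i \<omega>)) /\<^sub>R real n - (\<integral>w. \<Phi> y w \<partial>\<mu>)) < \<tau> y"
          by (simp only: sums)
        moreover have "n0 y \<le> n" using elim y(1) by simp
        ultimately have "?A n (\<lambda>i. W i \<omega>) \<le> ennreal (real_bound (S n \<omega>) + \<epsilon>)"
          using goodD[of y n "\<lambda>i. W i \<omega>"] y(2) unfolding Seq by blast
        then have "enn2ereal (?A n (\<lambda>i. W i \<omega>)) \<le> enn2ereal (ennreal (real_bound (S n \<omega>) + \<epsilon>))"
          by (simp only: less_eq_ennreal.rep_eq)
        also have "\<dots> = ereal (real_bound (S n \<omega>) + \<epsilon>)"
          using real_bound_nonneg[of "S n \<omega>"] \<open>\<epsilon> > 0\<close> by (intro enn2ereal_ennreal) simp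
        finally have "enn2ereal (?A n (\<lambda>i. W i \<omega>)) \<le> ereal (real_bound (S n \<omega>) + \<epsilon>)" .
        moreover have "ereal (real_bound (S n \<omega>) + \<epsilon>) < enn2ereal (?A n (\<lambda>i. W i \<omega>))" using \<omega> by blast
        ultimately show False using leD by blast
      qed
    qed
    moreover have m1: "{\<omega> \<in> space M. L < norm (S n \<omega>)} \<in> sets M" by measurable
    moreover have m2: "(\<Union>y\<in>T. bad y n) \<in> sets M" using T(1) by (intro sets.finite_UN) auto
    ultimately have "M.prob ?bad \<le> M.prob ({\<omega> \<in> space M. L < norm (S n \<omega>)} \<union> (\<Union>y\<in>T. bad y n))"
      by (intro M.finite_measure_mono sets.Un)
    also have "\<dots> \<le> M.prob {\<omega> \<in> space M. L < norm (S n \<omega>)} + M.prob (\<Union>y\<in>T. bad y n)"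
      using m1 m2 by (rule measure_Un_le)
    also have "M.prob (\<Union>y\<in>T. bad y n) \<le> (\<Sum>y\<in>T. M.prob (bad y n))"
      using T(1) by (intro M.finite_measure_subadditive_finite) auto
    also have "M.prob {\<omega> \<in> space M. L < norm (S n \<omega>)} + (\<Sum>y\<in>T. M.prob (bad y n)) \<le> \<eta> / 2 + \<eta> / 2"
      using L elim(1) by (intro add_mono) auto
    finally show ?case by simp
  qed
qed

text \<open>The first conjunct is what justifies the word maximum for the limiting variable, since
  \<open>limit_bound\<close> is defined as a supremum.\<close>

theorem theorem3:
  fixes M :: "'a measure" and N :: "'b measure"
    and W :: "nat \<Rightarrow> 'a \<Rightarrow> real ^ 'm" \<comment> \<open>\<open>W 0\<close> is the generic copy, \<open>W 1, W 2, \<dots>\<close> are the samples\<close>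
    and h :: "real ^ 'm \<Rightarrow> real ^ 'l \<Rightarrow> real ^ 'r"
    and Dh :: "real ^ 'm \<Rightarrow> real ^ 'm ^ 'r"
    and \<theta> :: "real ^ 'l"
    and H :: "'b \<Rightarrow> real ^ 'r"
    and p q :: ennreal and \<rho> :: real
    and c :: "real ^ 'm \<Rightarrow> real ^ 'm \<Rightarrow> real"
  assumes "prob_space M"
    and indep: "prob_space.indep_vars M (\<lambda>_. borel) W UNIV"
    and ident: "\<And>i. distr M borel (W i) = distr M borel (W 0)"
    and distinct: "\<And>n. AE \<omega> in M. inj_on (\<lambda>i. W i \<omega>) {1..n}"
    and A1: "c = (\<lambda>u w. lp_norm q (u - w) powr \<rho>)" "q \<ge> 1" "\<rho> \<ge> 1" "1 / p + 1 / q = 1"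
    and A2: "(\<integral>\<omega>. h (W 0 \<omega>) \<theta> \<partial>M) = 0" "integrable M (\<lambda>\<omega>. (norm (h (W 0 \<omega>) \<theta>))\<^sup>2)"
    and A3: "\<And>w. ((\<lambda>w. h w \<theta>) has_derivative (\<lambda>v. Dh w *v v)) (at w)" "continuous_on UNIV Dh"
    and A4: "\<And>\<zeta>. \<zeta> \<noteq> 0 \<Longrightarrow> measure M {\<omega> \<in> space M. lp_norm p (\<zeta> v* Dh (W 0 \<omega>)) > 0} > 0"
    and H: "centered_gaussian_vector N H (second_moment_matrix M (\<lambda>\<omega>. h (W 0 \<omega>) \<theta>))"
  shows "(\<forall>y. limit_bound p \<rho> M (\<lambda>\<omega>. Dh (W 0 \<omega>)) y \<in> limit_values p \<rho> M (\<lambda>\<omega>. Dh (W 0 \<omega>)) y) \<and>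
    asymp_stoch_le
      M (\<lambda>n \<omega>. enn2ereal (ennreal (real n powr (\<rho> / 2)) *
                 profile_function c h (empirical_measure n (\<lambda>i. W i \<omega>)) \<theta>))
      N (\<lambda>\<omega>. limit_bound p \<rho> M (\<lambda>\<omega>. Dh (W 0 \<omega>)) (H \<omega>))"
proof -
  interpret M: prob_space M by fact
  have W_meas [measurable]: "W i \<in> borel_measurable M" for i using indep by (simp add: M.indep_vars_def)
  define \<mu> where "\<mu> = distr M borel (W 0)"
  interpret jacobian_field \<mu> Dh p q \<rho>
  proof (intro jacobian_field.intro jacobian_field_axioms.intro)
    show "prob_space \<mu>" unfolding \<mu>_def by (rule M.prob_space_distr) simp
    show "sets \<mu> = sets borel" by (simp add: \<mu>_def)
    fix \<zeta> :: "real ^ 'r" assume "\<zeta> \<noteq> 0"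
    have "continuous_on UNIV (\<lambda>w. \<zeta> v* Dh w)"
      unfolding vector_matrix_mult_def
      by (intro continuous_on_vec_lambda continuous_on_sum continuous_on_mult continuous_on_component
          continuous_on_const A3(2))
    then have [measurable]: "(\<lambda>w. \<zeta> v* Dh w) \<in> borel_measurable borel" by (rule borel_measurable_continuous_onI)
    have "{w \<in> space borel. lp_norm p (\<zeta> v* Dh w) > 0} \<in> sets borel" by measurable
    then have "measure \<mu> {w \<in> space borel. lp_norm p (\<zeta> v* Dh w) > 0}
        = measure M (W 0 -` {w \<in> space borel. lp_norm p (\<zeta> v* Dh w) > 0} \<inter> space M)"
      unfolding \<mu>_def by (intro measure_distr) simp_all
    also have "W 0 -` {w \<in> space borel. lp_norm p (\<zeta> v* Dh w) > 0} \<inter> space M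
        = {\<omega> \<in> space M. lp_norm p (\<zeta> v* Dh (W 0 \<omega>)) > 0}" by auto
    finally show "measure \<mu> {w. lp_norm p (\<zeta> v* Dh w) > 0} > 0" using A4[OF \<open>\<zeta> \<noteq> 0\<close>] by simp
  qed (fact A1 A3)+
  have values_eq: "limit_values p \<rho> M (\<lambda>\<omega>. Dh (W 0 \<omega>)) = limit_values p \<rho> \<mu> Dh"
    unfolding \<mu>_def by (rule ext, rule limit_values_distr[OF W_meas A3(2)])
  then have bound_eq: "limit_bound p \<rho> M (\<lambda>\<omega>. Dh (W 0 \<omega>)) = limit_bound p \<rho> \<mu> Dh"
    by (simp add: limit_bound_def fun_eq_iff)
  have h_cont: "continuous_on UNIV (\<lambda>w. h w \<theta>)"
    using has_derivative_continuous[OF A3(1)] by (intro continuous_at_imp_continuous_on) simp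
  then have h_meas [measurable]: "(\<lambda>w. h w \<theta>) \<in> borel_measurable borel" by (rule borel_measurable_continuous_onI)
  have ident': "distr M borel (W i) = \<mu>" for i using ident[of i] by (simp add: \<mu>_def)
  \<comment> \<open>The shift by one skips the generic copy \<open>W 0\<close>.\<close>
  define X where "X i \<omega> = h (W (Suc i) \<omega>) \<theta>" for i \<omega>
  have X_eq: "X i = (\<lambda>\<omega>. h (W (Suc i) \<omega>) \<theta>)" for i by (simp add: X_def fun_eq_iff)
  have transfer: "(\<integral>\<omega>. F (W i \<omega>) \<partial>M) = (\<integral>w. F w \<partial>\<mu>)" "integrable M (\<lambda>\<omega>. F (W i \<omega>)) \<longleftrightarrow> integrable \<mu> F"
    if "F \<in> borel_measurable borel" for F :: "real ^ 'm \<Rightarrow> 'c::{banach, second_countable_topology}" and i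
    using integral_distr[OF W_meas[of i] that] integrable_distr_eq[OF W_meas[of i] that] by (simp_all add: ident')
  have norm2: "(\<lambda>w. (norm (h w \<theta>))\<^sup>2) \<in> borel_measurable borel" by measurable
  have mean: "(\<integral>w. h w \<theta> \<partial>\<mu>) = 0" using A2(1) transfer(1)[OF h_meas, of 0] by simp
  have sq: "integrable \<mu> (\<lambda>w. (norm (h w \<theta>))\<^sup>2)" using A2(2) transfer(2)[OF norm2, of 0] by simp
  have indepX: "M.indep_vars (\<lambda>_. borel) X UNIV"
  proof -
    have "M.indep_vars (\<lambda>_. borel) (\<lambda>i. W (Suc i)) UNIV"
      by (rule M.indep_vars_reindex_inj[OF indep]) simp
    then show ?thesis unfolding X_def by (rule M.indep_vars_compose2) simp
  qed
  have identX: "distr M borel (X i) = distr \<mu> borel (\<lambda>w. h w \<theta>)" for i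
    unfolding ident'[of "Suc i", symmetric] X_eq by (subst distr_distr) (auto simp: comp_def)
  have moment: "second_moment_matrix M (\<lambda>\<omega>. h (W 0 \<omega>) \<theta>) = second_moment_matrix M (X 0)"
  proof -
    have [measurable]: "(\<lambda>w. h w \<theta> $ i) \<in> borel_measurable borel" for i
      unfolding cart_eq_inner_axis by measurable
    have "(\<lambda>w. h w \<theta> $ i * h w \<theta> $ j) \<in> borel_measurable borel" for i j by measurable
    from transfer(1)[OF this] show ?thesis by (simp add: second_moment_matrix_def X_def)
  qed
  let ?S = "\<lambda>n \<omega>. (\<Sum>i<n. X i \<omega>) /\<^sub>R sqrt (real n)"
  have "asymp_stoch_le
      M (\<lambda>n \<omega>. enn2ereal (ennreal (real n powr (\<rho> / 2)) *
                 profile_function c h (empirical_measure n (\<lambda>i. W i \<omega>)) \<theta>))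
      N (\<lambda>\<omega>. ereal (real_bound (H \<omega>)))"
  proof (rule asymp_stoch_leI[where S = ?S])
    show "prob_space M" by fact
    show "prob_space N" "H \<in> borel_measurable N" using H by (simp_all add: centered_gaussian_vector_def)
    show "(\<lambda>\<omega>. enn2ereal (ennreal (real n powr (\<rho> / 2)) *
        profile_function c h (empirical_measure n (\<lambda>i. W i \<omega>)) \<theta>)) \<in> borel_measurable M" for n
    \<comment> \<open>For \<open>n = 0\<close> the factor \<open>real n powr (\<rho> / 2)\<close> is
      0, so the function is constant.\<close>
    proof (cases "n = 0")
      case False
      then have [measurable]: "(\<lambda>\<omega>. profile_function c h (empirical_measure n (\<lambda>i. W i \<omega>)) \<theta>) \<in> borel_measurable M"
        unfolding A1(1) by (intro measurable_profile_function A1 W_meas) simp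
      show ?thesis by measurable
    qed simp
    show "?S n \<in> borel_measurable M" for n unfolding X_def by measurable
    show "continuous_on UNIV real_bound" by (rule continuous_real_bound)
    show "(\<lambda>n. M.expectation (\<lambda>\<omega>. g (?S n \<omega>))) \<longlonglongrightarrow> (\<integral>\<omega>. g (H \<omega>) \<partial>N)"
      if "continuous_on UNIV g" "\<And>x. \<bar>g x\<bar> \<le> C" for g :: "real ^ 'r \<Rightarrow> real" and C
    proof (rule M.multivariate_central_limit_theorem[where X = X and g = g and C = C])
      show "M.indep_vars (\<lambda>_. borel) X UNIV" by (rule indepX)
      show "distr M borel (X i) = distr \<mu> borel (\<lambda>w. h w \<theta>)" for i by (rule identX)
      show "continuous_on UNIV g" "\<bar>g x\<bar> \<le> C" for x using that by simp_all
      show "M.expectation (X 0) = 0" unfolding X_eq using transfer(1)[OF h_meas] mean by simp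
      show "integrable M (\<lambda>\<omega>. (norm (X 0 \<omega>))\<^sup>2)" unfolding X_def using transfer(2)[OF norm2] sq by simp
      show "centered_gaussian_vector N H (second_moment_matrix M (X 0))" using H by (simp only: moment)
    qed
    show "\<forall>\<^sub>F n in sequentially. M.prob {\<omega> \<in> space M. ereal (real_bound (?S n \<omega>) + \<epsilon>) <
        enn2ereal (ennreal (real n powr (\<rho> / 2)) * profile_function c h (empirical_measure n (\<lambda>i. W i \<omega>)) \<theta>)} \<le> \<eta>"
      if "\<epsilon> > 0" "\<eta> > 0" for \<epsilon> \<eta>
      unfolding A1(1) X_def
      by (rule profile_function_tail[where h = h and \<theta> = \<theta>, OF \<open>prob_space M\<close> indep ident' A3(1) mean sq that])
  qed simp
  then show ?thesis
    unfolding bound_eq values_eq using limit_bound_attained by (simp add: limit_bound_eq)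
qed

end
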